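(* Let $\Bbbk$ be a field, let $A$ be a finitely generated $\Bbbk$-algebra with a finite Gröbner basis, and let $A'$ be its associated monomial algebra. Let $(B,d')\longrightarrow A'$ be the minimal model of $A'$ described in the context. Then there exists a (possibly non-minimal) model $(B,d)\longrightarrow A$, with the same underlying free graded algebra $B$, such that the associated graded morphism is $(B,d')\longrightarrow A'$. More precisely, it can be arranged that $d-d'$ decreases the order of the underlying monomial of a chain in $B$: for every chain $w$ (a generator of $B$), every basis element (product of chains) appearing in $(d-d')(w)$ has underlying monomial strictly smaller than that of $w$.
   Context: Let $A=TV/(I)$ with $V$ finite dimensional with a basis of variables, and fix a monomial order on the monomials of $TV$ for which the ideal of relations has a finite (reduced) Gröbner basis. The associated monomial algebra $A'$ is the quotient of $TV$ by the ideal generated by the finite set $R$ of leading monomials of the Gröbner basis ($R$ minimal, its elements of length at least $2$). A model of an algebra is a quasi-isomorphism onto it from a quasi-free dg algebra, i.e. one whose underlying graded algebra is free. A monomial is normal if no element of $R$ divides it; normal monomials form a basis of $A'$ and the others vanish in $A'$. For nonempty normal monomials $u,v$, "$uv=0$ minimally" means that $uv=0$ in $A'$ but $uv'\neq0$ in $A'$ for every proper prefix $v'$ of $v$. For $r\geqslant0$, an $r$-chain is a monomial $u_0u_1\cdots u_r$ with $u_0$ a variable, $u_1,\dots,u_r$ nonempty normal monomials, and $u_ju_{j+1}=0$ minimally for $j=0,\ldots,r-1$ (the factorization and $r$ are determined by the monomial). A decomposition of an $r$-chain $\gamma$ is a tuple $(\gamma_1,\ldots,\gamma_n)$, $n\geqslant2$,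 of chains of lengths $r_1,\ldots,r_n$ with $r_1+\cdots+r_n=r-1$ whose concatenation, in this order, is $\gamma$. The minimal model of $A'$: $B=TW$ is the free algebra on the graded space $W$ with basis the chains, an $r$-chain being placed in homological degree $r$, with differential the derivation determined by $d'\gamma=-\sum_{n\geqslant2}\sum(-1)^{\binom{n+1}{2}+r_1+1}\gamma_1\cdots\gamma_n$, the inner sum over decompositions $(\gamma_1,\ldots,\gamma_n)$ of $\gamma$ with $\gamma_1$ an $r_1$-chain; the map $B\to A'$ sends each $0$-chain (variable) to its class and all other chains to $0$. The underlying monomial of a product of chains in $B$ is the monomial of $TV$ obtained by concatenating them; monomials are compared in the chosen monomial order, and the differential $d'$ preserves underlying monomials. $B$ and $A$ are filtered by underlying monomials, and the associated graded morphism is taken with respect to these filtrations (the associated graded algebra of $A$ being $A'$).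
   Formalization: In the sign of d', the binomial coefficient binom(n+1,2) is replaced by n+1, because with the stated sign d' does not square to zero (e.g. R={xyxy}, chain xyxyxyxy, characteristic not 2); the two signs agree for n=2 and n=3. *)

theory Defs
  imports "HOL-Algebra.QuotRing" "HOL-Library.Poly_Mapping" "HOL-Library.Sublist"
begin

section \<open>Free algebras\<close>

text \<open>
  Lists form the free monoid, so that \<open>'s list \<Rightarrow>\<^sub>0 'k\<close> with the convolution product of
  \<^theory>\<open>HOL-Library.Poly_Mapping\<close> is the free associative algebra on the letters \<open>'s\<close>.
\<close>

instantiation list :: (type) monoid_add
begin

definition zero_list_def: "(0 :: 'a list) = []"

definition plus_list_def: "(xs :: 'a list) + ys = xs @ ys"

instance
  by standard (simp_all add: zero_list_def plus_list_def)

end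

type_synonym ('s, 'k) ncpoly = "'s list \<Rightarrow>\<^sub>0 'k"

abbreviation mon :: "'s list \<Rightarrow> ('s, 'k::field) ncpoly"
  where "mon w \<equiv> Poly_Mapping.single w 1"

abbreviation scalar :: "'k::field \<Rightarrow> ('s, 'k) ncpoly"
  where "scalar c \<equiv> Poly_Mapping.single [] c"

lemma mon_Nil [simp]: "mon [] = (1 :: ('s, 'k::field) ncpoly)"
  by (metis single_one zero_list_def)

definition free_algebra :: "'s set \<Rightarrow> ('s, 'k::field) ncpoly ring"
  where "free_algebra S =
    \<lparr>carrier = {f. Poly_Mapping.keys f \<subseteq> lists S}, mult = (*), one = 1, zero = 0, add = (+)\<rparr>"

lemma free_algebra_simps [simp]:
  "f \<in> carrier (free_algebra S) \<longleftrightarrow> Poly_Mapping.keys f \<subseteq> lists S"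
  "mult (free_algebra S) = (*)" "one (free_algebra S) = 1"
  "zero (free_algebra S) = 0" "add (free_algebra S) = (+)"
  by (simp_all add: free_algebra_def)

lemma keys_mult_lists:
  assumes "Poly_Mapping.keys f \<subseteq> lists S" "Poly_Mapping.keys g \<subseteq> lists S"
  shows "Poly_Mapping.keys (f * g :: ('s, 'k::field) ncpoly) \<subseteq> lists S"
  using keys_mult[of f g] assms by (fastforce simp: plus_list_def)

lemma ring_free_algebra: "ring (free_algebra S :: ('s, 'k::field) ncpoly ring)"
proof (rule ringI)
  show "abelian_group (free_algebra S :: ('s, 'k) ncpoly ring)"
  proof (rule abelian_groupI)
    fix f :: "('s, 'k) ncpoly" assume "f \<in> carrier (free_algebra S)"
    then show "\<exists>g\<in>carrier (free_algebra S). g \<oplus>\<^bsub>free_algebra S\<^esub> f = \<zero>\<^bsub>free_algebra S\<^esub>"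
      by (intro bexI[of _ "- f"]) auto
  next
    fix f g :: "('s, 'k) ncpoly"
    assume "f \<in> carrier (free_algebra S)" "g \<in> carrier (free_algebra S)"
    then show "f \<oplus>\<^bsub>free_algebra S\<^esub> g \<in> carrier (free_algebra S)"
      using Poly_Mapping.keys_add[of f g] by auto
  qed (simp_all add: algebra_simps)
  show "monoid (free_algebra S :: ('s, 'k) ncpoly ring)"
  proof (rule monoidI)
    fix f g :: "('s, 'k) ncpoly"
    assume "f \<in> carrier (free_algebra S)" "g \<in> carrier (free_algebra S)"
    then show "f \<otimes>\<^bsub>free_algebra S\<^esub> g \<in> carrier (free_algebra S)"
      by (simp add: keys_mult_lists)
  qed (auto simp: mult.assoc zero_list_def)
qed (simp_all add: algebra_simps)


section \<open>Noncommutative Groebner bases\<close>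

definition monomial_order :: "'x set \<Rightarrow> 'x list rel \<Rightarrow> bool"
  where "monomial_order X r \<longleftrightarrow> well_order_on (lists X) r \<and>
    (\<forall>u v a b. (u, v) \<in> r \<and> a \<in> lists X \<and> b \<in> lists X \<longrightarrow> (a @ u @ b, a @ v @ b) \<in> r)"

definition leading_monomial :: "'x list rel \<Rightarrow> ('x, 'k::field) ncpoly \<Rightarrow> 'x list"
  where "leading_monomial r f =
    (THE m. m \<in> Poly_Mapping.keys f \<and> (\<forall>w\<in>Poly_Mapping.keys f. (w, m) \<in> r))"

definition groebner_basis ::
    "'x list rel \<Rightarrow> ('x, 'k::field) ncpoly set \<Rightarrow> ('x, 'k) ncpoly set \<Rightarrow> bool"
  where "groebner_basis r J G \<longleftrightarrow> G \<subseteq> J - {0} \<and>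
    (\<forall>f\<in>J - {0}. \<exists>g\<in>G. sublist (leading_monomial r g) (leading_monomial r f))"

definition reduced_groebner_basis ::
    "'x list rel \<Rightarrow> ('x, 'k::field) ncpoly set \<Rightarrow> ('x, 'k) ncpoly set \<Rightarrow> bool"
  where "reduced_groebner_basis r J G \<longleftrightarrow> groebner_basis r J G \<and>
    (\<forall>g\<in>G. Poly_Mapping.lookup g (leading_monomial r g) = 1) \<and>
    (\<forall>g\<in>G. \<forall>h\<in>G - {g}. \<forall>w\<in>Poly_Mapping.keys g. \<not> sublist (leading_monomial r h) w)"

definition monomial_ideal :: "'x set \<Rightarrow> 'x list set \<Rightarrow> ('x, 'k::field) ncpoly set"
  where "monomial_ideal X R = Idl\<^bsub>free_algebra X\<^esub> (mon ` R)"

abbreviation cls :: "'x set \<Rightarrow> ('x, 'k::field) ncpoly set \<Rightarrow> ('x, 'k) ncpoly \<Rightarrow> ('x, 'k) ncpoly set"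
  where "cls X J f \<equiv> J +>\<^bsub>free_algebra X\<^esub> f"


section \<open>Chains\<close>

definition normal_word :: "'x list set \<Rightarrow> 'x list \<Rightarrow> bool"
  where "normal_word R w \<longleftrightarrow> \<not> (\<exists>\<rho>\<in>R. sublist \<rho> w)"

text \<open>
  A monomial is zero in the monomial algebra iff it is not normal. This is what allows
  chains, which do not depend on the ground field, to be defined through normality.
\<close>

lemma monomial_vanishes_iff:
  fixes X :: "'x set" and R :: "'x list set"
  assumes R: "R \<subseteq> lists X" and w: "w \<in> lists X"
  shows "cls X (monomial_ideal X R) (mon w :: ('x, 'k::field) ncpoly) =
      \<zero>\<^bsub>free_algebra X Quot monomial_ideal X R\<^esub> \<longleftrightarrow> \<not> normal_word R w"
proof -
  let ?F = "free_algebra X :: ('x, 'k) ncpoly ring"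
  let ?J = "monomial_ideal X R :: ('x, 'k) ncpoly set"
  interpret F: ring ?F by (rule ring_free_algebra)
  have sub: "(mon ` R :: ('x, 'k) ncpoly set) \<subseteq> carrier ?F"
    using R by auto
  interpret J: ideal ?J ?F
    unfolding monomial_ideal_def by (rule F.genideal_ideal[OF sub])
  let ?N = "{f :: ('x, 'k) ncpoly. Poly_Mapping.keys f \<subseteq> {v \<in> lists X. \<not> normal_word R v}}"
  have prod: "f * g \<in> ?N" if "f \<in> carrier ?F" "g \<in> carrier ?F" "f \<in> ?N \<or> g \<in> ?N" for f g
  proof -
    have "v \<in> lists X \<and> \<not> normal_word R v" if v: "v \<in> Poly_Mapping.keys (f * g)" for v
    proof -
      obtain a b where "a \<in> Poly_Mapping.keys f" "b \<in> Poly_Mapping.keys g" "v = a @ b"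
        using keys_mult[of f g] v by (auto simp: plus_list_def)
      then show ?thesis
        using \<open>f \<in> carrier ?F\<close> \<open>g \<in> carrier ?F\<close> \<open>f \<in> ?N \<or> g \<in> ?N\<close>
        by (auto simp: normal_word_def subset_iff)
          (metis sublist_append_leftI sublist_append_rightI sublist_order.order_trans)+
    qed
    then show ?thesis by auto
  qed
  have idN: "ideal ?N ?F"
  proof (rule idealI[OF ring_free_algebra])
    show "subgroup ?N (add_monoid ?F)"
    proof (rule F.add.subgroupI)
      show "?N \<subseteq> carrier ?F"
      proof
        fix f assume "f \<in> ?N"
        then have "Poly_Mapping.keys f \<subseteq> lists X" by blast
        then show "f \<in> carrier ?F" by simp
      qed
      have "0 \<in> ?N" by simp
      then show "?N \<noteq> {}" by blast
    next
      fix f assume "f \<in> ?N"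
      then have "\<ominus>\<^bsub>?F\<^esub> f = - f"
        by (intro F.minus_equality) auto
      then show "\<ominus>\<^bsub>?F\<^esub> f \<in> ?N" using \<open>f \<in> ?N\<close> by simp
    next
      fix f g assume "f \<in> ?N" "g \<in> ?N"
      then show "f \<oplus>\<^bsub>?F\<^esub> g \<in> ?N"
        using Poly_Mapping.keys_add[of f g] by auto
    qed
  next
    fix f g assume fg: "f \<in> ?N" "g \<in> carrier ?F"
    then have "f \<in> carrier ?F" by auto
    then show "g \<otimes>\<^bsub>?F\<^esub> f \<in> ?N" "f \<otimes>\<^bsub>?F\<^esub> g \<in> ?N"
      using prod[of g f] prod[of f g] fg by simp_all
  qed
  have "cls X ?J (mon w) = \<zero>\<^bsub>?F Quot ?J\<^esub> \<longleftrightarrow> mon w \<in> ?J"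
  proof
    assume "cls X ?J (mon w) = \<zero>\<^bsub>?F Quot ?J\<^esub>"
    then show "mon w \<in> ?J"
      using J.a_rcos_self[of "mon w"] w by (auto simp: FactRing_def)
  qed (simp add: FactRing_def J.a_rcos_const)
  also have "\<dots> \<longleftrightarrow> \<not> normal_word R w"
  proof
    assume "(mon w :: ('x, 'k) ncpoly) \<in> ?J"
    moreover have "?J \<subseteq> ?N"
      unfolding monomial_ideal_def
      by (rule F.genideal_minimal[OF idN]) (use R in \<open>auto simp: normal_word_def\<close>)
    ultimately show "\<not> normal_word R w" by auto
  next
    assume "\<not> normal_word R w"
    then obtain \<rho> a b where \<rho>: "\<rho> \<in> R" and eq: "w = a @ \<rho> @ b"
      by (auto simp: normal_word_def sublist_def)
    have "(mon \<rho> :: ('x, 'k) ncpoly) \<in> ?J"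
      unfolding monomial_ideal_def using F.genideal_self[OF sub] \<rho> by auto
    then have "mon a * (mon \<rho> * mon b) \<in> ?J"
      using J.I_l_closed[of "mon \<rho> * mon b" "mon a"] J.I_r_closed[of "mon \<rho>" "mon b"] w eq by simp
    then show "mon w \<in> ?J"
      by (simp add: mult_single plus_list_def eq)
  qed
  finally show ?thesis .
qed

definition minimally_zero :: "'x list set \<Rightarrow> 'x list \<Rightarrow> 'x list \<Rightarrow> bool"
  where "minimally_zero R u v \<longleftrightarrow> \<not> normal_word R (u @ v) \<and>
    (\<forall>v'. strict_prefix v' v \<longrightarrow> normal_word R (u @ v'))"

definition is_chain :: "'x set \<Rightarrow> 'x list set \<Rightarrow> nat \<Rightarrow> 'x list \<Rightarrow> bool"
  where "is_chain X R n \<gamma> \<longleftrightarrow> (\<exists>us. length us = Suc n \<and> concat us = \<gamma> \<and> \<gamma> \<in> lists X \<and>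
    length (us ! 0) = 1 \<and>
    (\<forall>j\<in>{1..n}. us ! j \<noteq> [] \<and> normal_word R (us ! j)) \<and>
    (\<forall>j<n. minimally_zero R (us ! j) (us ! Suc j)))"

definition chains :: "'x set \<Rightarrow> 'x list set \<Rightarrow> 'x list set"
  where "chains X R = {\<gamma>. \<exists>n. is_chain X R n \<gamma>}"

definition chain_degree :: "'x set \<Rightarrow> 'x list set \<Rightarrow> 'x list \<Rightarrow> nat"
  where "chain_degree X R \<gamma> = (THE n. is_chain X R n \<gamma>)"

text \<open>
  The letters of the free algebra on the chains are themselves lists, so its basis elements
  are lists of lists, and the underlying monomial of such a product of chains is its \<open>concat\<close>.
\<close>

definition word_degree :: "'x set \<Rightarrow> 'x list set \<Rightarrow> 'x list list \<Rightarrow> nat"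
  where "word_degree X R gs = sum_list (map (chain_degree X R) gs)"

definition decompositions :: "'x set \<Rightarrow> 'x list set \<Rightarrow> 'x list \<Rightarrow> 'x list list set"
  where "decompositions X R \<gamma> = {gs. 2 \<le> length gs \<and> gs \<in> lists (chains X R) \<and>
    concat gs = \<gamma> \<and> word_degree X R gs + 1 = chain_degree X R \<gamma>}"


section \<open>The minimal model of a monomial algebra\<close>

text \<open>
  On the sign: the binomial coefficient \<open>(n + 1) choose 2\<close> that appears in the literature in
  place of the summand \<open>n + 1\<close> below does not give a differential when a decomposition into at
  least four chains occurs. For \<open>R = {xyxy}\<close> and the \<open>3\<close>-chain \<open>xyxyxyxy\<close> the square of the
  derivation would contain \<open>[x, y, x, y, xyxy]\<close> with a nonzero coefficient, plus or minus \<open>2\<close>.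
  The exponents \<open>(n + 1) choose 2\<close> and \<open>n + 1\<close> have the same parity for \<open>n = 2\<close> and \<open>n = 3\<close>.
\<close>

definition monomial_diff_chain :: "'x set \<Rightarrow> 'x list set \<Rightarrow> 'x list \<Rightarrow> ('x list, 'k::field) ncpoly"
  where "monomial_diff_chain X R \<gamma> =
    - (\<Sum>gs\<in>decompositions X R \<gamma>.
        Poly_Mapping.single gs ((- 1) ^ ((length gs + 1) + chain_degree X R (hd gs) + 1)))"

fun monomial_diff_word :: "'x set \<Rightarrow> 'x list set \<Rightarrow> 'x list list \<Rightarrow> ('x list, 'k::field) ncpoly"
  where
    "monomial_diff_word X R [] = 0"
  | "monomial_diff_word X R (\<gamma> # gs) = monomial_diff_chain X R \<gamma> * mon gs +
       (- 1) ^ chain_degree X R \<gamma> * (mon [\<gamma>] * monomial_diff_word X R gs)"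

definition monomial_diff ::
    "'x set \<Rightarrow> 'x list set \<Rightarrow> ('x list, 'k::field) ncpoly \<Rightarrow> ('x list, 'k) ncpoly"
  where "monomial_diff X R b =
    (\<Sum>w\<in>Poly_Mapping.keys b. scalar (Poly_Mapping.lookup b w) * monomial_diff_word X R w)"

lemma monomial_diff_mon [simp]: "monomial_diff X R (mon w) = monomial_diff_word X R w"
  by (simp add: monomial_diff_def)

lemma monomial_diff_generator:
  "monomial_diff X R (mon [\<gamma>]) = monomial_diff_chain X R \<gamma>"
  by simp

lemma monomial_diff_Leibniz:
  "(monomial_diff X R (mon (v @ w)) :: ('x list, 'k::field) ncpoly) =
     monomial_diff X R (mon v) * mon w +
     (- 1) ^ word_degree X R v * (mon v * monomial_diff X R (mon w))"
proof -
  let ?D = "monomial_diff_word X R :: 'x list list \<Rightarrow> ('x list, 'k) ncpoly"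
  have "?D (v @ w) = ?D v * mon w + (- 1) ^ word_degree X R v * (mon v * ?D w)"
  proof (induction v)
    case Nil
    then show ?case by (simp add: word_degree_def)
  next
    case (Cons \<gamma> v)
    have "mon (v @ w) = mon v * (mon w :: ('x list, 'k) ncpoly)"
      "mon (\<gamma> # v) = mon [\<gamma>] * (mon v :: ('x list, 'k) ncpoly)"
      by (simp_all add: mult_single plus_list_def)
    with Cons show ?case
      by (cases "even (chain_degree X R \<gamma>)"; cases "even (word_degree X R v)")
        (simp_all add: word_degree_def distrib_left distrib_right left_diff_distrib
          right_diff_distrib mult.assoc power_add)
  qed
  then show ?thesis by simp
qed

definition monomial_aug ::
    "'x set \<Rightarrow> 'x list set \<Rightarrow> ('x list, 'k::field) ncpoly \<Rightarrow> ('x, 'k) ncpoly set"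
  where "monomial_aug X R b = cls X (monomial_ideal X R)
    (\<Sum>w\<in>Poly_Mapping.keys b. scalar (Poly_Mapping.lookup b w) *
       prod_list (map (\<lambda>\<gamma>. if is_chain X R 0 \<gamma> then mon \<gamma> else 0) w))"

definition chain_grading :: "'x set \<Rightarrow> 'x list set \<Rightarrow> nat \<Rightarrow> ('x list, 'k::field) ncpoly set"
  where "chain_grading X R n = {b \<in> carrier (free_algebra (chains X R)).
    \<forall>w\<in>Poly_Mapping.keys b. word_degree X R w = n}"


section \<open>Differential graded algebras and models\<close>

text \<open>
  The algebra structure over the ground field of a ring \<open>S\<close> is given by its unit map \<open>\<eta>\<close>, and
  \<open>Gr n\<close> is the homogeneous component of homological degree \<open>n\<close>.
\<close>

definition dg_differential ::
    "'a ring \<Rightarrow> ('k \<Rightarrow> 'a) \<Rightarrow> (nat \<Rightarrow> 'a set) \<Rightarrow> ('a \<Rightarrow> 'a) \<Rightarrow> bool"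
  where "dg_differential S \<eta> Gr d \<longleftrightarrow>
    d \<in> carrier S \<rightarrow> carrier S \<and>
    (\<forall>x\<in>carrier S. \<forall>y\<in>carrier S. d (x \<oplus>\<^bsub>S\<^esub> y) = d x \<oplus>\<^bsub>S\<^esub> d y) \<and>
    (\<forall>c. \<forall>x\<in>carrier S. d (\<eta> c \<otimes>\<^bsub>S\<^esub> x) = \<eta> c \<otimes>\<^bsub>S\<^esub> d x) \<and>
    (\<forall>n. d ` Gr (Suc n) \<subseteq> Gr n) \<and> d ` Gr 0 \<subseteq> {\<zero>\<^bsub>S\<^esub>} \<and>
    (\<forall>n. \<forall>x\<in>Gr n. \<forall>y\<in>carrier S. d (x \<otimes>\<^bsub>S\<^esub> y) = d x \<otimes>\<^bsub>S\<^esub> y \<oplus>\<^bsub>S\<^esub>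
       (if even n then x \<otimes>\<^bsub>S\<^esub> d y else \<ominus>\<^bsub>S\<^esub> (x \<otimes>\<^bsub>S\<^esub> d y))) \<and>
    (\<forall>x\<in>carrier S. d (d x) = \<zero>\<^bsub>S\<^esub>)"

definition dg_hom ::
    "'a ring \<Rightarrow> ('k \<Rightarrow> 'a) \<Rightarrow> (nat \<Rightarrow> 'a set) \<Rightarrow> ('a \<Rightarrow> 'a) \<Rightarrow>
     'b ring \<Rightarrow> ('k \<Rightarrow> 'b) \<Rightarrow> (nat \<Rightarrow> 'b set) \<Rightarrow> ('b \<Rightarrow> 'b) \<Rightarrow> ('a \<Rightarrow> 'b) \<Rightarrow> bool"
  where "dg_hom S \<eta> Gr d S' \<eta>' Gr' d' h \<longleftrightarrow>
    h \<in> ring_hom S S' \<and> (\<forall>c. h (\<eta> c) = \<eta>' c) \<and> (\<forall>n. h ` Gr n \<subseteq> Gr' n) \<and>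
    (\<forall>x\<in>carrier S. h (d x) = d' (h x))"

definition dg_homology ::
    "'a ring \<Rightarrow> (nat \<Rightarrow> 'a set) \<Rightarrow> ('a \<Rightarrow> 'a) \<Rightarrow> nat \<Rightarrow> 'a set set"
  where "dg_homology S Gr d n = (\<lambda>z. d ` Gr (Suc n) +>\<^bsub>S\<^esub> z) ` {z \<in> Gr n. d z = \<zero>\<^bsub>S\<^esub>}"

definition homology_map ::
    "'b ring \<Rightarrow> (nat \<Rightarrow> 'b set) \<Rightarrow> ('b \<Rightarrow> 'b) \<Rightarrow> ('a \<Rightarrow> 'b) \<Rightarrow> nat \<Rightarrow> 'a set \<Rightarrow> 'b set"
  where "homology_map S' Gr' d' h n C = d' ` Gr' (Suc n) <+>\<^bsub>S'\<^esub> h ` C"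

definition quasi_iso ::
    "'a ring \<Rightarrow> (nat \<Rightarrow> 'a set) \<Rightarrow> ('a \<Rightarrow> 'a) \<Rightarrow>
     'b ring \<Rightarrow> (nat \<Rightarrow> 'b set) \<Rightarrow> ('b \<Rightarrow> 'b) \<Rightarrow> ('a \<Rightarrow> 'b) \<Rightarrow> bool"
  where "quasi_iso S Gr d S' Gr' d' h \<longleftrightarrow>
    (\<forall>n. bij_betw (homology_map S' Gr' d' h n) (dg_homology S Gr d n) (dg_homology S' Gr' d' n))"

text \<open>
  An ordinary algebra is a dg algebra concentrated in degree \<open>0\<close>. The underlying graded algebra
  of the model is fixed to be the free algebra on the chains.
\<close>

definition model_on_chains ::
    "'x set \<Rightarrow> 'x list set \<Rightarrow> ('x, 'k::field) ncpoly set \<Rightarrow>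
     (('x list, 'k) ncpoly \<Rightarrow> ('x list, 'k) ncpoly) \<Rightarrow>
     (('x list, 'k) ncpoly \<Rightarrow> ('x, 'k) ncpoly set) \<Rightarrow> bool"
  where "model_on_chains X R J d \<phi> \<longleftrightarrow>
    (let B = free_algebra (chains X R); A = free_algebra X Quot J;
         GrB = chain_grading X R; GrA = (\<lambda>n. if n = 0 then carrier A else {\<zero>\<^bsub>A\<^esub>});
         dA = (\<lambda>_. \<zero>\<^bsub>A\<^esub>)
     in dg_differential B scalar GrB d \<and>
        dg_hom B scalar GrB d A (\<lambda>c. cls X J (scalar c)) GrA dA \<phi> \<and>
        quasi_iso B GrB d A GrA dA \<phi>)"


section \<open>Filtrations by underlying monomials\<close>

text \<open>
  \<open>u\<close> assigns to a basis element its underlying monomial: \<open>concat\<close> for products of chains,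
  and \<open>id\<close> for the monomials in the variables.
\<close>

definition filt_le :: "'x list rel \<Rightarrow> ('s list \<Rightarrow> 'x list) \<Rightarrow> 's set \<Rightarrow> 'x list \<Rightarrow> ('s, 'k::field) ncpoly set"
  where "filt_le r u S m =
    {f \<in> carrier (free_algebra S). \<forall>w\<in>Poly_Mapping.keys f. (u w, m) \<in> r}"

definition filt_less :: "'x list rel \<Rightarrow> ('s list \<Rightarrow> 'x list) \<Rightarrow> 's set \<Rightarrow> 'x list \<Rightarrow> ('s, 'k::field) ncpoly set"
  where "filt_less r u S m =
    {f \<in> carrier (free_algebra S). \<forall>w\<in>Poly_Mapping.keys f. (u w, m) \<in> r \<and> u w \<noteq> m}"

definition homog :: "('s list \<Rightarrow> 'x list) \<Rightarrow> 's set \<Rightarrow> 'x list \<Rightarrow> ('s, 'k::field) ncpoly set"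
  where "homog u S m = {f \<in> carrier (free_algebra S). \<forall>w\<in>Poly_Mapping.keys f. u w = m}"

text \<open>
  The family \<open>\<theta>\<close> identifies the algebra \<open>U\<close>, graded by monomials with components \<open>Uc m\<close>, with the
  associated graded algebra of the filtered algebra \<open>V\<close>, whose components are the quotients of
  \<open>Vle m\<close> by \<open>Vlt m\<close>.
\<close>

definition gr_identification ::
    "'x set \<Rightarrow> 'a ring \<Rightarrow> ('x list \<Rightarrow> 'a set) \<Rightarrow>
     'b ring \<Rightarrow> ('x list \<Rightarrow> 'b set) \<Rightarrow> ('x list \<Rightarrow> 'b set) \<Rightarrow> ('x list \<Rightarrow> 'a \<Rightarrow> 'b set) \<Rightarrow> bool"
  where "gr_identification X U Uc V Vle Vlt \<theta> \<longleftrightarrow>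
    (\<forall>m\<in>lists X. bij_betw (\<theta> m) (Uc m) ((\<lambda>v. Vlt m +>\<^bsub>V\<^esub> v) ` Vle m)) \<and>
    (\<forall>m\<in>lists X. \<forall>x\<in>Uc m. \<forall>y\<in>Uc m. \<theta> m (x \<oplus>\<^bsub>U\<^esub> y) = \<theta> m x <+>\<^bsub>V\<^esub> \<theta> m y) \<and>
    (\<forall>l\<in>lists X. \<forall>m\<in>lists X. \<forall>x\<in>Uc l. \<forall>y\<in>Uc m.
       \<theta> (l @ m) (x \<otimes>\<^bsub>U\<^esub> y) = Vlt (l @ m) <+>\<^bsub>V\<^esub> (\<theta> l x <#>\<^bsub>V\<^esub> \<theta> m y)) \<and>
    \<theta> [] \<one>\<^bsub>U\<^esub> = Vlt [] +>\<^bsub>V\<^esub> \<one>\<^bsub>V\<^esub>"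

definition gr_map :: "'b ring \<Rightarrow> ('x list \<Rightarrow> 'b set) \<Rightarrow> ('a \<Rightarrow> 'b) \<Rightarrow> 'x list \<Rightarrow> 'a set \<Rightarrow> 'b set"
  where "gr_map V Vlt h m C = Vlt m <+>\<^bsub>V\<^esub> h ` C"

text \<open>
  The filtration of \<open>A = TV / J\<close> is the image of that of \<open>TV\<close>. The identification of the monomial
  algebra with the associated graded algebra of \<open>A\<close> sends the class of \<open>c m\<close> in the monomial
  algebra to the class of \<open>c m\<close> in \<open>A\<close> modulo lower terms, for \<open>c\<close> a scalar and \<open>m\<close> a monomial.
\<close>

definition associated_graded_is_monomial_model ::
    "'x set \<Rightarrow> 'x list rel \<Rightarrow> 'x list set \<Rightarrow> ('x, 'k::field) ncpoly set \<Rightarrow>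
     (('x list, 'k) ncpoly \<Rightarrow> ('x list, 'k) ncpoly) \<Rightarrow>
     (('x list, 'k) ncpoly \<Rightarrow> ('x, 'k) ncpoly set) \<Rightarrow> bool"
  where "associated_graded_is_monomial_model X r R J d \<phi> \<longleftrightarrow>
    (let J' = monomial_ideal X R;
         B = free_algebra (chains X R); A = free_algebra X Quot J; A' = free_algebra X Quot J';
         Ble = filt_le r concat (chains X R); Blt = filt_less r concat (chains X R);
         Ale = (\<lambda>m. cls X J ` filt_le r id X m); Alt = (\<lambda>m. cls X J ` filt_less r id X m);
         Bc = homog concat (chains X R); A'c = (\<lambda>m. cls X J' ` homog id X m);
         \<theta>B = (\<lambda>m b. Blt m +>\<^bsub>B\<^esub> b);
         \<theta>A = (\<lambda>m C. Alt m <+>\<^bsub>A\<^esub> cls X J ` (C \<inter> homog id X m))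
     in (\<forall>m\<in>lists X. d ` Ble m \<subseteq> Ble m \<and> d ` Blt m \<subseteq> Blt m \<and>
           \<phi> ` Ble m \<subseteq> Ale m \<and> \<phi> ` Blt m \<subseteq> Alt m) \<and>
        gr_identification X B Bc B Ble Blt \<theta>B \<and>
        gr_identification X A' A'c A Ale Alt \<theta>A \<and>
        (\<forall>m\<in>lists X. \<forall>b\<in>Bc m.
           gr_map B Blt d m (\<theta>B m b) = \<theta>B m (monomial_diff X R b) \<and>
           gr_map A Alt \<phi> m (\<theta>B m b) = \<theta>A m (monomial_aug X R b)))"

end

theory Submission
  imports Defs "HOL-Library.Infinite_Set"
begin

text \<open>
Write \<open>d'\<close> for the differential of the monomial model. It preserves underlying monomials, and the
differential \<open>d\<close> to be found is \<open>d'\<close> plus terms with smaller underlying monomial. Three facts about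
the words of chains carry the proof.

\<^bold>\<open>The square of \<open>d'\<close> is zero.\<close> A term of \<open>d' (d' \<gamma>)\<close> is a word \<open>\<alpha>\<close> of chains together with a block of
consecutive chains of \<open>\<alpha>\<close> that merges to a chain. Let \<open>f s\<close> be the end of the shortest non-normal
subword of \<open>\<gamma>\<close> that starts at position \<open>s\<close>. A chain that starts at \<open>p\<close> has its successive factors end
at \<open>p + 1\<close>, \<open>f p\<close>, \<open>f (p + 1)\<close>, \<open>f (f p)\<close> and so on, so the question is about iterates of one monotone
function. A count of how far each chain of \<open>\<alpha>\<close> advances along this ladder from the start of \<open>\<gamma>\<close> shows
that exactly two blocks merge, with opposite signs (\<open>two_blocks\<close>, \<open>monomial_diff_square\<close>).

\<^bold>\<open>There is an acyclic matching.\<close> A word of chains of degree \<open>0\<close> whose monomial is normal is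
critical. All other words come in pairs \<open>(u, v)\<close>, where \<open>v\<close> arises from \<open>u\<close> by
splitting the last factor of the rightmost chain that allows a change into single letters. The
word \<open>v\<close> occurs in \<open>d' u\<close> with coefficient \<open>1\<close> or \<open>-1\<close>, and any other lower partner in \<open>d' u\<close> has its
change further to the right (\<open>matched_terms\<close>, \<open>matched_coefficient\<close>). Hence, for every \<open>d\<close> with leading
part \<open>d'\<close>, an element can be changed by a boundary until no lower partner occurs in it, without
raising its monomials (\<open>reduce\<close>), and a cycle that consists of upper partners is zero
(\<open>upper_cycle_zero\<close>). So cycles of positive degree bound, with control of the filtration. In degree
\<open>0\<close> the reduced elements are combinations of normal monomials, and such a combination lies in \<open>J\<close>
only if it is zero, which is the defining property of a Groebner basis.

\<^bold>\<open>The differential lifts.\<close> The chains of degree \<open>1\<close> are the leading monomials \<open>\<rho>\<close>, and \<open>d \<rho>\<close> is, up to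
sign, the element of the Groebner basis that \<open>\<rho>\<close> leads. If \<open>d\<close> is known on chains of degree less than
that of \<open>\<gamma>\<close>, then \<open>d (d' \<gamma>)\<close> is a cycle, in degree \<open>0\<close> of the augmented complex if \<open>\<gamma>\<close> has degree \<open>2\<close>, and its
monomials lie strictly below \<open>\<gamma>\<close> because \<open>d' (d' \<gamma>) = 0\<close>. So it is the boundary of some \<open>y\<close> with monomials strictly below \<open>\<gamma>\<close>, and \<open>d \<gamma> = d' \<gamma> - y\<close> continues the
construction (\<open>perturbed_differential\<close>). The exactness above, applied to the finished \<open>d\<close>, shows that
the augmentation is a quasi-isomorphism, and the comparison of leading parts gives the statement
about associated graded objects.
\<close>

section \<open>Ladders of positions\<close>

text \<open>
In the application the function is monotone because subwords of normal words are normal, and the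
bound expresses that relations have length at least two.
\<close>

locale ladder =
  fixes f :: "nat \<Rightarrow> nat"
  assumes mono_f: "mono f" and f_gt: "Suc s < f s"
begin

text \<open>
The ends of the factors of a chain that starts at \<open>p\<close>, when \<open>f s\<close> is the end of the shortest
non-normal subword that starts at \<open>s\<close>: two consecutive factors are zero minimally, so the second
one ends at the value of \<open>f\<close> where the first one starts, which is two rungs below.
\<close>

fun rung :: "nat \<Rightarrow> nat \<Rightarrow> nat" where
  "rung p 0 = p"
| "rung p (Suc 0) = Suc p"
| "rung p (Suc (Suc n)) = f (rung p n)"

text \<open>
The condition for the subword from \<open>p\<close> to \<open>q\<close> to be a chain of degree \<open>r\<close>. The two inequalities say
that its last factor is nonempty and normal; they imply the same for the other factors.
\<close>

definition link :: "nat \<Rightarrow> nat \<Rightarrow> nat \<Rightarrow> bool"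
  where "link p q r \<longleftrightarrow> q = rung p (r + 1) \<and> rung p r < q \<and> q < rung p (r + 2)"

lemma rung_shift: "rung p (n + 2 * k) = (f ^^ k) (rung p n)"
  by (induction k) auto

lemma mono_funpow: "x \<le> y \<Longrightarrow> (f ^^ k) x \<le> (f ^^ k) y"
  using mono_f by (metis funpow_mono)

lemma rung_le_Suc: "rung p n \<le> rung p (Suc n)"
proof (induction p n rule: rung.induct)
  case (2 p)
  then show ?case using f_gt[of p] by simp
next
  case (3 p n)
  then show ?case using mono_f by (simp add: monoD)
qed simp

lemma rung_mono: "m \<le> n \<Longrightarrow> rung p m \<le> rung p n"
  by (rule lift_Suc_mono_le[of "rung p"]) (rule rung_le_Suc)

lemma rung_less_imp: "rung p m < rung p n \<Longrightarrow> m < n"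
  using rung_mono by (metis leD leI)

lemma rung_merge:
  assumes "rung p n = rung p (Suc n)"
  shows "rung p (n + 2 * k) = rung p (Suc (n + 2 * k))"
  using assms rung_shift[of p n k] rung_shift[of p "Suc n" k] by simp

text \<open>
An equality of two neighbouring rungs is passed on two rungs upwards by applying \<open>f\<close>. So strict
inequalities at two consecutive places exclude equalities at all earlier ones.
\<close>

lemma link_strict:
  assumes "link p q r" "n \<le> Suc r"
  shows "rung p n < rung p (Suc n)"
proof (rule ccontr)
  assume "\<not> ?thesis"
  then have eq: "rung p n = rung p (Suc n)" using rung_le_Suc[of p n] by simp
  have "\<exists>k. n + 2 * k = r \<or> n + 2 * k = Suc r"
    using assms(2) by presburger
  then obtain k where "n + 2 * k = r \<or> n + 2 * k = Suc r" ..
  then show False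
    using rung_merge[OF eq, of k] assms(1) by (auto simp: link_def)
qed

declare rung.simps(3) [simp del]

lemma link_less: "link p q r \<Longrightarrow> p < q"
  using rung_mono[of 0 r p] by (auto simp: link_def)

lemma link_degree_unique: "link p q r \<Longrightarrow> link p q r' \<Longrightarrow> r = r'"
  unfolding link_def by (metis Suc_eq_plus1 add_2_eq_Suc' less_Suc_eq_le nat_neq_iff not_less_eq
    rung_less_imp rung_mono)

lemma link_even:
  assumes "link p q r" "even r"
  shows "q = (f ^^ (r div 2)) (Suc p)" "(f ^^ (r div 2)) p < q"
  using assms rung_shift[of p 1 "r div 2"] rung_shift[of p 0 "r div 2"] by (auto simp: link_def)

lemma link_odd:
  assumes "link p q r" "odd r"
  shows "q = (f ^^ (Suc r div 2)) p" "q < (f ^^ (Suc r div 2)) (Suc p)"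
proof -
  have "2 * (Suc r div 2) = Suc r" using assms(2) by simp
  then show "q = (f ^^ (Suc r div 2)) p" "q < (f ^^ (Suc r div 2)) (Suc p)"
    using assms rung_shift[of p 0 "Suc r div 2"] rung_shift[of p 1 "Suc r div 2"]
    by (auto simp: link_def)
qed

text \<open>
The next four lemmas compare a link with a ladder that starts elsewhere. A link of even degree
is an iterate of \<open>f\<close> at the successor of its start, a link of odd degree is an iterate at the
start itself; so the former moves strictly beyond a rung that it starts on, while the latter may
stay on the ladder.
\<close>

lemma link_even_above:
  assumes "link q q' r" "even r" "rung p m \<le> q"
  shows "rung p (m + r) < q'"
proof -
  have "rung p (m + r) = (f ^^ (r div 2)) (rung p m)"
    using rung_shift[of p m "r div 2"] assms(2) by simp
  also have "\<dots> \<le> (f ^^ (r div 2)) q" by (rule mono_funpow) fact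
  also have "\<dots> < q'" by (rule link_even) fact+
  finally show ?thesis .
qed

lemma link_even_below:
  assumes "link q q' r" "even r" "q < rung p m"
  shows "q' \<le> rung p (m + r)"
proof -
  have "q' = (f ^^ (r div 2)) (Suc q)" by (rule link_even) fact+
  also have "\<dots> \<le> (f ^^ (r div 2)) (rung p m)" by (rule mono_funpow) (use assms in simp)
  also have "\<dots> = rung p (m + r)"
    using rung_shift[of p m "r div 2"] assms(2) by simp
  finally show ?thesis .
qed

lemma link_odd_above:
  assumes "link q q' r" "odd r" "rung p m \<le> q"
  shows "rung p (m + r + 1) \<le> q'"
proof -
  have "2 * (Suc r div 2) = Suc r" using assms(2) by simp
  then have "rung p (m + r + 1) = (f ^^ (Suc r div 2)) (rung p m)"
    using rung_shift[of p m "Suc r div 2"] by simp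
  also have "\<dots> \<le> (f ^^ (Suc r div 2)) q" by (rule mono_funpow) fact
  finally show ?thesis using link_odd[OF assms(1,2)] by simp
qed

lemma link_odd_below:
  assumes "link q q' r" "odd r" "q < rung p m"
  shows "q' < rung p (m + r + 1)"
proof -
  have "q' < (f ^^ (Suc r div 2)) (Suc q)" by (rule link_odd) fact+
  also have "\<dots> \<le> (f ^^ (Suc r div 2)) (rung p m)" by (rule mono_funpow) (use assms in simp)
  also have "2 * (Suc r div 2) = Suc r" using assms(2) by simp
  then have "(f ^^ (Suc r div 2)) (rung p m) = rung p (m + r + 1)"
    using rung_shift[of p m "Suc r div 2"] by simp
  finally show ?thesis .
qed

text \<open>
The rungs of even index are iterates of \<open>f\<close> at the foot of a ladder, and the end of a link is a rung
of the ladder at its start.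
\<close>

lemma rung_link_even:
  assumes "link p q r" "even m"
  shows "rung q m = rung p (r + 1 + m)"
proof -
  have "rung q m = (f ^^ (m div 2)) q" using rung_shift[of q 0 "m div 2"] assms(2) by simp
  also have "\<dots> = rung p (r + 1 + m)"
    using rung_shift[of p "r + 1" "m div 2"] assms by (simp add: link_def)
  finally show ?thesis .
qed

lemma rung_even_ge: "rung p n \<le> q \<Longrightarrow> even m \<Longrightarrow> rung p (n + m) \<le> rung q m"
  using rung_shift[of q 0 "m div 2"] rung_shift[of p n "m div 2"] mono_funpow by simp

lemma rung_odd_ge: "rung p n \<le> q \<Longrightarrow> odd m \<Longrightarrow> rung p (n + m - 1) \<le> rung q m"
  using rung_even_ge[of p n q "m - 1"] rung_le_Suc[of q "m - 1"] by (cases m) auto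

lemma rung_odd_le:
  assumes "q < rung p n" "odd m"
  shows "rung q m \<le> rung p (n + m - 1)"
proof -
  obtain k where m: "m = 1 + 2 * k" using assms(2) by (metis oddE add.commute)
  show ?thesis
    using rung_shift[of q 1 k] rung_shift[of p n k] mono_funpow[of "Suc q" "rung p n" k] assms(1)
    by (simp add: m)
qed

end


text \<open>
A path of links stands for a word of chains with a fixed underlying monomial.
\<close>

locale ladder_path = ladder +
  fixes N :: nat and q :: "nat \<Rightarrow> nat" and rr :: "nat \<Rightarrow> nat"
  assumes links: "k < N \<Longrightarrow> link (q k) (q (Suc k)) (rr k)"
begin

definition S :: "nat \<Rightarrow> nat" where "S k = sum rr {..<k}"

lemma S_Suc: "S (Suc k) = S k + rr k" by (simp add: S_def)

lemma S_0: "S 0 = 0" by (simp add: S_def)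

lemma S_mono: "i \<le> k \<Longrightarrow> S i \<le> S k"
  unfolding S_def by (rule sum_mono2) auto

lemma q_mono: "i \<le> k \<Longrightarrow> k \<le> N \<Longrightarrow> q i \<le> q k"
proof (induction k)
  case (Suc k)
  then show ?case using link_less[OF links[of k]] by (cases "i = Suc k") auto
qed simp

lemma S_parity:
  assumes "\<And>m. i \<le> m \<Longrightarrow> m < k \<Longrightarrow> even (rr m)" "i \<le> k"
  shows "even (S k - S i)"
  using assms(2,1)
proof (induction k rule: dec_induct)
  case (step n)
  then show ?case using S_mono[of i n] by (simp add: S_Suc)
qed simp

lemma even_links_above:
  assumes "\<And>m. i \<le> m \<Longrightarrow> m < k \<Longrightarrow> even (rr m)" "i \<le> k" "k \<le> N" "rung p n \<le> q i"
  shows "rung p (n + (S k - S i)) \<le> q k \<and> (i < k \<longrightarrow> rung p (n + (S k - S i)) < q k)"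
  using assms(2,1,3)
proof (induction k rule: dec_induct)
  case (step k)
  have "rung p (n + (S k - S i) + rr k) < q (Suc k)"
    by (rule link_even_above[OF links]) (use step in auto)
  then show ?case using S_mono[of i k] step by (simp add: S_Suc add.assoc)
qed (use assms in simp)

definition block :: "nat \<Rightarrow> nat \<Rightarrow> bool"
  where "block i k \<longleftrightarrow> i + 2 \<le> k \<and> k \<le> N \<and> link (q i) (q k) (S k - S i + 1)"

text \<open>
The index is normalized so that the pair \<open>(i, k)\<close> is a block iff \<open>q k\<close> is the middle one of three
distinct rungs \<open>F i k 1\<close>, \<open>F i k 2\<close>, \<open>F i k 3\<close> of the ladder from \<open>q i\<close>, and so that passing from \<open>i\<close> to
its successor shifts the index by one.
\<close>

definition F :: "nat \<Rightarrow> nat \<Rightarrow> nat \<Rightarrow> nat"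
  where "F i k x = rung (q i) (S k - S i + x)"

lemma F_mono: "x \<le> y \<Longrightarrow> F i k x \<le> F i k y"
  unfolding F_def by (rule rung_mono) simp

lemma block_F: "block i k \<longleftrightarrow> i + 2 \<le> k \<and> k \<le> N \<and> q k = F i k 2 \<and> F i k 1 < q k \<and> q k < F i k 3"
  by (simp add: block_def link_def F_def numeral_3_eq_3 numeral_2_eq_2)

lemma F_shift:
  assumes "Suc i \<le> k" "k \<le> N" "even (S k - S (Suc i) + x)"
  shows "F (Suc i) k x = F i k (x + 1)"
proof -
  have "F (Suc i) k x = rung (q i) (rr i + 1 + (S k - S (Suc i) + x))"
    unfolding F_def by (rule rung_link_even[OF links assms(3)]) (use assms in simp)
  then show ?thesis
    using S_mono[OF assms(1)] by (simp add: F_def S_Suc add.commute add.left_commute)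
qed

text \<open>
Once a path is two rungs ahead of the total degree, it never again meets the middle rung: an even
link goes strictly beyond it and an odd link goes to the next rung at least.
\<close>

lemma overshoot:
  assumes "\<And>m. k \<le> m \<Longrightarrow> m < l \<Longrightarrow> even (rr m)" "k \<le> l" "l < N" "i \<le> k"
    and "rung (q i) (S k - S i + 2) \<le> q k"
  shows "\<not> block i (Suc l)"
proof -
  have "rung (q i) (S k - S i + 2 + (S l - S k)) \<le> q l"
    using even_links_above[of k l "q i" "S k - S i + 2"] assms by simp
  moreover have "S k - S i + 2 + (S l - S k) = S l - S i + 2"
    using S_mono[of i k] S_mono[of k l] assms by simp
  ultimately have le: "rung (q i) (S l - S i + 2) \<le> q l" by simp
  have S: "S (Suc l) - S i = S l - S i + rr l" using S_mono[of i l] assms by (simp add: S_Suc)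
  show ?thesis
  proof (cases "even (rr l)")
    case True
    then have "F i (Suc l) 2 < q (Suc l)"
      using link_even_above[OF links[OF \<open>l < N\<close>] True le] by (simp add: F_def S add.commute add.left_commute)
    then show ?thesis by (auto simp: block_F)
  next
    case False
    then have "F i (Suc l) 3 \<le> q (Suc l)"
      using link_odd_above[OF links[OF \<open>l < N\<close>] False le]
      by (simp add: F_def S add.commute add.left_commute numeral_3_eq_3)
    then show ?thesis by (auto simp: block_F)
  qed
qed

lemma F_last:
  assumes "k < N"
  shows "F k (Suc k) 1 = q (Suc k)" "F k (Suc k) 0 < q (Suc k)" "q (Suc k) < F k (Suc k) 2"
proof -
  have "F k (Suc k) x = rung (q k) (rr k + x)" for x by (simp add: F_def S_Suc)
  note * = this[of 1] this[of 0, simplified] this[of 2]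
  have "q (Suc k) = rung (q k) (rr k + 1)" "rung (q k) (rr k) < q (Suc k)"
      "q (Suc k) < rung (q k) (rr k + 2)"
    using links[OF assms, unfolded link_def] by blast+
  then show "F k (Suc k) 1 = q (Suc k)" "F k (Suc k) 0 < q (Suc k)" "q (Suc k) < F k (Suc k) 2"
    by (simp_all only: *)
qed

end

text \<open>
The total degree of a term of the square of the differential is two less than the degree of the
chain that it comes from.
\<close>

locale ladder_double = ladder_path +
  assumes whole: "link (q 0) (q N) (S N + 2)"
begin

abbreviation c :: "nat \<Rightarrow> nat" where "c \<equiv> rung (q 0)"

lemma c_strict: "n \<le> S N + 3 \<Longrightarrow> c n < c (Suc n)"
  using link_strict[OF whole, of n] by simp

lemma q_N: "q N = c (S N + 3)" and c_above: "q N < c (S N + 4)"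
proof -
  have *: "S N + 2 + 1 = S N + 3" "S N + 2 + 2 = S N + 4" by simp_all
  show "q N = c (S N + 3)" "q N < c (S N + 4)"
    using whole[unfolded link_def *] by blast+
qed

lemma c_bound: "c n \<le> q k \<Longrightarrow> k \<le> N \<Longrightarrow> n \<le> S N + 3"
  using q_mono[of k N] c_above rung_less_imp[of "q 0" n "S N + 4"] by fastforce

definition level :: "nat \<Rightarrow> nat" where "level k = (LEAST n. q k < c (Suc n))"

lemma level_eqI: "c n \<le> q k \<Longrightarrow> q k < c (Suc n) \<Longrightarrow> level k = n"
  unfolding level_def
proof (rule Least_equality)
  fix n' assume "c n \<le> q k" "q k < c (Suc n')"
  then have "c n < c (Suc n')" by (rule le_less_trans)
  then show "n \<le> n'" using rung_less_imp by fastforce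
qed

lemma level_bounds:
  assumes "k \<le> N"
  shows "c (level k) \<le> q k" "q k < c (Suc (level k))"
proof -
  have ex: "q k < c (Suc (S N + 3))" using q_mono[OF assms] c_above by (simp add: numeral_eq_Suc)
  show "q k < c (Suc (level k))" unfolding level_def by (rule LeastI[of _ "S N + 3"]) fact
  show "c (level k) \<le> q k"
  proof (cases "level k")
    case 0
    then show ?thesis using q_mono[of 0 k] assms by simp
  next
    case (Suc n)
    then show ?thesis using not_less_Least[of n "\<lambda>n. q k < c (Suc n)"] by (simp add: level_def)
  qed
qed

lemma level_0: "level 0 = 0"
  by (rule level_eqI) auto

lemma level_N: "level N = S N + 3"
  by (rule level_eqI) (use q_N c_above in \<open>simp_all add: numeral_eq_Suc\<close>)

text \<open>
A link of degree \<open>r\<close> climbs \<open>r\<close> or \<open>r + 1\<close> levels. A link of odd degree climbs \<open>r + 1\<close>. A link of even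
degree climbs \<open>r\<close> and ends strictly between two rungs, or it climbs \<open>r + 1\<close> and ends on a rung.
\<close>

lemma level_step:
  assumes "k < N"
  shows "level (Suc k) = level k + rr k \<and> even (rr k) \<and> c (level k + rr k) < q (Suc k) \<or>
    level (Suc k) = level k + rr k + 1 \<and> (even (rr k) \<longrightarrow> q (Suc k) = c (level k + rr k + 1))"
proof (cases "even (rr k)")
  case True
  have lo: "c (level k + rr k) < q (Suc k)"
    by (rule link_even_above[OF links[OF assms] True level_bounds(1)]) (use assms in simp)
  have hi: "q (Suc k) \<le> c (Suc (level k) + rr k)"
    by (rule link_even_below[OF links[OF assms] True level_bounds(2)]) (use assms in simp)
  show ?thesis
  proof (cases "q (Suc k) = c (Suc (level k) + rr k)")
    case eq: True
    then have "level k + rr k + 1 \<le> S N + 3" using c_bound[of _ "Suc k"] assms by simp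
    then have "level (Suc k) = level k + rr k + 1"
      by (intro level_eqI) (use eq c_strict[of "level k + rr k + 1"] in simp_all)
    then show ?thesis using eq by simp
  next
    case False
    then have "level (Suc k) = level k + rr k" by (intro level_eqI) (use lo hi in simp_all)
    then show ?thesis using lo True by simp
  qed
next
  case False
  have "c (level k + rr k + 1) \<le> q (Suc k)"
    by (rule link_odd_above[OF links[OF assms] False level_bounds(1)]) (use assms in simp)
  moreover have "q (Suc k) < c (Suc (level k) + rr k + 1)"
    by (rule link_odd_below[OF links[OF assms] False level_bounds(2)]) (use assms in simp)
  ultimately have "level (Suc k) = level k + rr k + 1" by (intro level_eqI) simp_all
  then show ?thesis using False by simp
qed

lemma N_pos: "0 < N"
  using whole link_less by (metis gr0I less_irrefl)

lemma level_1: "level 1 = S 1 + 1"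
proof -
  have "link (q 0) (q 1) (S 1)" using links[OF N_pos] by (simp add: S_def)
  then have l: "q 1 = c (S 1 + 1)" "q 1 < c (S 1 + 2)" unfolding link_def by blast+
  have "S 1 + 2 = Suc (S 1 + 1)" by simp
  with l show ?thesis by (intro level_eqI) (metis order_refl, metis)
qed

lemma level_Suc_ge: "k < N \<Longrightarrow> level k + rr k \<le> level (Suc k)"
  using level_step[of k] by linarith

lemma level_ge: "k \<le> N \<Longrightarrow> S k \<le> level k"
proof (induction k)
  case (Suc k)
  then show ?case using level_Suc_ge[of k] by (simp add: S_Suc)
qed (simp add: S_0)

lemma excess_mono: "i \<le> k \<Longrightarrow> k \<le> N \<Longrightarrow> level i - S i \<le> level k - S k"
proof (induction k rule: dec_induct)
  case (step k)
  then show ?case using level_Suc_ge[of k] level_ge[of k] by (simp add: S_Suc)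
qed simp

lemma level_last: "level (N - 1) = S (N - 1) + 2"
proof -
  obtain M where M: "N = Suc M" using N_pos by (cases N) auto
  have "level N \<noteq> level M + rr M"
  proof
    assume eq: "level N = level M + rr M"
    then have "c (level N) < q N" using level_step[of M] unfolding M by auto
    then show False using q_N level_N by simp
  qed
  then have "level N = level M + rr M + 1" using level_step[of M] unfolding M by auto
  moreover have "S N = S M + rr M" using S_Suc[of M] M by simp
  ultimately have "level M = S M + 2" using level_N by linarith
  then show ?thesis using M by simp
qed

text \<open>
The path climbs \<open>S N + 3\<close> levels, so exactly three links climb one level more than their degree. The
first link does, as it starts on the ladder; the last link does, as it ends on a rung. The third
one is the link at place \<open>j\<close>.
\<close>

lemma turning_point:
  obtains j where "1 \<le> j" "j + 2 \<le> N"
    "\<And>k. 1 \<le> k \<Longrightarrow> k \<le> j \<Longrightarrow> level k = S k + 1"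
    "\<And>k. j < k \<Longrightarrow> k < N \<Longrightarrow> level k = S k + 2"
proof -
  define j where "j = (LEAST j. 2 \<le> level (Suc j) - S (Suc j))"
  have N2: "2 \<le> N"
  proof (rule ccontr)
    assume "\<not> 2 \<le> N"
    then have "N - 1 = 0" using N_pos by simp
    then show False using level_last level_0 S_0 by simp
  qed
  then have "2 \<le> level (Suc (N - 2)) - S (Suc (N - 2))"
    using level_last by (simp add: numeral_2_eq_2 Suc_diff_Suc)
  then have j: "2 \<le> level (Suc j) - S (Suc j)" and jN: "j \<le> N - 2"
    unfolding j_def by (rule LeastI, rule Least_le)
  have least: "level (Suc i) - S (Suc i) < 2" if "i < j" for i
    using not_less_Least[of i "\<lambda>j. 2 \<le> level (Suc j) - S (Suc j)"] that by (simp add: j_def)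
  have "j \<noteq> 0"
  proof
    assume "j = 0"
    then have "2 \<le> level 1 - S 1" using j by simp
    then show False using level_1 by simp
  qed
  show ?thesis
  proof (rule that[of j])
    show "1 \<le> j" "j + 2 \<le> N" using \<open>j \<noteq> 0\<close> jN N2 by simp_all
    show "level k = S k + 1" if "1 \<le> k" "k \<le> j" for k
    proof -
      have "level k - S k < 2" using least[of "k - 1"] that by simp
      moreover have "level 1 - S 1 \<le> level k - S k" using excess_mono[of 1 k] that jN N2 by simp
      ultimately show ?thesis using level_1 by linarith
    qed
    show "level k = S k + 2" if "j < k" "k < N" for k
    proof -
      have "level (Suc j) - S (Suc j) \<le> level k - S k" using excess_mono[of "Suc j" k] that by simp
      moreover have "level k - S k \<le> level (N - 1) - S (N - 1)"
        using excess_mono[of k "N - 1"] that by simp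
      ultimately show ?thesis using j level_last by linarith
    qed
  qed
qed

end

text \<open>
All links other than the first one, the last one and the one at place \<open>j\<close> have even degree and end
strictly between two rungs.
\<close>

locale ladder_turn = ladder_double +
  fixes j :: nat
  assumes j_pos: "1 \<le> j" and j_N: "j + 2 \<le> N"
    and level_before: "\<And>k. 1 \<le> k \<Longrightarrow> k \<le> j \<Longrightarrow> level k = S k + 1"
    and level_after: "\<And>k. j < k \<Longrightarrow> k < N \<Longrightarrow> level k = S k + 2"
begin

lemma before:
  assumes "1 \<le> k" "k \<le> j"
  shows "c (S k + 1) \<le> q k" "q k < c (S k + 2)"
  using level_bounds[of k] level_before[OF assms] assms j_N by simp_all

lemma after:
  assumes "j < k" "k < N"
  shows "c (S k + 2) \<le> q k" "q k < c (S k + 3)"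
  using level_bounds[of k] level_after[OF assms] assms by (simp_all add: numeral_3_eq_3)

lemma q_ge: "1 \<le> k \<Longrightarrow> k < N \<Longrightarrow> c (S k + 1) \<le> q k"
  using before(1)[of k] after(1)[of k] rung_mono[of "S k + 1" "S k + 2" "q 0"] by fastforce

lemma q_less: "1 \<le> k \<Longrightarrow> k \<le> N \<Longrightarrow> q k < c (S k + 4)"
  using before(2)[of k] after(2)[of k] c_above rung_mono[of "S k + 2" "S k + 4" "q 0"]
    rung_mono[of "S k + 3" "S k + 4" "q 0"]
  by (cases "k = N"; cases "k \<le> j") auto

lemma even_degree:
  assumes "1 \<le> k" "Suc k < N" "k \<noteq> j"
  shows "even (rr k)" "c (level k + rr k) < q (Suc k)"
proof -
  have "level (Suc k) = level k + rr k"
    using level_before[of k] level_before[of "Suc k"] level_after[of k] level_after[of "Suc k"] assms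
    by (cases "k < j") (simp_all add: S_Suc)
  then show "even (rr k)" "c (level k + rr k) < q (Suc k)"
    using level_step[of k] assms by auto
qed

lemma after_strict:
  assumes "j + 1 < k" "k < N"
  shows "c (S k + 2) < q k"
  using even_degree(2)[of "k - 1"] level_after[of "k - 1"] S_Suc[of "k - 1"] assms
  by (simp add: add.commute add.left_commute)

lemma turn_even:
  assumes "even (rr j)"
  shows "q (Suc j) = c (S (Suc j) + 2)"
  using level_step[of j] level_before[of j] level_after[of "Suc j"] assms j_pos j_N
  by (auto simp: S_Suc)

lemma parity_before: "1 \<le> k \<Longrightarrow> k \<le> j \<Longrightarrow> even (S k) = even (S 1)"
  using S_parity[of 1 k] even_degree(1) S_mono[of 1 k] j_N by auto

lemma parity_all:
  assumes "even (rr j)" "1 \<le> k" "k < N"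
  shows "even (S k) = even (S 1)"
proof -
  have "even (rr m)" if "1 \<le> m" "m < k" for m
    using even_degree(1)[of m] that assms by (cases "m = j") auto
  then have "even (S k - S 1)" using S_parity[of 1 k] assms by simp
  then show ?thesis using S_mono[of 1 k] assms by simp
qed

lemma F_ge_even:
  assumes "c (S i + a) \<le> q i" "i \<le> k" "even (S k - S i + x)" "m = S k + a + x"
  shows "c m \<le> F i k x"
  using rung_even_ge[OF assms(1,3)] S_mono[OF assms(2)] assms(4)
  by (simp add: F_def add.assoc add.left_commute)

lemma F_ge_odd:
  assumes "c (S i + a) \<le> q i" "i \<le> k" "odd (S k - S i + x)" "Suc m = S k + a + x"
  shows "c m \<le> F i k x"
proof -
  have "S i + a + (S k - S i + x) - 1 = m" using S_mono[OF assms(2)] assms(4) by simp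
  then show ?thesis using rung_odd_ge[OF assms(1,3)] by (simp add: F_def)
qed

lemma F_le_odd:
  assumes "q i < c (S i + a)" "i \<le> k" "odd (S k - S i + x)" "Suc m = S k + a + x"
  shows "F i k x \<le> c m"
proof -
  have "S i + a + (S k - S i + x) - 1 = m" using S_mono[OF assms(2)] assms(4) by simp
  then show ?thesis using rung_odd_le[OF assms(1,3)] by (simp add: F_def)
qed

lemma F_0: "F 0 k x = c (S k + x)"
  by (simp add: F_def S_0)

text \<open>
Merging requires one extra level, and before the turning point none has been gained since the
first link.
\<close>

lemma block_end_ge:
  assumes "block i k"
  shows "j < k"
proof (rule ccontr)
  assume "\<not> j < k"
  then have k: "k \<le> j" by simp
  from assms have b: "i + 2 \<le> k" "q k = F i k 2" by (auto simp: block_F)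
  have "c (S k + 2) \<le> F i k 2"
  proof (cases "i = 0")
    case False
    then have i: "c (S i + 1) \<le> q i" "i \<le> k" using before(1)[of i] b k by auto
    show ?thesis
    proof (cases "even (S k - S i + 2)")
      case True
      then have "c (S k + 3) \<le> F i k 2" by (rule F_ge_even[OF i]) simp
      then show ?thesis using rung_mono[of "S k + 2" "S k + 3" "q 0"] by simp
    next
      case False
      then show ?thesis by (rule F_ge_odd[OF i]) simp
    qed
  qed (simp add: F_0)
  then show False using before(2)[of k] b k by simp
qed

text \<open>
A block from the start of the path would end on rung \<open>S k + 2\<close>, which the path has passed by then.
For a start after the turning point, either the middle rung lies beyond the path or the bottom rung
is not below its end.
\<close>

lemma late_block_start:
  assumes "block i k" "Suc j < k"
  shows "1 \<le> i" "i \<le> j"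
proof -
  from assms have b: "i + 2 \<le> k" "k \<le> N" "q k = F i k 2" "F i k 1 < q k" by (auto simp: block_F)
  show "1 \<le> i"
  proof (rule ccontr)
    assume "\<not> 1 \<le> i"
    then have "i = 0" by simp
    then have "q k = c (S k + 2)" using b(3) F_0 by simp
    then show False
      using after_strict[of k] assms(2) b(2) q_N c_strict[of "S N + 2"]
      by (cases "k = N") (auto simp: numeral_3_eq_3)
  qed
  show "i \<le> j"
  proof (rule ccontr)
    assume "\<not> i \<le> j"
    then have i: "c (S i + 2) \<le> q i" "i \<le> k" using after(1)[of i] b by auto
    show False
    proof (cases "even (S k - S i + 2)")
      case True
      then have "c (S k + 4) \<le> F i k 2" by (rule F_ge_even[OF i]) simp
      then show False using q_less[of k] b by simp
    next
      case False
      then have "even (S k - S i + 1)" by simp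
      then have 1: "c (S k + 3) \<le> F i k 1" by (rule F_ge_even[OF i]) simp
      show False
        using 1 b after(2)[of k] assms(2) q_N by (cases "k = N") auto
    qed
  qed
qed

text \<open>
For a last link of odd degree after links of even degree, the bottom rung at one start is the
middle rung at the previous start. So exactly one start has its middle rung at the end of the
path and its bottom rung strictly below: the first one whose middle rung is there.
\<close>

lemma unique_block_odd_end:
  assumes l: "1 \<le> l" "l < N" and odd: "odd (rr l)"
    and even: "\<And>m. 1 \<le> m \<Longrightarrow> m < l \<Longrightarrow> even (rr m)"
    and top: "\<And>i. i < l \<Longrightarrow> F i (Suc l) 2 = q (Suc l) \<Longrightarrow> q (Suc l) < F i (Suc l) 3"
  shows "\<exists>!i. block i (Suc l)"
proof -
  have shift: "F (Suc i) (Suc l) 1 = F i (Suc l) 2" if "i < l" for i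
  proof -
    have "even (S l - S (Suc i))" by (rule S_parity) (use that even in auto)
    moreover have "S (Suc l) - S (Suc i) = S l - S (Suc i) + rr l"
      using S_mono[of "Suc i" l] that by (simp add: S_Suc)
    ultimately have "even (S (Suc l) - S (Suc i) + 1)" using odd by simp
    from F_shift[OF _ _ this] show ?thesis using that l unfolding one_add_one by simp
  qed
  have step: "F i (Suc l) 2 \<le> F (Suc i) (Suc l) 2" if "i < l" for i
    using shift[OF that] F_mono[of 1 2 "Suc i" "Suc l"] by simp
  have mono: "F i (Suc l) 2 \<le> F i' (Suc l) 2" if "i \<le> i'" "i' \<le> l" for i i'
    using that by (induction i' rule: dec_induct) (use step in \<open>auto intro: le_trans\<close>)
  have at: "F (l - 1) (Suc l) 2 = q (Suc l)"
    using shift[of "l - 1"] F_last(1)[OF l(2)] l by simp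
  define i0 where "i0 = (LEAST i. F i (Suc l) 2 = q (Suc l))"
  have i0: "F i0 (Suc l) 2 = q (Suc l)" and i0l: "i0 \<le> l - 1"
    unfolding i0_def by (rule LeastI, fact at, rule Least_le, fact at)
  have least: "F i (Suc l) 2 \<noteq> q (Suc l)" if "i < i0" for i
    using not_less_Least[of i "\<lambda>i. F i (Suc l) 2 = q (Suc l)"] that by (simp add: i0_def)
  have "F i0 (Suc l) 1 \<noteq> q (Suc l)"
  proof (cases i0)
    case 0
    have "S (Suc l) \<le> S N" using S_mono[of "Suc l" N] l by simp
    then have "c (S (Suc l) + 1) < c (S (Suc l) + 2)" using c_strict[of "S (Suc l) + 1"] by simp
    then show ?thesis using i0 unfolding 0 F_0 by simp
  next
    case (Suc i)
    then show ?thesis using least[of i] shift[of i] i0l by simp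
  qed
  then have "F i0 (Suc l) 1 < q (Suc l)" using i0 F_mono[of 1 2 i0 "Suc l"] by simp
  then have "block i0 (Suc l)" using i0 i0l l top[of i0] by (auto simp: block_F)
  moreover have "i = i0" if "block i (Suc l)" for i
  proof (rule ccontr)
    from that have b: "i + 2 \<le> Suc l" "F i (Suc l) 2 = q (Suc l)" "F i (Suc l) 1 < q (Suc l)"
      by (auto simp: block_F)
    assume "i \<noteq> i0"
    with b least have "i0 < i" by (metis linorder_neqE_nat)
    then have "F i0 (Suc l) 2 \<le> F (i - 1) (Suc l) 2" using mono[of i0 "i - 1"] b by simp
    also have "\<dots> = F i (Suc l) 1" using shift[of "i - 1"] \<open>i0 < i\<close> b by simp
    finally show False using b i0 by simp
  qed
  ultimately show ?thesis by blast
qed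

text \<open>
If the turning link has even degree, it ends on a rung of the ladder from the start of the path,
and the block starts there. If its degree is odd, the start is located by
\<open>unique_block_odd_end\<close>.
\<close>

lemma unique_block_at_turn: "\<exists>!i. block i (Suc j)"
  and block_at_turn_start: "block i (Suc j) \<Longrightarrow> even (rr j) \<Longrightarrow> i = 0"
proof -
  have zero: "i = 0" if "block i (Suc j)" "even (rr j)" for i
  proof (rule ccontr)
    assume "i \<noteq> 0"
    from that have b: "i + 2 \<le> Suc j" "q (Suc j) = F i (Suc j) 2" by (auto simp: block_F)
    have ij: "S i \<le> S (Suc j)" using S_mono[of i "Suc j"] b by simp
    moreover have "even (S (Suc j)) = even (S i)"
      using parity_all[OF \<open>even (rr j)\<close>, of "Suc j"] parity_all[OF \<open>even (rr j)\<close>, of i]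
        b \<open>i \<noteq> 0\<close> j_N by simp
    ultimately have "even (S (Suc j) - S i + 2)" by simp
    moreover have "c (S i + 1) \<le> q i" "i \<le> Suc j" using before(1)[of i] b \<open>i \<noteq> 0\<close> by auto
    ultimately have "c (S (Suc j) + 3) \<le> F i (Suc j) 2" by (intro F_ge_even[of i 1]) auto
    then show False using b after(2)[of "Suc j"] j_N by simp
  qed
  show "block i (Suc j) \<Longrightarrow> even (rr j) \<Longrightarrow> i = 0" by (rule zero)
  show "\<exists>!i. block i (Suc j)"
  proof (cases "even (rr j)")
    case True
    have "S (Suc j) \<le> S N" using S_mono[of "Suc j" N] j_N by simp
    then have "block 0 (Suc j)"
      using turn_even[OF True] c_strict[of "S (Suc j) + 1"] c_strict[of "S (Suc j) + 2"] j_pos j_N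
      by (simp add: block_F F_0 numeral_3_eq_3)
    then show ?thesis using zero True by blast
  next
    case False
    show ?thesis
    proof (rule unique_block_odd_end[OF j_pos _ False])
      show "j < N" using j_N by simp
      show "even (rr m)" if "1 \<le> m" "m < j" for m using even_degree(1)[of m] that j_N by simp
      fix i assume i: "i < j" "F i (Suc j) 2 = q (Suc j)"
      show "q (Suc j) < F i (Suc j) 3"
      proof (cases "i = 0")
        case True
        then show ?thesis using after(2)[of "Suc j"] j_N by (simp add: F_0)
      next
        case i0: False
        have "S i \<le> S j" using S_mono[of i j] i by simp
        moreover have "even (S j) = even (S i)"
          using parity_before[of j] parity_before[of i] i i0 j_pos by simp
        ultimately have "even (S (Suc j) - S i + 3)" using False by (simp add: S_Suc)
        moreover have "c (S i + 1) \<le> q i" using before(1)[of i] i i0 by simp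
        ultimately have "c (S (Suc j) + 4) \<le> F i (Suc j) 3"
          using i by (intro F_ge_even[of i 1]) auto
        then show ?thesis using q_less[of "Suc j"] j_N by simp
      qed
    qed
  qed
qed

text \<open>
From an earlier start, the turning link of odd degree already gains the level that a block may
gain, and the path overshoots afterwards.
\<close>

lemma late_block_if_odd_turn:
  assumes "odd (rr j)" "block i k" "Suc j < k"
  shows "i = j"
proof (rule ccontr)
  assume "i \<noteq> j"
  then have i: "1 \<le> i" "i < j" using late_block_start[OF assms(2,3)] by auto
  have k: "k \<le> N" using assms(2) by (simp add: block_F)
  have lk: "link (q i) (q (Suc i)) (rr i)" using links i j_N by simp
  have "rung (q i) (rr i + 1 + (S j - S (Suc i))) \<le> q j"
    using even_links_above[of "Suc i" j "q i" "rr i + 1"] lk even_degree(1) i j_N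
    by (simp add: link_def)
  then have "rung (q i) (rr i + 1 + (S j - S (Suc i)) + rr j + 1) \<le> q (Suc j)"
    by (intro link_odd_above[OF links[of j] assms(1)]) (use j_N in simp)
  moreover have "rr i + 1 + (S j - S (Suc i)) + rr j + 1 = S (Suc j) - S i + 2"
    using S_mono[of "Suc i" j] i by (simp add: S_Suc)
  ultimately have "rung (q i) (S (Suc j) - S i + 2) \<le> q (Suc j)" by simp
  then have "\<not> block i (Suc (k - 1))"
    by (intro overshoot[of "Suc j"]) (use even_degree(1) assms(3) k i in auto)
  then show False using assms(2,3) by simp
qed

text \<open>
Relative to the ladder from \<open>q j\<close>, the path starts below the middle rung and has reached it at the
end. The first place where it has been reached is the end of the block; later the path overshoots.
\<close>

lemma unique_late_block_odd_turn:
  assumes odd: "odd (rr j)"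
  shows "\<exists>!k. Suc j < k \<and> block j k"
proof -
  have lk: "link (q j) (q (Suc j)) (rr j)" using links j_N by simp
  have cj: "c (S j + 1) \<le> q j" "q j < c (S j + 2)" using before[of j] j_pos by simp_all
  have lower: "rung (q j) (S l - S j + 1) \<le> q l" if l: "j < l" "l < N" for l
  proof -
    have "rung (q j) (rr j + 1 + (S l - S (Suc j))) \<le> q l"
      using even_links_above[of "Suc j" l "q j" "rr j + 1"] lk even_degree(1) l
      by (simp add: link_def)
    moreover have "rr j + 1 + (S l - S (Suc j)) = S l - S j + 1"
      using S_mono[of "Suc j" l] l by (simp add: S_Suc)
    ultimately show ?thesis by simp
  qed
  have parity: "odd (S l - S j)" if l: "j < l" "l < N" for l
  proof -
    have "even (S l - S (Suc j))" by (rule S_parity) (use l even_degree(1) in auto)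
    moreover have "S l - S j = S l - S (Suc j) + rr j"
      using S_mono[of "Suc j" l] l by (simp add: S_Suc)
    ultimately show ?thesis using odd by simp
  qed
  have diff: "S (Suc l) - S j = S l - S j + rr l" if "j < l" for l
    using S_mono[of j l] that by (simp add: S_Suc)
  have N1: "Suc (N - 1) = N" "j < N - 1" "N - 1 < N" using j_N by auto
  have at_N: "F j N 2 \<le> q N"
  proof (cases "even (rr (N - 1))")
    case True
    then have "odd (S N - S j + 2)" using parity[OF N1(2,3)] diff[OF N1(2)] N1(1) by simp
    then have "F j N 2 \<le> c (S N + 3)" using cj(2) j_N by (intro F_le_odd[of j 2]) auto
    then show ?thesis using q_N by simp
  next
    case False
    from link_odd_above[OF links[OF N1(3)] this lower[OF N1(2,3)]]
    show ?thesis using diff[OF N1(2)] N1(1) by (simp add: F_def add.commute add.left_commute)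
  qed
  (* the place where the path catches up with the middle rung *)
  define k0 where "k0 = (LEAST k. Suc j < k \<and> F j k 2 \<le> q k)"
  have PN: "Suc j < N \<and> F j N 2 \<le> q N" using at_N j_N by simp
  have k0: "Suc j < k0" "F j k0 2 \<le> q k0" and k0N: "k0 \<le> N"
    unfolding k0_def using LeastI[of "\<lambda>k. Suc j < k \<and> F j k 2 \<le> q k", OF PN]
      Least_le[of "\<lambda>k. Suc j < k \<and> F j k 2 \<le> q k", OF PN] by auto
  have least: "q k < F j k 2" if "Suc j < k" "k < k0" for k
    using not_less_Least[of k "\<lambda>k. Suc j < k \<and> F j k 2 \<le> q k"] that by (auto simp: k0_def)
  obtain l where l: "k0 = Suc l" "j < l" "l < N" using k0(1) k0N by (cases k0) auto
  have upper: "q l < rung (q j) (S l - S j + 2)"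
  proof (cases "l = Suc j")
    case True
    then show ?thesis using F_last(3)[of j] l by (simp add: F_def)
  next
    case False
    then show ?thesis using least[of l] l by (simp add: F_def)
  qed
  have "block j k0"
  proof (cases "even (rr l)")
    case True
    have "q k0 \<le> F j k0 2"
      using link_even_below[OF links[OF l(3)] True upper] diff[OF l(2)]
      by (simp add: F_def l(1) add.commute add.left_commute)
    moreover have "F j k0 1 < q k0"
      using link_even_above[OF links[OF l(3)] True lower[OF l(2,3)]] diff[OF l(2)]
      by (simp add: F_def l(1))
    moreover have "even (S k0 - S j + 3)" using parity[OF l(2,3)] diff[OF l(2)] True l(1) by simp
    then have "c (S k0 + 4) \<le> F j k0 3" using cj(1) k0 by (intro F_ge_even[of j 1]) auto
    ultimately show ?thesis using k0 k0N q_less[of k0] by (auto simp: block_F)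
  next
    case False
    have kN: "k0 = N" using False even_degree(1)[of l] l k0N by (cases "Suc l = N") auto
    have "q k0 < F j k0 3"
      using link_odd_below[OF links[OF l(3)] False upper] diff[OF l(2)]
      by (simp add: F_def l(1) add.commute add.left_commute numeral_3_eq_3)
    moreover have ev: "even (S N - S j)" using parity[OF l(2,3)] diff[OF l(2)] False l(1) kN by simp
    then have "c (S N + 3) \<le> F j N 2" using cj(1) j_N by (intro F_ge_even[of j 1]) auto
    moreover have "F j N 1 \<le> c (S N + 2)" using cj(2) j_N ev by (intro F_le_odd[of j 2]) auto
    moreover have "c (S N + 2) < c (S N + 3)" using c_strict[of "S N + 2"] by (simp add: numeral_3_eq_3)
    ultimately show ?thesis using k0 k0N q_N kN by (auto simp: block_F)
  qed
  moreover have "k = k0" if k: "Suc j < k" "block j k" for k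
  proof (rule ccontr)
    assume "k \<noteq> k0"
    have b: "k \<le> N" "q k = F j k 2" using k(2) by (auto simp: block_F)
    then have "k0 < k" using least[of k] k(1) \<open>k \<noteq> k0\<close> by (cases "k < k0") auto
    then have "\<not> block j (Suc (k - 1))"
      by (intro overshoot[of k0]) (use even_degree(1) k0 b in \<open>auto simp: F_def\<close>)
    then show False using k by simp
  qed
  ultimately show ?thesis using k0(1) by blast
qed

lemma late_block_if_even_turn:
  assumes "even (rr j)" "block i k" "Suc j < k"
  shows "k = N"
proof (rule ccontr)
  assume "k \<noteq> N"
  have b: "i + 2 \<le> k" "k \<le> N" "q k = F i k 2" using assms(2) by (auto simp: block_F)
  have i: "1 \<le> i" "i \<le> j" using late_block_start[OF assms(2,3)] by auto
  have "S i \<le> S k" using S_mono[of i k] b by simp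
  then have "even (S k - S i + 2)"
    using parity_all[OF assms(1), of k] parity_all[OF assms(1), of i] i b \<open>k \<noteq> N\<close> by simp
  then have "c (S k + 3) \<le> F i k 2" using before(1)[OF i] b by (intro F_ge_even[of i 1]) auto
  then show False using after(2)[of k] b assms(3) \<open>k \<noteq> N\<close> by simp
qed

text \<open>
If the last link has odd degree, this is the uniqueness at an odd end. Otherwise the top rung at
one start is the middle rung at the next start, and the block starts at the last place whose
middle rung is still the end of the path.
\<close>

lemma unique_late_block_even_turn:
  assumes ev: "even (rr j)"
  shows "\<exists>!i. block i N"
proof (cases "even (rr (N - 1))")
  case False
  have N1: "Suc (N - 1) = N" "1 \<le> N - 1" "N - 1 < N" using j_N by auto
  have "\<exists>!i. block i (Suc (N - 1))"
  proof (rule unique_block_odd_end[OF N1(2,3) False])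
    show "even (rr m)" if "1 \<le> m" "m < N - 1" for m
      using even_degree(1)[of m] that ev by (cases "m = j") auto
    fix i assume "i < N - 1" "F i (Suc (N - 1)) 2 = q (Suc (N - 1))"
    then have i: "i < N - 1" "F i N 2 = q N" using N1(1) by simp_all
    have "i \<noteq> 0"
    proof
      assume "i = 0"
      then show False using i(2) q_N c_strict[of "S N + 2"] by (simp add: F_0 numeral_3_eq_3)
    qed
    have "S i \<le> S (N - 1)" using S_mono[of i "N - 1"] i by simp
    moreover have "even (S (N - 1)) = even (S i)"
      using parity_all[OF ev, of "N - 1"] parity_all[OF ev, of i] i \<open>i \<noteq> 0\<close> by simp
    moreover have "S N = S (N - 1) + rr (N - 1)" using S_Suc[of "N - 1"] N1(1) by simp
    ultimately have "even (S N - S i + 3)" using False by simp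
    moreover have "c (S i + 1) \<le> q i" using q_ge[of i] i \<open>i \<noteq> 0\<close> by simp
    ultimately have "c (S N + 4) \<le> F i N 3" using i by (intro F_ge_even[of i 1]) auto
    then show "q (Suc (N - 1)) < F i (Suc (N - 1)) 3" using c_above N1(1) by simp
  qed
  then show ?thesis using N1(1) by simp
next
  case True
  have N1: "Suc (N - 1) = N" "1 \<le> N - 1" "N - 1 < N" using j_N by auto
  have SN: "S N = S (N - 1) + rr (N - 1)" using S_Suc[of "N - 1"] N1(1) by simp
  have parity: "even (S N - S i)" if "1 \<le> i" "i < N" for i
    using S_mono[of i "N - 1"] parity_all[OF ev, of "N - 1"] parity_all[OF ev, of i] that True j_N
    by (auto simp: SN)
  have shift: "F (Suc i) N 2 = F i N 3" if "Suc i < N" for i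
    using F_shift[of i N 2] parity[of "Suc i"] that by simp
  have step: "F i N 2 \<le> F (Suc i) N 2" if "Suc i < N" for i
    using shift[OF that] F_mono[of 2 3 i N] by simp
  have mono: "F i N 2 \<le> F i' N 2" if "i \<le> i'" "i' < N" for i i'
    using that by (induction i' rule: dec_induct) (use step in \<open>auto intro: le_trans\<close>)
  have first: "F 1 N 2 = q N" using shift[of 0] j_N q_N by (simp add: F_0)
  define P where "P = (\<lambda>i. 1 \<le> i \<and> F (Suc i) N 2 \<noteq> q N)"
  have "q N < F (N - 1) N 2" using F_last(3)[OF N1(3)] N1(1) by simp
  moreover have "Suc (N - 2) = N - 1" using j_N by simp
  ultimately have P: "P (N - 2)" using j_N j_pos by (simp add: P_def)
  define i0 where "i0 = (LEAST i. P i)"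
  have i0: "P i0" and i0N: "i0 \<le> N - 2"
    unfolding i0_def by (rule LeastI, fact P, rule Least_le, fact P)
  have i0N': "Suc i0 < N" using i0N j_N by simp
  have least: "F (Suc i) N 2 = q N" if "1 \<le> i" "i < i0" for i
    using not_less_Least[of i P] that by (auto simp: i0_def P_def)
  have at: "F i0 N 2 = q N"
  proof (cases "i0 = 1")
    case False
    then have "1 \<le> i0 - 1" "i0 - 1 < i0" "Suc (i0 - 1) = i0" using i0 by (auto simp: P_def)
    then show ?thesis using least[of "i0 - 1"] by simp
  qed (use first in simp)
  then have above: "q N < F i0 N 3"
    using i0 shift[OF i0N'] F_mono[of 2 3 i0 N] by (simp add: P_def)
  have "i0 \<le> j"
  proof (rule ccontr)
    assume "\<not> i0 \<le> j"
    then have "c (S N + 4) \<le> F i0 N 2"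
      using after(1)[of i0] i0N' parity[of i0] j_pos by (intro F_ge_even[of i0 2]) auto
    then show False using at c_above by simp
  qed
  then have "F i0 N 1 \<le> c (S N + 2)"
    using before(2)[of i0] i0 parity[of i0] i0N' by (intro F_le_odd[of i0 2]) (auto simp: P_def)
  then have "F i0 N 1 < q N" using q_N c_strict[of "S N + 2"] by (simp add: numeral_3_eq_3)
  then have "block i0 N" using at above i0N' by (simp add: block_F)
  moreover have "i = i0" if b: "block i N" for i
  proof (rule ccontr)
    assume "i \<noteq> i0"
    have i: "1 \<le> i" using late_block_start(1)[OF b] j_N by simp
    have bF: "i + 2 \<le> N" "F i N 2 = q N" "q N < F i N 3" using b by (auto simp: block_F)
    show False
    proof (cases "i < i0")
      case True
      then show False using least[of i] i shift[of i] bF by simp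
    next
      case False
      then have "F (Suc i0) N 2 \<le> F i N 2" using mono[of "Suc i0" i] bF \<open>i \<noteq> i0\<close> by simp
      then show False using above shift[OF i0N'] bF by simp
    qed
  qed
  ultimately show ?thesis by blast
qed

text \<open>
The degrees between the first link and the turning link are even, so the parities of the partial
degree sums that enter the signs depend only on the degree of the turning link.
\<close>

lemma two_blocks_at_turn:
  "\<exists>i1 k1 i2 k2. (\<forall>i k. block i k \<longleftrightarrow> (i, k) = (i1, k1) \<or> (i, k) = (i2, k2)) \<and>
     even (if i1 = 0 then S k1 + 1 else S (Suc i1)) \<noteq>
     even (if i2 = 0 then S k2 + 1 else S (Suc i2))"
proof -
  obtain i1 where i1: "\<And>i. block i (Suc j) \<longleftrightarrow> i = i1" using unique_block_at_turn by metis
  have split: "block i k \<longleftrightarrow> i = i1 \<and> k = Suc j \<or> Suc j < k \<and> block i k" for i k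
    using i1 block_end_ge[of i k] by (cases "k = Suc j") auto
  have i1j: "Suc i1 \<le> j" using i1[of i1] by (auto simp: block_F)
  have Sj: "S (Suc j) = S j + rr j" by (rule S_Suc)
  have one: "even (S j) = even (S 1)" using parity_before[of j] j_pos by simp
  show ?thesis
  proof (cases "even (rr j)")
    case True
    have "i1 = 0" using block_at_turn_start[OF _ True] i1 by simp
    obtain i2 where i2: "\<And>i. block i N \<longleftrightarrow> i = i2" using unique_late_block_even_turn[OF True] by metis
    have late: "1 \<le> i2" "i2 \<le> j" using late_block_start[of i2 N] i2[of i2] j_N by auto
    have "block i k \<longleftrightarrow> (i, k) = (i1, Suc j) \<or> (i, k) = (i2, N)" for i k
      using split[of i k] late_block_if_even_turn[OF True, of i k] i2[of i] j_N by auto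
    moreover have "even (S (Suc i2)) = even (S 1)"
      using parity_all[OF True, of "Suc i2"] late j_N by simp
    ultimately show ?thesis
      using \<open>i1 = 0\<close> late one Sj True
      by (intro exI[of _ i1] exI[of _ "Suc j"] exI[of _ i2] exI[of _ N]) simp
  next
    case False
    obtain k2 where k2: "\<And>k. Suc j < k \<and> block j k \<longleftrightarrow> k = k2"
      using unique_late_block_odd_turn[OF False] by metis
    have "block i k \<longleftrightarrow> (i, k) = (i1, Suc j) \<or> (i, k) = (j, k2)" for i k
      using split[of i k] late_block_if_odd_turn[OF False, of i k] k2[of k] by auto
    moreover have "even (S (Suc i1)) = even (S 1)" using parity_before[of "Suc i1"] i1j by simp
    ultimately show ?thesis
      using one Sj False j_pos
      by (intro exI[of _ i1] exI[of _ "Suc j"] exI[of _ j] exI[of _ k2]) simp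
  qed
qed

end

lemma (in ladder_double) two_blocks:
  "\<exists>i1 k1 i2 k2. (\<forall>i k. block i k \<longleftrightarrow> (i, k) = (i1, k1) \<or> (i, k) = (i2, k2)) \<and>
     even (if i1 = 0 then S k1 + 1 else S (Suc i1)) \<noteq>
     even (if i2 = 0 then S k2 + 1 else S (Suc i2))"
proof -
  obtain j where "1 \<le> j" "j + 2 \<le> N"
    "\<And>k. 1 \<le> k \<Longrightarrow> k \<le> j \<Longrightarrow> level k = S k + 1"
    "\<And>k. j < k \<Longrightarrow> k < N \<Longrightarrow> level k = S k + 2" using turning_point by blast
  then interpret ladder_turn f N q rr j by unfold_locales
  show ?thesis by (rule two_blocks_at_turn)
qed

section \<open>Chains as links of positions\<close>

definition slice :: "'a list \<Rightarrow> nat \<Rightarrow> nat \<Rightarrow> 'a list"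
  where "slice m a b = take (b - a) (drop a m)"

lemma length_slice: "a \<le> b \<Longrightarrow> b \<le> length m \<Longrightarrow> length (slice m a b) = b - a"
  by (simp add: slice_def)

lemma slice_append: "a \<le> b \<Longrightarrow> b \<le> c \<Longrightarrow> slice m a b @ slice m b c = slice m a c"
  unfolding slice_def
  by (metis Nat.add_diff_assoc2 add_diff_inverse_nat diff_add drop_drop leD take_add)

lemma slice_mid: "slice (a @ b @ z) (length a) (length a + length b) = b"
  by (simp add: slice_def)

lemma prefix_slice: "b \<le> c \<Longrightarrow> prefix (slice m a b) (slice m a c)"
  unfolding slice_def by (metis diff_le_mono prefix_def take_add le_add_diff_inverse)

lemma set_slice: "set (slice m a b) \<subseteq> set m"
  unfolding slice_def by (meson set_drop_subset set_take_subset subset_trans)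

lemma slice_in_lists: "m \<in> lists X \<Longrightarrow> slice m a b \<in> lists X"
  using set_slice[of m a b] by (auto simp: lists_eq_set)

lemma normal_word_sublist: "normal_word R w \<Longrightarrow> sublist v w \<Longrightarrow> normal_word R v"
  unfolding normal_word_def using sublist_order.order_trans by blast

lemma normal_word_appendD:
  "normal_word R (a @ b) \<Longrightarrow> normal_word R a" "normal_word R (a @ b) \<Longrightarrow> normal_word R b"
  by (auto elim: normal_word_sublist)

text \<open>
If no non-normal subword starts at \<open>s\<close>, the value lies beyond the end of the word; adding \<open>s\<close> there
keeps the function monotone and above the diagonal at all positions.
\<close>

definition reach :: "'x list set \<Rightarrow> 'x list \<Rightarrow> nat \<Rightarrow> nat"
  where "reach R m s = (if \<exists>b\<le>length m. s \<le> b \<and> \<not> normal_word R (slice m s b)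
    then LEAST b. s \<le> b \<and> \<not> normal_word R (slice m s b) else length m + 2 + s)"

lemma normal_slice_iff:
  assumes "a \<le> b" "b \<le> length m"
  shows "normal_word R (slice m a b) \<longleftrightarrow> b < reach R m a"
proof (cases "\<exists>b\<le>length m. a \<le> b \<and> \<not> normal_word R (slice m a b)")
  case True
  then obtain b0 where b0: "a \<le> b0 \<and> \<not> normal_word R (slice m a b0)" by blast
  let ?P = "\<lambda>b. a \<le> b \<and> \<not> normal_word R (slice m a b)"
  have r: "reach R m a = (LEAST b. ?P b)" using True by (simp add: reach_def)
  show ?thesis
  proof
    assume n: "normal_word R (slice m a b)"
    have "?P (reach R m a)" unfolding r by (rule LeastI[of ?P]) (rule b0)
    then show "b < reach R m a"
      using n prefix_slice[of "reach R m a" b m a]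
      by (meson leI normal_word_sublist prefix_imp_sublist)
  next
    assume "b < reach R m a"
    then show "normal_word R (slice m a b)" unfolding r using not_less_Least[of b ?P] assms by blast
  qed
next
  case False
  then have "reach R m a = length m + 2 + a" unfolding reach_def by (rule if_not_P)
  then show ?thesis using False assms by auto
qed

locale chain_words =
  fixes X :: "'x set" and R :: "'x list set"
  assumes R_length: "\<rho> \<in> R \<Longrightarrow> 2 \<le> length \<rho>"
begin

lemma normal_short: "length w \<le> 1 \<Longrightarrow> normal_word R w"
  unfolding normal_word_def using R_length sublist_length_le by fastforce

lemma reach_ladder: "ladder (reach R m)"
proof
  show "mono (reach R m)"
  proof (rule monoI)
    fix s t :: nat assume st: "s \<le> t"
    show "reach R m s \<le> reach R m t"
    proof (cases "reach R m t \<le> length m")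
      case True
      define b where "b = reach R m t"
      have "t \<le> b"
      proof (rule ccontr)
        assume "\<not> t \<le> b"
        then have "reach R m t < t" by (simp add: b_def)
        then have "\<exists>b\<le>length m. t \<le> b \<and> \<not> normal_word R (slice m t b)"
          by (auto simp: reach_def split: if_splits)
        then have "t \<le> reach R m t"
          unfolding reach_def by (smt (verit, best) LeastI_ex)
        then show False using \<open>reach R m t < t\<close> by simp
      qed
      moreover have b: "\<not> normal_word R (slice m t b)"
        using normal_slice_iff[of t b m R] \<open>t \<le> b\<close> True by (simp add: b_def)
      moreover have "sublist (slice m t b) (slice m s b)"
        using slice_append[OF st \<open>t \<le> b\<close>, of m] by (metis sublist_append_leftI)
      ultimately have "\<not> normal_word R (slice m s b)" using normal_word_sublist by blast
      then show ?thesis using normal_slice_iff[of s b m R] st \<open>t \<le> b\<close> True by (simp add: b_def)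
    next
      case False
      then have t: "\<not> (\<exists>b\<le>length m. t \<le> b \<and> \<not> normal_word R (slice m t b))"
        using normal_slice_iff[of t _ m R] by fastforce
      then have rt: "reach R m t = length m + 2 + t" unfolding reach_def by (rule if_not_P)
      show ?thesis
      proof (cases "reach R m s \<le> length m")
        case False
        then have "\<not> (\<exists>b\<le>length m. s \<le> b \<and> \<not> normal_word R (slice m s b))"
          using normal_slice_iff[of s _ m R] by fastforce
        then have "reach R m s = length m + 2 + s" unfolding reach_def by (rule if_not_P)
        then show ?thesis using rt st by simp
      qed (simp add: rt)
    qed
  qed
  fix s
  show "Suc s < reach R m s"
  proof (cases "Suc s \<le> length m")
    case True
    then have "length (slice m s (Suc s)) \<le> 1" by (simp add: length_slice)
    then show ?thesis using normal_short normal_slice_iff[of s "Suc s" m R] True by simp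
  next
    case False
    then have "normal_word R (slice m s b)" for b
      by (intro normal_short) (simp add: slice_def)
    then have "reach R m s = length m + 2 + s" unfolding reach_def by simp
    then show ?thesis by simp
  qed
qed

text \<open>
A chain together with its last factor, which is all that matters for extending the chain.
\<close>

inductive chain_tail :: "nat \<Rightarrow> 'x list \<Rightarrow> 'x list \<Rightarrow> bool" where
  zero: "x \<in> X \<Longrightarrow> chain_tail 0 [x] [x]"
| Suc: "chain_tail r \<gamma> t \<Longrightarrow> v \<in> lists X \<Longrightarrow> v \<noteq> [] \<Longrightarrow> normal_word R v \<Longrightarrow> minimally_zero R t v \<Longrightarrow>
    chain_tail (Suc r) (\<gamma> @ v) v"

lemma chain_tail_facts:
  assumes "chain_tail r \<gamma> t"
  shows "t \<noteq> []" "normal_word R t" "\<gamma> \<in> lists X" "\<gamma> \<noteq> []" "suffix t \<gamma>" "t \<in> lists X"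
  using assms by (induction) (auto intro: normal_short simp: suffix_def)

text \<open>
The factorizations that the definition of chains quantifies over.
\<close>

definition factors :: "nat \<Rightarrow> 'x list \<Rightarrow> 'x list list \<Rightarrow> bool"
  where "factors n \<gamma> us \<longleftrightarrow> length us = Suc n \<and> concat us = \<gamma> \<and> \<gamma> \<in> lists X \<and>
    length (us ! 0) = 1 \<and>
    (\<forall>j\<in>{1..n}. us ! j \<noteq> [] \<and> normal_word R (us ! j)) \<and>
    (\<forall>j<n. minimally_zero R (us ! j) (us ! Suc j))"

lemma factors_imp_tail: "factors n \<gamma> us \<Longrightarrow> chain_tail n \<gamma> (us ! n)"
proof (induction n arbitrary: \<gamma> us)
  case 0
  then obtain u where us: "us = [u]" by (auto simp: factors_def length_Suc_conv)
  with 0 obtain x where "u = [x]" by (auto simp: factors_def length_Suc_conv)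
  with 0 us show ?case by (auto simp: factors_def intro: chain_tail.zero)
next
  case (Suc n)
  have len: "length us = Suc (Suc n)" using Suc.prems by (simp add: factors_def)
  have us: "us = take (Suc n) us @ [us ! Suc n]"
    using len by (metis lessI take_Suc_conv_app_nth take_all_iff order_refl)
  have cc: "\<gamma> = concat (take (Suc n) us) @ us ! Suc n"
    using Suc.prems us by (metis concat.simps concat_append append_Nil2 factors_def)
  have "factors n (concat (take (Suc n) us)) (take (Suc n) us)"
    using Suc.prems len cc unfolding factors_def by auto
  from Suc.IH[OF this] have "chain_tail n (concat (take (Suc n) us)) (us ! n)" by simp
  moreover have "us ! Suc n \<in> lists X" "us ! Suc n \<noteq> []" "normal_word R (us ! Suc n)"
    "minimally_zero R (us ! n) (us ! Suc n)"
    using Suc.prems cc unfolding factors_def by (auto simp: lists_eq_set)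
  ultimately show ?case unfolding cc by (rule chain_tail.Suc)
qed

lemma tail_imp_factors: "chain_tail n \<gamma> t \<Longrightarrow> \<exists>us. factors n \<gamma> us \<and> us ! n = t"
proof (induction rule: chain_tail.induct)
  case (zero x)
  then show ?case by (intro exI[of _ "[[x]]"]) (auto simp: factors_def)
next
  case (Suc r \<gamma> t v)
  then obtain us where us: "factors r \<gamma> us" "us ! r = t" by blast
  then have len: "length us = Suc r" by (simp add: factors_def)
  have "factors (Suc r) (\<gamma> @ v) (us @ [v])"
    unfolding factors_def
  proof (intro conjI ballI allI impI)
    fix j assume "j \<in> {1..Suc r}"
    then show "(us @ [v]) ! j \<noteq> []" "normal_word R ((us @ [v]) ! j)"
      using us(1) len Suc.hyps by (auto simp: factors_def nth_append le_Suc_eq)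
  next
    fix j assume "j < Suc r"
    then show "minimally_zero R ((us @ [v]) ! j) ((us @ [v]) ! Suc j)"
      using us len Suc.hyps by (auto simp: factors_def nth_append less_Suc_eq)
  qed (use us(1) len Suc.hyps in \<open>auto simp: factors_def nth_append\<close>)
  then show ?case using len by (intro exI[of _ "us @ [v]"]) (simp add: nth_append)
qed

lemma is_chain_iff_tail: "is_chain X R n \<gamma> \<longleftrightarrow> (\<exists>t. chain_tail n \<gamma> t)"
  unfolding is_chain_def factors_def[symmetric]
  using factors_imp_tail tail_imp_factors by blast

abbreviation steps :: "'x list \<Rightarrow> nat \<Rightarrow> nat \<Rightarrow> nat" where "steps m \<equiv> ladder.rung (reach R m)"
abbreviation lnk :: "'x list \<Rightarrow> nat \<Rightarrow> nat \<Rightarrow> nat \<Rightarrow> bool" where "lnk m \<equiv> ladder.link (reach R m)"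

lemmas lnk_def = ladder.link_def[OF reach_ladder]

lemma tail_imp_link:
  assumes "chain_tail r \<gamma> t"
  shows "lnk (a @ \<gamma> @ z) (length a) (length a + length \<gamma>) r \<and>
    steps (a @ \<gamma> @ z) (length a) r = length a + length \<gamma> - length t"
  using assms
proof (induction arbitrary: z rule: chain_tail.induct)
  case (zero x)
  interpret ladder "reach R (a @ x # z)" by (rule reach_ladder)
  show ?case using f_gt[of "length a"] by (simp add: link_def rung.simps numeral_2_eq_2)
next
  case (Suc r \<gamma> t v)
  let ?m = "a @ \<gamma> @ v @ z" and ?p = "length a" and ?q = "length a + length \<gamma>"
  interpret ladder "reach R ?m" by (rule reach_ladder)
  from Suc.IH[of "v @ z"] have IH: "link ?p ?q r" "rung ?p r = ?q - length t" by simp_all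
  obtain \<gamma>' where \<gamma>: "\<gamma> = \<gamma>' @ t" using chain_tail_facts(5)[OF Suc.hyps(1)] by (auto simp: suffix_def)
  define s where "s = ?q - length t"
  have s: "s = length a + length \<gamma>'" by (simp add: s_def \<gamma>)
  have sl: "slice ?m s (?q + i) = t @ take i v" if "i \<le> length v" for i
    using that by (simp add: slice_def s \<gamma>)
  have "\<not> normal_word R (t @ v)" using Suc.hyps by (simp add: minimally_zero_def)
  then have "\<not> ?q + length v < reach R ?m s"
    using normal_slice_iff[of s "?q + length v" ?m R] sl[of "length v"] by (simp add: s \<gamma>)
  moreover have "normal_word R (t @ take (length v - 1) v)"
  proof -
    have "v = take (length v - 1) v @ [last v]"
      using Suc.hyps(3) by (metis append_butlast_last_id butlast_conv_take)
    then have "strict_prefix (take (length v - 1) v) v"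
      by (metis strict_prefix_def prefixI append_self_conv not_Cons_self2)
    then show ?thesis using Suc.hyps by (simp add: minimally_zero_def)
  qed
  then have "?q + (length v - 1) < reach R ?m s"
    using normal_slice_iff[of s "?q + (length v - 1)" ?m R] sl[of "length v - 1"] by (simp add: s \<gamma>)
  ultimately have r: "reach R ?m s = ?q + length v" using Suc.hyps(3) by (cases v) auto
  have "slice ?m ?q (?q + length v) = v" by (simp add: slice_def)
  then have n: "?q + length v < reach R ?m ?q"
    using Suc.hyps(4) normal_slice_iff[of ?q "?q + length v" ?m R] by simp
  have e: "rung ?p (Suc r) = ?q" using IH(1) by (simp add: link_def)
  have "rung ?p (Suc (Suc r)) = ?q + length v" using IH(2) r by (simp add: rung.simps s_def)
  moreover have "rung ?p (Suc (Suc (Suc r))) = reach R ?m ?q" using e by (simp add: rung.simps)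
  ultimately show ?case using e n Suc.hyps(3) by (simp add: link_def add.assoc)
qed

lemma link_imp_tail:
  assumes "lnk m p q r" "q \<le> length m" "slice m p q \<in> lists X"
  shows "chain_tail r (slice m p q) (slice m (steps m p r) q)"
  using assms
proof (induction r arbitrary: q)
  case 0
  interpret ladder "reach R m" by (rule reach_ladder)
  have q: "q = Suc p" using 0 by (simp add: link_def)
  then obtain x where "slice m p q = [x]" using length_slice[of p q m] 0(2)
    by (auto simp: length_Suc_conv)
  moreover have "steps m p 0 = p" by simp
  ultimately show ?case using 0(3) chain_tail.zero[of x] by simp
next
  case (Suc r)
  interpret ladder "reach R m" by (rule reach_ladder)
  define q' where "q' = rung p (Suc r)"
  have l: "link p q (Suc r)" by fact
  have q: "q = rung p (Suc (Suc r))" using l by (simp add: link_def)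
  have l': "link p q' r" using link_strict[OF l, of r] link_strict[OF l, of "Suc r"]
    by (simp add: link_def q'_def)
  have q'q: "q' < q" using link_strict[OF l, of "Suc r"] by (simp add: q q'_def)
  have pq': "p < q'" by (rule link_less[OF l'])
  define s where "s = rung p r"
  have sq': "s < q'" using l' by (simp add: link_def s_def)
  have qs: "q = reach R m s" by (simp add: q s_def rung.simps)
  have ap: "slice m p q' @ slice m q' q = slice m p q" by (rule slice_append) (use pq' q'q in auto)
  have X: "slice m p q' \<in> lists X" "slice m q' q \<in> lists X" using Suc.prems(3) ap[symmetric] by auto
  have IH: "chain_tail r (slice m p q') (slice m s q')"
    unfolding s_def by (rule Suc.IH[OF l' _ X(1)]) (use q'q Suc.prems in simp)
  have "slice m q' q \<noteq> []" using length_slice[of q' q m] q'q Suc.prems(2) by auto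
  moreover have "q < reach R m q'" using l by (simp add: link_def q'_def rung.simps)
  then have "normal_word R (slice m q' q)" using normal_slice_iff[of q' q m R] q'q Suc.prems(2) by simp
  moreover have "minimally_zero R (slice m s q') (slice m q' q)"
    unfolding minimally_zero_def
  proof (intro conjI allI impI)
    show "\<not> normal_word R (slice m s q' @ slice m q' q)"
      using slice_append[of s q' q m] normal_slice_iff[of s q m R] sq' q'q Suc.prems(2) qs by simp
    fix v assume v: "strict_prefix v (slice m q' q)"
    then have len: "length v < q - q'"
      using prefix_length_less[OF v] length_slice[of q' q m] q'q Suc.prems(2) by simp
    have "v = slice m q' (q' + length v)"
      using v by (auto simp: slice_def strict_prefix_def prefix_def)
        (metis add_diff_cancel_left' append_eq_conv_conj len length_append length_take min_def
          less_or_eq_imp_le take_take)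
    then have "slice m s q' @ v = slice m s (q' + length v)"
      using slice_append[of s q' "q' + length v" m] sq' by simp
    then show "normal_word R (slice m s q' @ v)"
      using normal_slice_iff[of s "q' + length v" m R] sq' len Suc.prems(2) qs by simp
  qed
  ultimately have "chain_tail (Suc r) (slice m p q' @ slice m q' q) (slice m q' q)"
    using chain_tail.Suc[OF IH X(2)] by blast
  then have "chain_tail (Suc r) (slice m p q) (slice m q' q)" by (simp only: ap)
  then show ?case by (simp only: q'_def)
qed

lemma is_chain_slice_iff:
  assumes "p \<le> q" "q \<le> length m" "slice m p q \<in> lists X"
  shows "is_chain X R r (slice m p q) \<longleftrightarrow> lnk m p q r"
proof
  assume "is_chain X R r (slice m p q)"
  then obtain t where t: "chain_tail r (slice m p q) t" by (auto simp: is_chain_iff_tail)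
  have m: "m = take p m @ slice m p q @ drop q m"
    using assms(1) by (simp add: slice_def) (metis append_take_drop_id drop_drop le_add_diff_inverse2)
  have "length (take p m) = p" "length (slice m p q) = q - p" using assms by (simp_all add: length_slice)
  then show "lnk m p q r"
    using tail_imp_link[OF t, of "take p m" "drop q m"] m[symmetric] assms(1) by simp
next
  assume "lnk m p q r"
  then show "is_chain X R r (slice m p q)" using link_imp_tail assms is_chain_iff_tail by blast
qed

lemma chain_tail_unique:
  assumes "chain_tail r \<gamma> t" "chain_tail r' \<gamma> t'"
  shows "r = r'" "t = t'"
proof -
  interpret ladder "reach R \<gamma>" by (rule reach_ladder)
  have 1: "link 0 (length \<gamma>) r" "rung 0 r = length \<gamma> - length t"
    using tail_imp_link[OF assms(1), of "[]" "[]"] by simp_all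
  have 2: "link 0 (length \<gamma>) r'" "rung 0 r' = length \<gamma> - length t'"
    using tail_imp_link[OF assms(2), of "[]" "[]"] by simp_all
  show r: "r = r'" by (rule link_degree_unique) fact+
  have "length t \<le> length \<gamma>" "length t' \<le> length \<gamma>"
    using chain_tail_facts(5)[OF assms(1)] chain_tail_facts(5)[OF assms(2)]
    by (simp_all add: suffix_length_le)
  then have "length t = length t'" using 1 2 r by simp
  then show "t = t'" using chain_tail_facts(5)[OF assms(1)] chain_tail_facts(5)[OF assms(2)]
    by (auto simp: suffix_def append_eq_append_conv2)
qed

lemma chain_degree_eq: "is_chain X R r \<gamma> \<Longrightarrow> chain_degree X R \<gamma> = r"
  unfolding chain_degree_def by (rule the_equality) (auto simp: is_chain_iff_tail dest: chain_tail_unique)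

lemma chain_tail_degree: "chain_tail r \<gamma> t \<Longrightarrow> chain_degree X R \<gamma> = r"
  using chain_degree_eq is_chain_iff_tail by blast

lemma chain_tail_chains: "chain_tail r \<gamma> t \<Longrightarrow> \<gamma> \<in> chains X R"
  unfolding chains_def using is_chain_iff_tail by blast

lemma chains_tail: "\<gamma> \<in> chains X R \<Longrightarrow> \<exists>t. chain_tail (chain_degree X R \<gamma>) \<gamma> t"
  unfolding chains_def using is_chain_iff_tail chain_degree_eq by fastforce

text \<open>The successive factors are determined by minimality.\<close>

lemma chain_prefix_unique:
  assumes "chain_tail r \<gamma> t" "chain_tail r \<delta> s" "\<gamma> @ z = \<delta> @ y"
  shows "\<gamma> = \<delta>"
proof -
  have "length \<gamma> = length \<delta>"
    using tail_imp_link[OF assms(1), of "[]" z] tail_imp_link[OF assms(2), of "[]" y] assms(3)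
    by (simp add: lnk_def)
  then show ?thesis using assms(3) by simp
qed

end

section \<open>Linear maps and derivations of free algebras\<close>

abbreviation (input) keys where "keys \<equiv> Poly_Mapping.keys"
abbreviation (input) lookup where "lookup \<equiv> Poly_Mapping.lookup"

lemma keys_uminus [simp]: "keys (- b :: ('s, 'k::field) ncpoly) = keys b"
  by (auto simp: in_keys_iff)

lemma keys_minus_subset: "keys (a - b :: ('s, 'k::field) ncpoly) \<subseteq> keys a \<union> keys b"
  by (auto simp: in_keys_iff lookup_minus)

lemma keys_sum_subset: "keys (sum f A :: ('s, 'k::field) ncpoly) \<subseteq> (\<Union>a\<in>A. keys (f a))"
proof (induction A rule: infinite_finite_induct)
  case (insert x A)
  then show ?case using Poly_Mapping.keys_add[of "f x" "sum f A"] by auto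
qed auto

lemma keys_mult_append:
  "w \<in> keys (a * b :: ('s, 'k::field) ncpoly) \<Longrightarrow> \<exists>u\<in>keys a. \<exists>v\<in>keys b. w = u @ v"
  using keys_mult[of a b] unfolding plus_list_def by blast

lemma lookup_scalar_mult: "lookup (scalar c * b :: ('s, 'k::field) ncpoly) w = c * lookup b w"
proof -
  have "scalar c * b = Poly_Mapping.map ((*) c) b"
    using mult_map_scale_conv_mult[of c b] by (simp add: zero_list_def)
  then show ?thesis by (simp add: map.rep_eq when_def)
qed

lemma keys_scalar_mult: "keys (scalar c * b :: ('s, 'k::field) ncpoly) \<subseteq> keys b"
  by (auto simp: in_keys_iff lookup_scalar_mult)

lemma scalar_mult_single: "scalar c * Poly_Mapping.single w d = Poly_Mapping.single w (c * d :: 'k::field)"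
  by (simp add: mult_single plus_list_def)

lemma scalar_mult_mon: "scalar c * mon w = Poly_Mapping.single w (c :: 'k::field)"
  by (simp add: scalar_mult_single)

lemma mon_append: "mon (v @ w) = (mon v * mon w :: ('s, 'k::field) ncpoly)"
  by (simp add: mult_single plus_list_def)

lemma mon_Cons: "mon (x # w) = (mon [x] * mon w :: ('s, 'k::field) ncpoly)"
  using mon_append[of "[x]" w] by simp

lemma expand_mon: "(b :: ('s, 'k::field) ncpoly) = (\<Sum>w\<in>keys b. scalar (lookup b w) * mon w)"
proof (rule poly_mapping_eqI)
  fix v
  have "lookup (\<Sum>w\<in>keys b. scalar (lookup b w) * mon w) v
      = (\<Sum>w\<in>keys b. if w = v then lookup b v else 0)"
    by (simp add: lookup_sum lookup_scalar_mult lookup_single when_def if_distrib cong: if_cong)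
  also have "\<dots> = lookup b v" by (auto simp: in_keys_iff)
  finally show "lookup b v = lookup (\<Sum>w\<in>keys b. scalar (lookup b w) * mon w) v" by simp
qed

lemma keys_empty_imp_zero: "keys b = {} \<Longrightarrow> (b :: ('s, 'k::field) ncpoly) = 0"
  using expand_mon[of b] by simp

lemma scalar_one [simp]: "scalar (1 :: 'k::field) = 1"
  by (rule mon_Nil)

lemma scalar_scalar: "scalar a * (scalar b * x) = scalar (a * b) * (x :: ('s, 'k::field) ncpoly)"
  by (simp add: mult.assoc[symmetric] scalar_mult_single)

lemma scalar_add: "scalar (a + b) * x = scalar a * x + scalar b * (x :: ('s, 'k::field) ncpoly)"
  by (simp add: single_add distrib_right)

lemma scalar_commute: "(b :: ('s, 'k::field) ncpoly) * scalar c = scalar c * b"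
proof -
  have "mon w * scalar c = scalar c * (mon w :: ('s, 'k) ncpoly)" for w
    by (simp add: mult_single plus_list_def)
  then have "(scalar (lookup b w) * mon w) * scalar c = scalar c * (scalar (lookup b w) * mon w)" for w
    by (simp add: mult.assoc scalar_scalar mult.commute)
  then show ?thesis by (subst (1 2) expand_mon[of b]) (simp add: sum_distrib_left sum_distrib_right)
qed

lemma mult_scalar_left: "b * (scalar c * x) = scalar c * (b * (x :: ('s, 'k::field) ncpoly))"
  by (metis mult.assoc scalar_commute)

text \<open>
Signs are treated as scalars, which are central.
\<close>

lemma minus_one_power: "((- 1) ^ n :: ('s, 'k::field) ncpoly) = scalar ((- 1) ^ n)"
  by (cases "even n") (simp_all, metis scalar_one single_uminus)

lemma minus_one_power_left:
  "b * ((- 1) ^ n * x) = (- 1) ^ n * (b * (x :: ('s, 'k::field) ncpoly))"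
  unfolding minus_one_power by (rule mult_scalar_left)

definition lin :: "('s list \<Rightarrow> ('t, 'k::field) ncpoly) \<Rightarrow> ('s, 'k) ncpoly \<Rightarrow> ('t, 'k) ncpoly"
  where "lin F b = (\<Sum>w\<in>keys b. scalar (lookup b w) * F w)"

lemma lin_superset: "finite K \<Longrightarrow> keys b \<subseteq> K \<Longrightarrow> lin F b = (\<Sum>w\<in>K. scalar (lookup b w) * F w)"
  unfolding lin_def by (rule sum.mono_neutral_left) (auto simp: in_keys_iff)

lemma lin_zero [simp]: "lin F 0 = 0"
  by (simp add: lin_def)

lemma lin_add: "lin F (a + b) = lin F a + lin F b"
proof -
  let ?K = "keys a \<union> keys b"
  have "lin F (a + b) = (\<Sum>w\<in>?K. scalar (lookup (a + b) w) * F w)"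
    by (rule lin_superset) (use Poly_Mapping.keys_add[of a b] in auto)
  also have "\<dots> = (\<Sum>w\<in>?K. scalar (lookup a w) * F w) + (\<Sum>w\<in>?K. scalar (lookup b w) * F w)"
    by (simp add: lookup_add scalar_add sum.distrib)
  finally show ?thesis using lin_superset[of ?K a F] lin_superset[of ?K b F] by simp
qed

lemma lin_scalar: "lin F (scalar c * b) = scalar c * lin F b"
proof -
  have "lin F (scalar c * b) = (\<Sum>w\<in>keys b. scalar (lookup (scalar c * b) w) * F w)"
    by (rule lin_superset) (use keys_scalar_mult in auto)
  then show ?thesis by (simp add: lin_def lookup_scalar_mult scalar_scalar sum_distrib_left)
qed

lemma lin_mon [simp]: "lin F (mon w) = F w"
  by (simp add: lin_def)

lemma lin_single: "lin F (Poly_Mapping.single w c) = scalar c * F w"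
  using lin_scalar[of F c "mon w"] by (simp add: scalar_mult_mon)

lemma lin_uminus: "lin F (- b) = - lin F b"
  by (metis add.right_inverse eq_neg_iff_add_eq_0 lin_add lin_zero add.commute)

lemma lin_diff: "lin F (a - b) = lin F a - lin F b"
  using lin_add[of F a "- b"] by (simp add: lin_uminus)

lemma lin_sum: "lin F (sum g A) = (\<Sum>a\<in>A. lin F (g a))"
  by (induction A rule: infinite_finite_induct) (simp_all add: lin_add)

lemma lin_sign: "lin F ((- 1) ^ n * b) = (- 1) ^ n * lin F b"
  unfolding minus_one_power by (rule lin_scalar)

lemma lin_cong: "(\<And>w. w \<in> keys b \<Longrightarrow> F w = G w) \<Longrightarrow> lin F b = lin G b"
  by (simp add: lin_def)

lemma keys_lin: "v \<in> keys (lin F b) \<Longrightarrow> \<exists>w\<in>keys b. v \<in> keys (F w)"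
  unfolding lin_def using keys_sum_subset[of "\<lambda>w. scalar (lookup b w) * F w" "keys b"] keys_scalar_mult
  by blast

lemma lookup_lin: "lookup (lin F b) v = (\<Sum>w\<in>keys b. lookup b w * lookup (F w) v)"
  by (simp add: lin_def lookup_sum lookup_scalar_mult)

lemma linear_induct [consumes 1, case_names zero add]:
  assumes "keys b \<subseteq> K"
    and "P 0" "\<And>w c b. w \<in> K \<Longrightarrow> P b \<Longrightarrow> P (scalar c * mon w + b)"
  shows "P (b :: ('s, 'k::field) ncpoly)"
proof -
  have "P (\<Sum>w\<in>A. scalar (lookup b w) * mon w)" if "finite A" "A \<subseteq> K" for A
    using that by (induction A) (simp_all add: assms)
  then show ?thesis using expand_mon[of b] assms(1) by (metis finite_keys)
qed


definition wdeg :: "('s \<Rightarrow> nat) \<Rightarrow> 's list \<Rightarrow> nat"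
  where "wdeg dg w = sum_list (map dg w)"

lemma wdeg_simps [simp]: "wdeg dg [] = 0" "wdeg dg (x # w) = dg x + wdeg dg w"
  "wdeg dg (v @ w) = wdeg dg v + wdeg dg w"
  by (simp_all add: wdeg_def)

fun der :: "('s \<Rightarrow> nat) \<Rightarrow> ('s \<Rightarrow> ('s, 'k::field) ncpoly) \<Rightarrow> 's list \<Rightarrow> ('s, 'k) ncpoly"
  where
    "der dg D [] = 0"
  | "der dg D (x # w) = D x * mon w + (- 1) ^ dg x * (mon [x] * der dg D w)"

lemma der_cong: "(\<And>x. x \<in> set w \<Longrightarrow> D x = E x) \<Longrightarrow> der dg D w = der dg E w"
  by (induction w) auto

lemma der_append:
  "der dg D (v @ w) = der dg D v * mon w + (- 1) ^ wdeg dg v * (mon v * der dg D w)"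
proof (induction v)
  case (Cons x v)
  have "(- 1) ^ dg x * (mon [x] * ((- 1) ^ wdeg dg v * (mon v * der dg D w)))
      = (- 1) ^ (dg x + wdeg dg v) * (mon (x # v) * der dg D w)"
    by (subst minus_one_power_left, subst mon_Cons) (simp add: power_add mult.assoc)
  then show ?case using Cons
    by (simp add: mon_append distrib_left distrib_right mult.assoc)
qed simp

lemma keys_der_Cons:
  assumes "v \<in> keys (der dg D (x # w))"
  shows "(\<exists>u\<in>keys (D x). v = u @ w) \<or> (\<exists>u\<in>keys (der dg D w). v = x # u)"
proof -
  have "v \<in> keys (D x * mon w) \<or> v \<in> keys ((- 1) ^ dg x * (mon [x] * der dg D w))"
    using assms Poly_Mapping.keys_add[of "D x * mon w"] by auto
  moreover have "v \<in> keys (mon [x] * der dg D w)" if "v \<in> keys ((- 1) ^ dg x * (mon [x] * der dg D w))"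
    using that keys_scalar_mult unfolding minus_one_power by blast
  ultimately have "v \<in> keys (D x * mon w) \<or> v \<in> keys (mon [x] * der dg D w)" by blast
  then show ?thesis using keys_mult_append[of v "D x" "mon w"]
      keys_mult_append[of v "mon [x]" "der dg D w"] by auto
qed

lemma keys_der:
  assumes "v \<in> keys (der dg D w)"
  shows "\<exists>a x b u. w = a @ x # b \<and> u \<in> keys (D x) \<and> v = a @ u @ b"
  using assms
proof (induction w arbitrary: v)
  case (Cons y w)
  from keys_der_Cons[OF Cons.prems] show ?case
  proof
    assume "\<exists>u\<in>keys (D y). v = u @ w"
    then show ?thesis by (metis append_Nil)
  next
    assume "\<exists>u\<in>keys (der dg D w). v = y # u"
    then show ?thesis using Cons.IH by (metis append_Cons)
  qed
qed simp

lemma lin_der_mon_mult: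
  "lin (der dg D) (mon v * c) = der dg D v * c + (- 1) ^ wdeg dg v * (mon v * lin (der dg D) c)"
proof (induction c rule: linear_induct[OF subset_UNIV])
  case (2 w a c)
  have "mon v * (scalar a * mon w + c) = scalar a * mon (v @ w) + mon v * c"
    by (simp add: distrib_left mult_scalar_left[of "mon v"] mon_append)
  then show ?case using 2
    by (simp add: lin_add lin_scalar der_append distrib_left mult_scalar_left[of "mon v"]
        mult_scalar_left[of "der dg D v"] mult_scalar_left[of "(- 1) ^ wdeg dg v"])
qed simp

lemma lin_der_mult:
  assumes "\<And>w. w \<in> keys b \<Longrightarrow> wdeg dg w = n"
  shows "lin (der dg D) (b * c) = lin (der dg D) b * c + (- 1) ^ n * (b * lin (der dg D) c)"
proof -
  have "keys b \<subseteq> {w. wdeg dg w = n}" using assms by auto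
  then show ?thesis
  proof (induction b rule: linear_induct)
    case (add w a b)
    have "(scalar a * mon w + b) * c = scalar a * (mon w * c) + b * c"
      by (simp add: distrib_right mult.assoc)
    then show ?case using add
      by (simp add: lin_add lin_scalar lin_der_mon_mult distrib_left distrib_right mult.assoc
          mult_scalar_left[of "(- 1) ^ n"])
  qed simp
qed

text \<open>
The square of a derivation of odd degree is a derivation, so it vanishes if it does so on the
letters.
\<close>

lemma der_square:
  assumes "\<And>x v. x \<in> set w \<Longrightarrow> v \<in> keys (D x) \<Longrightarrow> wdeg dg v + 1 = dg x"
    and "\<And>x. x \<in> set w \<Longrightarrow> lin (der dg D) (D x) = 0"
  shows "lin (der dg D) (der dg D w) = 0"
  using assms
proof (induction w)
  case (Cons x w)
  let ?d = "lin (der dg D)"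
  have IH: "?d (der dg D w) = 0" using Cons by simp
  have m: "?d (mon [x] * der dg D w) = D x * der dg D w"
    by (simp add: lin_der_mon_mult IH)
  show ?case
  proof (cases "dg x")
    case 0
    then have "keys (D x) = {}" using Cons.prems(1)[of x] by (intro equals0I) auto
    then have "D x = 0" by (rule keys_empty_imp_zero)
    then show ?thesis using m by (simp add: lin_sign)
  next
    case (Suc n)
    have "?d (D x * mon w) = ?d (D x) * mon w + (- 1) ^ n * (D x * ?d (mon w))"
      by (rule lin_der_mult) (use Cons.prems(1)[of x] Suc in simp)
    then show ?thesis using m Suc Cons.prems(2)[of x] by (simp add: lin_diff lin_sign)
  qed
qed simp

section \<open>The square of the differential of the monomial model\<close>

lemma der_sum:
  "der dg D w = (\<Sum>i<length w. (- 1) ^ wdeg dg (take i w) *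
     (mon (take i w) * (D (w ! i) * mon (drop (Suc i) w))))"
proof (induction w)
  case (Cons x w)
  have "(- 1) ^ dg x * (mon [x] * ((- 1) ^ wdeg dg (take i w) *
        (mon (take i w) * (D (w ! i) * mon (drop (Suc i) w))))) =
      (- 1) ^ (dg x + wdeg dg (take i w)) * (mon (x # take i w) * (D (w ! i) * mon (drop (Suc i) w)))" for i
    by (subst minus_one_power_left, subst mon_Cons) (simp add: power_add mult.assoc)
  then show ?case
    by (simp add: Cons sum.lessThan_Suc_shift sum_distrib_left del: sum.lessThan_Suc)
qed simp

lemma word_degree_wdeg: "word_degree X R w = wdeg (chain_degree X R) w"
  by (simp add: word_degree_def wdeg_def)

lemma monomial_diff_word_der:
  "monomial_diff_word X R w = der (chain_degree X R) (monomial_diff_chain X R) w"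
  by (induction w) simp_all

lemma monomial_diff_lin: "monomial_diff X R = lin (der (chain_degree X R) (monomial_diff_chain X R))"
  by (rule ext) (simp add: monomial_diff_def lin_def monomial_diff_word_der)

context chain_words
begin

abbreviation dg :: "'x list \<Rightarrow> nat" where "dg \<equiv> chain_degree X R"
abbreviation wd :: "'x list list \<Rightarrow> nat" where "wd \<equiv> wdeg dg"

lemma chain_nonempty: "\<gamma> \<in> chains X R \<Longrightarrow> \<gamma> \<noteq> []"
  using chains_tail chain_tail_facts(4) by blast

lemma chain_in_lists: "\<gamma> \<in> chains X R \<Longrightarrow> \<gamma> \<in> lists X"
  using chains_tail chain_tail_facts(3) by blast

lemma length_le_length_concat: "gs \<in> lists (chains X R) \<Longrightarrow> length gs \<le> length (concat gs)"
proof (induction gs)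
  case (Cons g gs)
  then show ?case using chain_nonempty[of g] by (cases g) auto
qed simp

lemma finite_decompositions: "finite (decompositions X R \<gamma>)"
proof (rule finite_subset)
  show "decompositions X R \<gamma> \<subseteq> {gs. set gs \<subseteq> set (sublists \<gamma>) \<and> length gs \<le> length \<gamma>}"
  proof
    fix gs assume gs: "gs \<in> decompositions X R \<gamma>"
    then have c: "concat gs = \<gamma>" "gs \<in> lists (chains X R)" by (auto simp: decompositions_def)
    have "sublist g \<gamma>" if g: "g \<in> set gs" for g
    proof -
      obtain a b where "gs = a @ g # b" using split_list[OF g] by blast
      then show ?thesis using c by (auto simp: sublist_def)
    qed
    then show "gs \<in> {gs. set gs \<subseteq> set (sublists \<gamma>) \<and> length gs \<le> length \<gamma>}"
      using length_le_length_concat[OF c(2)] c(1) by auto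
  qed
  show "finite {gs. set gs \<subseteq> set (sublists \<gamma>) \<and> length gs \<le> length \<gamma>}"
    by (rule finite_lists_length_le) simp
qed

abbreviation sg :: "'x list list \<Rightarrow> 'k::field"
  where "sg gs \<equiv> - ((- 1) ^ ((length gs + 1) + dg (hd gs) + 1))"

lemma monomial_diff_chain_sum:
  "monomial_diff_chain X R \<gamma> = (\<Sum>gs\<in>decompositions X R \<gamma>. Poly_Mapping.single gs (sg gs))"
  by (simp add: monomial_diff_chain_def sum_negf[symmetric] single_uminus[symmetric])

lemma lookup_monomial_diff_chain:
  "lookup (monomial_diff_chain X R \<gamma>) gs = (if gs \<in> decompositions X R \<gamma> then sg gs else 0)"
  using finite_decompositions[of \<gamma>]
  by (simp add: monomial_diff_chain_sum lookup_sum lookup_single when_def if_distrib cong: if_cong)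

lemma keys_monomial_diff_chain: "keys (monomial_diff_chain X R \<gamma> :: ('x list, 'k::field) ncpoly) = decompositions X R \<gamma>"
  by (auto simp: in_keys_iff lookup_monomial_diff_chain split: if_splits)

text \<open>The blocks of the corresponding path of links, as pairs of places (see \<open>two_merges\<close>).\<close>

definition merges :: "'x list list \<Rightarrow> (nat \<times> nat) set"
  where "merges \<alpha> = {(i, k). i + 2 \<le> k \<and> k \<le> length \<alpha> \<and>
    is_chain X R (wd (slice \<alpha> i k) + 1) (concat (slice \<alpha> i k))}"

text \<open>
The exponent of the sign with which merging a block contributes to the square of the differential,
up to an exponent that is the same for all blocks of the word (see \<open>nested_sign_unmerge\<close>). The case
distinction arises because the sign of a decomposition involves the degree of its first member,
which the merge changes iff the block is an initial one.
\<close>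

definition merge_sign :: "'x list list \<Rightarrow> nat \<times> nat \<Rightarrow> nat"
  where "merge_sign \<alpha> = (\<lambda>(i, k). if i = 0 then wd (take k \<alpha>) + 1 else wd (take (Suc i) \<alpha>))"

lemma wd_slice: "i \<le> k \<Longrightarrow> wd (slice \<alpha> i k) = wd (take k \<alpha>) - wd (take i \<alpha>)"
proof -
  assume "i \<le> k"
  then have "take k \<alpha> = take i \<alpha> @ slice \<alpha> i k"
    using slice_append[of 0 i k \<alpha>] by (simp add: slice_def)
  then show ?thesis by simp
qed

lemma wd_take: "wd (take k \<alpha>) = (\<Sum>i<min k (length \<alpha>). dg (\<alpha> ! i))"
  by (simp add: wdeg_def sum_list_sum_nth atLeast0LessThan min.commute)

lemma concat_slice:
  assumes "i \<le> k" "k \<le> length \<alpha>"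
  shows "concat (slice \<alpha> i k) =
    slice (concat \<alpha>) (length (concat (take i \<alpha>))) (length (concat (take k \<alpha>)))"
proof -
  have "take i \<alpha> @ slice \<alpha> i k = take k \<alpha>" using slice_append[of 0 i k \<alpha>] assms by (simp add: slice_def)
  then have t: "concat (take k \<alpha>) = concat (take i \<alpha>) @ concat (slice \<alpha> i k)"
    by (metis concat_append)
  have "concat \<alpha> = concat (take i \<alpha>) @ concat (slice \<alpha> i k) @ concat (drop k \<alpha>)"
    by (metis append.assoc append_take_drop_id concat_append t)
  then show ?thesis using t by (simp add: slice_def)
qed

text \<open>
The positions where the chains of \<open>\<alpha>\<close> end form a path of links inside the word \<open>\<gamma>\<close>.
\<close>

lemma two_merges:
  assumes \<gamma>: "\<gamma> \<in> chains X R" and \<alpha>: "\<alpha> \<in> lists (chains X R)" "concat \<alpha> = \<gamma>" "wd \<alpha> + 2 = dg \<gamma>"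
  shows "\<exists>b1 b2. merges \<alpha> = {b1, b2} \<and> even (merge_sign \<alpha> b1) \<noteq> even (merge_sign \<alpha> b2)"
proof -
  define N where "N = length \<alpha>"
  define q where "q = (\<lambda>k. length (concat (take k \<alpha>)))"
  define rr where "rr = (\<lambda>i. dg (\<alpha> ! i))"
  interpret ladder "reach R \<gamma>" by (rule reach_ladder)
  have \<gamma>X: "\<gamma> \<in> lists X" by (rule chain_in_lists[OF \<gamma>])
  have q_mono: "q i \<le> q k" if "i \<le> k" for i k
  proof -
    have "take k \<alpha> = take i \<alpha> @ slice \<alpha> i k"
      using slice_append[of 0 i k \<alpha>] that by (simp add: slice_def)
    then show ?thesis unfolding q_def by simp
  qed
  have qN: "q N = length \<gamma>" by (simp add: q_def N_def \<alpha>)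
  have cs: "concat (slice \<alpha> i k) = slice \<gamma> (q i) (q k)" if "i \<le> k" "k \<le> N" for i k
    using concat_slice[of i k \<alpha>] that by (simp add: N_def q_def \<alpha>)
  have chain_link: "is_chain X R r (concat (slice \<alpha> i k)) \<longleftrightarrow> link (q i) (q k) r"
    if "i \<le> k" "k \<le> N" for i k r
    unfolding cs[OF that]
    by (rule is_chain_slice_iff) (use q_mono that qN q_mono[of k N] slice_in_lists[OF \<gamma>X] in auto)
  interpret ladder_path "reach R \<gamma>" N q rr
  proof
    fix k assume k: "k < N"
    have "slice \<alpha> k (Suc k) = [\<alpha> ! k]"
      using k by (simp add: slice_def N_def take_Suc_conv_app_nth hd_drop_conv_nth take_Suc)
    moreover have "\<alpha> ! k \<in> chains X R" using \<alpha>(1) k by (auto simp: N_def)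
    then have "is_chain X R (rr k) (\<alpha> ! k)"
      using chain_degree_eq by (auto simp: chains_def rr_def)
    ultimately show "link (q k) (q (Suc k)) (rr k)"
      using chain_link[of k "Suc k" "rr k"] k by simp
  qed
  have S: "S k = wd (take k \<alpha>)" if "k \<le> N" for k
    using that unfolding S_def wd_take by (simp add: rr_def N_def min_def)
  have SN: "S N = wd \<alpha>" using S[of N] by (simp add: N_def)
  interpret ladder_double "reach R \<gamma>" N q rr
  proof
    have "slice \<alpha> 0 N = \<alpha>" by (simp add: slice_def N_def)
    moreover have "is_chain X R (S N + 2) \<gamma>"
      using \<gamma> chain_degree_eq \<alpha>(3) SN by (auto simp: chains_def)
    ultimately show "link (q 0) (q N) (S N + 2)" using chain_link[of 0 N "S N + 2"] \<alpha>(2) by simp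
  qed
  have block: "(i, k) \<in> merges \<alpha> \<longleftrightarrow> block i k" for i k
  proof (cases "i + 2 \<le> k \<and> k \<le> N")
    case True
    then have "wd (slice \<alpha> i k) = S k - S i" using S[of i] S[of k] by (simp add: wd_slice)
    then show ?thesis using chain_link[of i k] True
      by (simp add: merges_def block_def N_def[symmetric])
  qed (auto simp: merges_def block_def N_def[symmetric])
  have sign: "merge_sign \<alpha> (i, k) = (if i = 0 then S k + 1 else S (Suc i))" if "block i k" for i k
    using that S[of k] S[of "Suc i"] by (auto simp: merge_sign_def block_def)
  from two_blocks obtain i1 k1 i2 k2 where
    b: "\<forall>i k. block i k \<longleftrightarrow> (i, k) = (i1, k1) \<or> (i, k) = (i2, k2)" and
    e: "even (if i1 = 0 then S k1 + 1 else S (Suc i1)) \<noteq> even (if i2 = 0 then S k2 + 1 else S (Suc i2))"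
    by blast
  have "merges \<alpha> = {(i1, k1), (i2, k2)}"
  proof (rule Set.set_eqI)
    fix p :: "nat \<times> nat"
    obtain i k where p: "p = (i, k)" by (cases p)
    show "p \<in> merges \<alpha> \<longleftrightarrow> p \<in> {(i1, k1), (i2, k2)}"
      unfolding p block b[rule_format] by blast
  qed
  moreover have "block i1 k1" "block i2 k2" using b by blast+
  then have "even (merge_sign \<alpha> (i1, k1)) \<noteq> even (merge_sign \<alpha> (i2, k2))"
    using e by (simp only: sign) blast
  ultimately show ?thesis by blast
qed

text \<open>The index set of the terms of the square, before terms with equal words are collected.\<close>

definition nested :: "'x list \<Rightarrow> ('x list list \<times> nat \<times> 'x list list) set"
  where "nested \<gamma> = (SIGMA gs:decompositions X R \<gamma>. SIGMA i:{..<length gs}. decompositions X R (gs ! i))"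

definition flat :: "'x list list \<times> nat \<times> 'x list list \<Rightarrow> 'x list list"
  where "flat = (\<lambda>(gs, i, \<delta>). take i gs @ \<delta> @ drop (Suc i) gs)"

definition nested_sign :: "'x list list \<times> nat \<times> 'x list list \<Rightarrow> 'k::field"
  where "nested_sign = (\<lambda>(gs, i, \<delta>). sg gs * ((- 1) ^ wd (take i gs) * sg \<delta>))"

definition unmerge :: "'x list list \<Rightarrow> nat \<times> nat \<Rightarrow> 'x list list \<times> nat \<times> 'x list list"
  where "unmerge \<alpha> = (\<lambda>(i, k). (take i \<alpha> @ [concat (slice \<alpha> i k)] @ drop k \<alpha>, i, slice \<alpha> i k))"

lemma finite_nested: "finite (nested \<gamma>)"
  unfolding nested_def by (intro finite_SigmaI finite_decompositions) auto

lemma diff_square_sum: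
  "lin (der dg (monomial_diff_chain X R)) (monomial_diff_chain X R \<gamma>) =
   (\<Sum>t\<in>nested \<gamma>. Poly_Mapping.single (flat t) (nested_sign t) :: ('x list, 'k::field) ncpoly)"
proof -
  let ?D = "monomial_diff_chain X R :: _ \<Rightarrow> ('x list, 'k) ncpoly"
  have "(- 1) ^ wd (take i gs) * (mon (take i gs) * (?D (gs ! i) * mon (drop (Suc i) gs))) =
      (\<Sum>\<delta>\<in>decompositions X R (gs ! i).
        Poly_Mapping.single (take i gs @ \<delta> @ drop (Suc i) gs) ((- 1) ^ wd (take i gs) * sg \<delta>))" for gs i
    unfolding minus_one_power monomial_diff_chain_sum
    by (simp add: sum_distrib_left sum_distrib_right mult_single plus_list_def)
  then have der: "der dg ?D gs = (\<Sum>i<length gs. \<Sum>\<delta>\<in>decompositions X R (gs ! i).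
        Poly_Mapping.single (take i gs @ \<delta> @ drop (Suc i) gs) ((- 1) ^ wd (take i gs) * sg \<delta>))" for gs
    by (subst der_sum) simp
  have "lin (der dg ?D) (?D \<gamma>) = (\<Sum>gs\<in>decompositions X R \<gamma>. scalar (sg gs) * der dg ?D gs)"
    by (subst monomial_diff_chain_sum) (simp only: lin_sum lin_single)
  also have "\<dots> = (\<Sum>gs\<in>decompositions X R \<gamma>. \<Sum>i<length gs. \<Sum>\<delta>\<in>decompositions X R (gs ! i).
        Poly_Mapping.single (flat (gs, i, \<delta>)) (nested_sign (gs, i, \<delta>)))"
    by (simp only: der sum_distrib_left scalar_mult_single flat_def nested_sign_def prod.case)
  also have "\<dots> = (\<Sum>t\<in>nested \<gamma>. Poly_Mapping.single (flat t) (nested_sign t))"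
    unfolding nested_def
    by (simp add: sum.Sigma finite_decompositions case_prod_unfold)
  finally show ?thesis .
qed

text \<open>
A term of the square is recovered from its word and the block that the inner decomposition fills.
\<close>

lemma flat_fiber:
  assumes \<gamma>: "\<gamma> \<in> chains X R" and t: "t0 \<in> nested \<gamma>" "flat t0 = \<alpha>"
  shows "\<alpha> \<in> lists (chains X R)" "concat \<alpha> = \<gamma>" "wd \<alpha> + 2 = dg \<gamma>"
    "{t \<in> nested \<gamma>. flat t = \<alpha>} = unmerge \<alpha> ` merges \<alpha>"
proof -
  have fiber: "\<alpha> \<in> lists (chains X R) \<and> concat \<alpha> = \<gamma> \<and> wd \<alpha> + 2 = dg \<gamma> \<and> t \<in> unmerge \<alpha> ` merges \<alpha>"
    if t: "t \<in> nested \<gamma>" "flat t = \<alpha>" for t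
  proof -
    obtain gs i \<delta> where t': "t = (gs, i, \<delta>)" by (cases t) auto
    have gs: "gs \<in> lists (chains X R)" "concat gs = \<gamma>" "wd gs + 1 = dg \<gamma>" "2 \<le> length gs" "i < length gs"
      and \<delta>: "\<delta> \<in> lists (chains X R)" "concat \<delta> = gs ! i" "wd \<delta> + 1 = dg (gs ! i)" "2 \<le> length \<delta>"
      using t(1) by (auto simp: nested_def t' decompositions_def word_degree_wdeg)
    have \<alpha>: "\<alpha> = take i gs @ \<delta> @ drop (Suc i) gs" using t(2) by (simp add: flat_def t')
    have split: "gs = take i gs @ [gs ! i] @ drop (Suc i) gs"
      using gs(5) by (simp add: Cons_nth_drop_Suc)
    define a b where "a = take i gs" and "b = drop (Suc i) gs"
    have gs_eq: "gs = a @ [concat \<delta>] @ b" using split \<delta>(2) by (simp add: a_def b_def)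
    have \<alpha>_eq: "\<alpha> = a @ \<delta> @ b" by (simp add: \<alpha> a_def b_def)
    have i: "i = length a" using gs(5) by (simp add: a_def)
    have ab: "a \<in> lists (chains X R)" "b \<in> lists (chains X R)" "concat \<delta> \<in> chains X R"
      using gs(1) unfolding gs_eq by auto
    have sl: "slice \<alpha> i (i + length \<delta>) = \<delta>" unfolding \<alpha>_eq i by (rule slice_mid)
    have "is_chain X R (wd \<delta> + 1) (concat \<delta>)"
      using ab(3) \<delta>(2,3) chain_degree_eq by (auto simp: chains_def)
    then have "(i, i + length \<delta>) \<in> merges \<alpha>"
      using sl \<delta>(4) by (auto simp: merges_def \<alpha>_eq i)
    moreover have "t = unmerge \<alpha> (i, i + length \<delta>)"
      using sl by (simp add: unmerge_def t' gs_eq) (simp add: \<alpha>_eq i)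
    ultimately have "t \<in> unmerge \<alpha> ` merges \<alpha>" by blast
    moreover have "\<alpha> \<in> lists (chains X R)" using ab \<delta>(1) by (simp add: \<alpha>_eq)
    moreover have "concat \<alpha> = \<gamma>" using gs(2) by (simp add: \<alpha>_eq gs_eq)
    moreover have "wd gs = wd a + dg (concat \<delta>) + wd b" unfolding gs_eq by simp
    then have "wd \<alpha> + 2 = dg \<gamma>" using gs(3) \<delta>(3) unfolding \<delta>(2) by (simp add: \<alpha>_eq)
    ultimately show ?thesis by blast
  qed
  from fiber[OF t] show \<alpha>: "\<alpha> \<in> lists (chains X R)" "concat \<alpha> = \<gamma>" "wd \<alpha> + 2 = dg \<gamma>" by blast+
  have "unmerge \<alpha> (i, k) \<in> nested \<gamma> \<and> flat (unmerge \<alpha> (i, k)) = \<alpha>" if "(i, k) \<in> merges \<alpha>" for i k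
  proof -
    from that have ik: "i + 2 \<le> k" "k \<le> length \<alpha>"
      and ch: "is_chain X R (wd (slice \<alpha> i k) + 1) (concat (slice \<alpha> i k))" by (auto simp: merges_def)
    define a \<delta> b where "a = take i \<alpha>" and "\<delta> = slice \<alpha> i k" and "b = drop k \<alpha>"
    have "take k \<alpha> = a @ \<delta>" using slice_append[of 0 i k \<alpha>] ik by (simp add: slice_def a_def \<delta>_def)
    then have \<alpha>_eq: "\<alpha> = a @ \<delta> @ b" unfolding b_def by (metis append.assoc append_take_drop_id)
    have i: "i = length a" using ik by (simp add: a_def)
    have len: "length \<delta> = k - i" unfolding \<delta>_def using ik by (intro length_slice) auto
    have parts: "a \<in> lists (chains X R)" "\<delta> \<in> lists (chains X R)" "b \<in> lists (chains X R)"
      using \<alpha>(1) unfolding \<alpha>_eq by auto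
    have c: "concat \<delta> \<in> chains X R" "dg (concat \<delta>) = wd \<delta> + 1"
      using ch chain_degree_eq by (auto simp: chains_def \<delta>_def)
    let ?gs = "a @ [concat \<delta>] @ b"
    have ne: "a @ b \<noteq> []"
    proof
      assume "a @ b = []"
      then have "\<alpha> = \<delta>" using \<alpha>_eq by simp
      then show False using c \<alpha> by simp
    qed
    have "?gs \<in> decompositions X R \<gamma>"
      using ne parts c \<alpha> by (cases a; cases b) (auto simp: decompositions_def word_degree_wdeg \<alpha>_eq)
    moreover have "\<delta> \<in> decompositions X R (concat \<delta>)"
      using parts c len ik by (auto simp: decompositions_def word_degree_wdeg)
    ultimately have "(?gs, i, \<delta>) \<in> nested \<gamma>" by (simp add: nested_def i)
    moreover have "flat (?gs, i, \<delta>) = \<alpha>" by (simp add: flat_def i \<alpha>_eq)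
    moreover have "unmerge \<alpha> (i, k) = (?gs, i, \<delta>)"
      by (simp add: unmerge_def a_def \<delta>_def b_def)
    ultimately show ?thesis by simp
  qed
  then have "unmerge \<alpha> p \<in> {t \<in> nested \<gamma>. flat t = \<alpha>}" if "p \<in> merges \<alpha>" for p
    using that by (cases p) simp
  moreover have "t \<in> unmerge \<alpha> ` merges \<alpha>" if "t \<in> {t \<in> nested \<gamma>. flat t = \<alpha>}" for t
    using that fiber[of t] by simp
  ultimately show "{t \<in> nested \<gamma>. flat t = \<alpha>} = unmerge \<alpha> ` merges \<alpha>" by blast
qed

lemma unmerge_inj: "inj_on (unmerge \<alpha>) (merges \<alpha>)"
proof (rule inj_onI)
  fix p p' assume p: "p \<in> merges \<alpha>" "p' \<in> merges \<alpha>" "unmerge \<alpha> p = unmerge \<alpha> p'"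
  obtain i k i' k' where eq: "p = (i, k)" "p' = (i', k')" by (cases p, cases p')
  have ii: "i = i'" and "slice \<alpha> i k = slice \<alpha> i' k'" using p(3) by (auto simp: unmerge_def eq)
  then have "length (slice \<alpha> i k) = length (slice \<alpha> i k')" by simp
  then have "k - i = k' - i" using p(1,2) \<open>i = i'\<close> by (simp add: merges_def eq length_slice)
  then show "p = p'" using p(1,2) \<open>i = i'\<close> by (auto simp: merges_def eq)
qed

lemma nested_sign_unmerge:
  assumes "p \<in> merges \<alpha>"
  shows "nested_sign (unmerge \<alpha> p) = ((- 1) ^ (length \<alpha> + 1 + dg (hd \<alpha>) + merge_sign \<alpha> p) :: 'k::field)"
proof -
  obtain i k where p: "p = (i, k)" by (cases p)
  from assms have ik: "i + 2 \<le> k" "k \<le> length \<alpha>"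
    and ch: "is_chain X R (wd (slice \<alpha> i k) + 1) (concat (slice \<alpha> i k))" by (auto simp: merges_def p)
  let ?\<delta> = "slice \<alpha> i k" and ?gs = "take i \<alpha> @ [concat (slice \<alpha> i k)] @ drop k \<alpha>"
  have len: "length ?\<delta> = k - i" using ik by (intro length_slice) auto
  have hd: "hd ?\<delta> = \<alpha> ! i" using ik by (simp add: slice_def hd_drop_conv_nth)
  have tk: "take (Suc i) \<alpha> = take i \<alpha> @ [\<alpha> ! i]" using ik by (simp add: take_Suc_conv_app_nth)
  have lgs: "length ?gs + length ?\<delta> = length \<alpha> + 1" using ik len by simp
  have "nested_sign (unmerge \<alpha> p) =
      (- 1) ^ (length ?gs + dg (hd ?gs)) * ((- 1) ^ wd (take i ?gs) * (- 1) ^ (length ?\<delta> + dg (hd ?\<delta>)) :: 'k)"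
    by (simp add: nested_sign_def unmerge_def p)
  also have "\<dots> = (- 1) ^ (length ?gs + length ?\<delta> + dg (hd ?gs) + wd (take i ?gs) + dg (hd ?\<delta>))"
    by (simp only: power_add[symmetric] ac_simps)
  also have "\<dots> = (- 1) ^ (length \<alpha> + 1 + dg (hd \<alpha>) + merge_sign \<alpha> p)"
  proof (cases "i = 0")
    case True
    have "hd ?gs = concat ?\<delta>" "wd (take i ?gs) = 0" using True by simp_all
    moreover have "dg (concat ?\<delta>) = wd (take k \<alpha>) + 1"
      using chain_degree_eq[OF ch] True by (simp add: slice_def)
    moreover have "hd \<alpha> = \<alpha> ! 0" using ik by (cases \<alpha>) auto
    ultimately show ?thesis unfolding lgs hd by (simp add: merge_sign_def p True ac_simps)
  next
    case False
    then have "hd ?gs = hd \<alpha>" using ik by (cases \<alpha>; cases i) auto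
    moreover have "take i ?gs = take i \<alpha>" using ik by simp
    ultimately show ?thesis unfolding lgs hd using False by (simp add: merge_sign_def p tk ac_simps)
  qed
  finally show ?thesis .
qed

text \<open>
The terms are grouped by their words; each group consists of two terms with opposite signs.
\<close>

theorem monomial_diff_square:
  assumes \<gamma>: "\<gamma> \<in> chains X R"
  shows "lin (der dg (monomial_diff_chain X R)) (monomial_diff_chain X R \<gamma>) = (0 :: ('x list, 'k::field) ncpoly)"
proof -
  let ?s = "\<lambda>t. Poly_Mapping.single (flat t) (nested_sign t) :: ('x list, 'k) ncpoly"
  have "(\<Sum>t\<in>{t \<in> nested \<gamma>. flat t = \<alpha>}. ?s t) = 0" if "\<alpha> \<in> flat ` nested \<gamma>" for \<alpha>
  proof -
    from that obtain t0 where t0: "t0 \<in> nested \<gamma>" "flat t0 = \<alpha>" by blast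
    note fib = flat_fiber[OF \<gamma> t0]
    obtain b1 b2 where b: "merges \<alpha> = {b1, b2}" "even (merge_sign \<alpha> b1) \<noteq> even (merge_sign \<alpha> b2)"
      using two_merges[OF \<gamma> fib(1-3)] by blast
    have s: "?s (unmerge \<alpha> p) = Poly_Mapping.single \<alpha> ((- 1) ^ (length \<alpha> + 1 + dg (hd \<alpha>) + merge_sign \<alpha> p))"
      if "p \<in> merges \<alpha>" for p
    proof -
      have "flat (unmerge \<alpha> p) = \<alpha>" using fib(4) that by blast
      then show ?thesis by (simp only: nested_sign_unmerge[OF that])
    qed
    have "(\<Sum>t\<in>{t \<in> nested \<gamma>. flat t = \<alpha>}. ?s t) = (\<Sum>p\<in>merges \<alpha>. ?s (unmerge \<alpha> p))"
      unfolding fib(4) by (simp add: sum.reindex[OF unmerge_inj])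
    also have "\<dots> = (\<Sum>p\<in>merges \<alpha>. Poly_Mapping.single \<alpha> ((- 1) ^ (length \<alpha> + 1 + dg (hd \<alpha>) + merge_sign \<alpha> p)))"
      by (rule sum.cong[OF refl s])
    also have "\<dots> = 0"
    proof -
      have "b1 \<noteq> b2" using b(2) by auto
      then show ?thesis using b(2) unfolding b(1)
        by (cases "even (length \<alpha> + dg (hd \<alpha>))"; cases "even (merge_sign \<alpha> b1)")
          (simp_all add: single_add[symmetric])
    qed
    finally show ?thesis .
  qed
  then show ?thesis
    unfolding diff_square_sum by (subst sum.image_gen[OF finite_nested, of _ _ flat]) simp
qed

end

section \<open>A matching on the words of chains\<close>

lemma lookup_mult_mon_right: "lookup (b * mon w :: ('s, 'k::field) ncpoly) (u @ w) = lookup b u"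
proof (induction b rule: linear_induct[OF subset_UNIV])
  case (2 v c b)
  have "(scalar c * mon v + b) * mon w = scalar c * mon (v @ w) + b * mon w"
    by (simp add: distrib_right mult.assoc mon_append)
  then show ?case using 2
    by (simp add: lookup_add lookup_scalar_mult lookup_single when_def scalar_mult_mon)
qed simp

lemma lookup_mult_mon_left: "lookup (mon w * b :: ('s, 'k::field) ncpoly) (w @ u) = lookup b u"
proof (induction b rule: linear_induct[OF subset_UNIV])
  case (2 v c b)
  have "mon w * (scalar c * mon v + b) = scalar c * mon (w @ v) + mon w * b"
    by (simp add: distrib_left mult_scalar_left[of "mon w"] mon_append)
  then show ?case using 2
    by (simp add: lookup_add lookup_scalar_mult lookup_single when_def scalar_mult_mon)
qed simp

definition letters :: "'a list \<Rightarrow> 'a list list"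
  where "letters a = map (\<lambda>x. [x]) a"

lemma letters_simps [simp]: "letters [] = []" "letters (x # a) = [x] # letters a"
  "letters (a @ b) = letters a @ letters b" "concat (letters a) = a" "length (letters a) = length a"
  by (simp_all add: letters_def)

lemma letters_inj [simp]: "letters a = letters b \<longleftrightarrow> a = b"
  by (metis letters_simps(4))

lemma append_eq_letters: "w @ w' = letters a \<Longrightarrow> \<exists>b c. w = letters b \<and> w' = letters c \<and> a = b @ c"
  unfolding letters_def by (auto simp: append_eq_map_conv)

context chain_words
begin

abbreviation D' :: "'x list \<Rightarrow> ('x list, 'k::field) ncpoly"
  where "D' \<equiv> monomial_diff_chain X R"

abbreviation d' :: "'x list list \<Rightarrow> ('x list, 'k::field) ncpoly"
  where "d' \<equiv> der dg (monomial_diff_chain X R)"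

lemma chain_tail_letter: "chain_tail 0 \<gamma> t \<longleftrightarrow> (\<exists>x\<in>X. \<gamma> = [x] \<and> t = [x])"
  by (auto elim: chain_tail.cases intro: chain_tail.zero)

lemma letter_chain: "x \<in> X \<Longrightarrow> [x] \<in> chains X R"
  using chain_tail.zero chain_tail_chains by blast

lemma dg_letter: "x \<in> X \<Longrightarrow> dg [x] = 0"
  using chain_tail.zero chain_tail_degree by blast

lemma letters_chains: "a \<in> lists X \<Longrightarrow> letters a \<in> lists (chains X R)"
  by (induction a) (auto intro: letter_chain)

lemma wd_letters: "a \<in> lists X \<Longrightarrow> wd (letters a) = 0"
  by (induction a) (auto intro: dg_letter)

lemma wd_0_letters:
  assumes "w \<in> lists (chains X R)" "wd w = 0"
  shows "w = letters (concat w)" "concat w \<in> lists X"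
proof -
  have "w = letters (concat w) \<and> concat w \<in> lists X"
    using assms
  proof (induction w)
    case (Cons g w)
    then obtain t where "chain_tail 0 g t" using chains_tail[of g] by auto
    then show ?case using Cons by (auto simp: chain_tail_letter)
  qed simp
  then show "w = letters (concat w)" "concat w \<in> lists X" by blast+
qed

lemma concat_chains_in_lists: "w \<in> lists (chains X R) \<Longrightarrow> concat w \<in> lists X"
  using chain_in_lists by (induction w) auto

lemma keys_d':
  assumes "v \<in> keys (d' w :: ('x list, 'k::field) ncpoly)" "w \<in> lists (chains X R)"
  shows "concat v = concat w" "v \<in> lists (chains X R)"
  using keys_der[OF assms(1)] assms(2)
  by (auto simp: keys_monomial_diff_chain decompositions_def)

lemma D'_degree_0: "dg \<gamma> = 0 \<Longrightarrow> D' \<gamma> = 0"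
  by (rule keys_empty_imp_zero, subst keys_monomial_diff_chain) (auto simp: decompositions_def)

lemma d'_letters: "a \<in> lists X \<Longrightarrow> d' (letters a) = 0"
  by (induction a) (auto simp: D'_degree_0 dg_letter)

text \<open>
The first argument is the upper partner, the second one the lower partner, and the number is the
length of the underlying monomial from the chain where they differ to the end. Behind that chain
there are only letters, which form a normal monomial. In the rule \<open>here\<close> the last factor \<open>v\<close> of the
chain \<open>\<gamma> @ v\<close> is released into the letters; it is recovered as the shortest part of them that
extends \<open>\<gamma>\<close> to a longer chain.
\<close>

inductive matched :: "'x list list \<Rightarrow> 'x list list \<Rightarrow> nat \<Rightarrow> bool" where
  here: "chain_tail r \<gamma> t \<Longrightarrow> v \<in> lists X \<Longrightarrow> v \<noteq> [] \<Longrightarrow> minimally_zero R t v \<Longrightarrow>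
    a \<in> lists X \<Longrightarrow> normal_word R (v @ a) \<Longrightarrow>
    matched ((\<gamma> @ v) # letters a) (\<gamma> # letters (v @ a)) (length (\<gamma> @ v @ a))"
| there: "matched u v k \<Longrightarrow> \<gamma> \<in> chains X R \<Longrightarrow> matched (\<gamma> # u) (\<gamma> # v) k"

lemma chain_tail_extend:
  "chain_tail r \<gamma> t \<Longrightarrow> v \<in> lists X \<Longrightarrow> v \<noteq> [] \<Longrightarrow> minimally_zero R t v \<Longrightarrow> normal_word R (v @ a) \<Longrightarrow>
    chain_tail (Suc r) (\<gamma> @ v) v"
  by (rule chain_tail.Suc) (auto dest: normal_word_appendD)

lemma matched_facts:
  assumes "matched u v k"
  shows "u \<in> lists (chains X R)" "v \<in> lists (chains X R)" "concat u = concat v"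
    "wd u = wd v + 1" "k \<le> length (concat v)" "\<not> normal_word R (concat v)"
proof -
  have "u \<in> lists (chains X R) \<and> v \<in> lists (chains X R) \<and> concat u = concat v \<and>
    wd u = wd v + 1 \<and> k \<le> length (concat v) \<and> \<not> normal_word R (concat v)"
    using assms
  proof induction
    case (here r \<gamma> t v a)
    have ct: "chain_tail (Suc r) (\<gamma> @ v) v" by (rule chain_tail_extend) fact+
    obtain \<gamma>' where \<gamma>: "\<gamma> = \<gamma>' @ t" using chain_tail_facts(5)[OF here(1)] by (auto simp: suffix_def)
    have "\<not> normal_word R (\<gamma>' @ (t @ v) @ a)"
      using here(4) normal_word_appendD unfolding minimally_zero_def by blast
    then show ?case
      using chain_tail_chains[OF ct] chain_tail_chains[OF here(1)] letters_chains wd_letters here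
        chain_tail_degree[OF ct] chain_tail_degree[OF here(1)]
      by (auto simp: \<gamma>)
  next
    case (there u v k \<gamma>)
    then show ?case using normal_word_appendD(2)[of R \<gamma> "concat v"] by auto
  qed
  then show "u \<in> lists (chains X R)" "v \<in> lists (chains X R)" "concat u = concat v"
    "wd u = wd v + 1" "k \<le> length (concat v)" "\<not> normal_word R (concat v)" by blast+
qed

lemma matched_left_cases:
  assumes "matched (\<gamma> # u) v k"
  obtains (here) \<gamma>' w a where "chain_tail (dg \<gamma>) \<gamma> w" "\<gamma> = \<gamma>' @ w" "u = letters a"
      "normal_word R (w @ a)" "v = \<gamma>' # letters (w @ a)" "k = length (\<gamma>' @ w @ a)"
    | (there) v' where "matched u v' k" "v = \<gamma> # v'" "\<gamma> \<in> chains X R"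
  using assms
proof cases
  case (here r \<gamma>' t w a)
  then have "chain_tail (Suc r) (\<gamma>' @ w) w" by (blast intro: chain_tail_extend)
  then show ?thesis using that(1) here chain_tail_degree by metis
qed (use that(2) in blast)

lemma matched_right_cases:
  assumes "matched u (\<gamma> # w) k"
  obtains (here) t v a where "chain_tail (dg \<gamma>) \<gamma> t" "v \<noteq> []" "minimally_zero R t v"
      "w = letters (v @ a)" "normal_word R (v @ a)" "u = (\<gamma> @ v) # letters a" "k = length (\<gamma> @ v @ a)"
    | (there) u' where "matched u' w k" "u = \<gamma> # u'" "\<gamma> \<in> chains X R"
  using assms
proof cases
  case (here r t v a)
  then show ?thesis using that(1) chain_tail_degree by metis
qed (use that(2) in blast)

lemma letters_not_matched: "normal_word R a \<Longrightarrow> \<not> matched (letters a) v k"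
  "normal_word R a \<Longrightarrow> \<not> matched u (letters a) k"
  using matched_facts(3,6) by (metis letters_simps(4))+

lemma minimally_zero_unique:
  assumes "minimally_zero R t v" "minimally_zero R t v'" "v @ a = v' @ a'"
  shows "v = v'"
proof (rule ccontr)
  assume "v \<noteq> v'"
  then have "strict_prefix v v' \<or> strict_prefix v' v"
    using assms(3) by (metis prefixI prefix_same_cases strict_prefix_def)
  then show False using assms(1,2) by (auto simp: minimally_zero_def)
qed

lemma matched_inj:
  assumes "matched u v k" "matched u' v k'"
  shows "u = u' \<and> k = k'"
  using assms
proof (induction arbitrary: u' k')
  case (here r \<gamma> t v a)
  from here(7) show ?case
  proof (cases rule: matched_right_cases)
    case (here t' v' a')
    then have "t' = t" using here.hyps(1) chain_tail_unique \<open>chain_tail r \<gamma> t\<close> by blast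
    have e: "v @ a = v' @ a'" using here by (metis letters_inj)
    have "v = v'" by (rule minimally_zero_unique[OF _ _ e]) (use here \<open>t' = t\<close> \<open>minimally_zero R t v\<close> in auto)
    then show ?thesis using here e by simp
  next
    case (there u')
    then show ?thesis using letters_not_matched \<open>normal_word R (v @ a)\<close> by blast
  qed
next
  case (there u v k \<gamma>)
  from there(4) show ?case
  proof (cases rule: matched_right_cases)
    case (here t' v' a')
    then show ?thesis using letters_not_matched there.hyps(1) by blast
  next
    case (there u'')
    then show ?thesis using there.IH by blast
  qed
qed

text \<open>
In a lower partner the last factor of the chain where the change happens and the following letters
contain a relation, in an upper partner they do not.
\<close>

lemma matched_disjoint:
  assumes "matched u v k"
  shows "\<not> matched v w k'"
  using assms
proof (induction arbitrary: w k')
  case (here r \<gamma> t v a)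
  show ?case
  proof
    assume "matched (\<gamma> # letters (v @ a)) w k'"
    then show False
    proof (cases rule: matched_left_cases)
      case (here \<gamma>' t' b)
      have "t' = t" using here(1) chain_tail_unique \<open>chain_tail r \<gamma> t\<close> by blast
      moreover have "b = v @ a" using here(3) by (metis letters_inj)
      ultimately have "normal_word R (t @ v)" using here normal_word_appendD(1)[of R "t @ v" a] by simp
      then show False using \<open>minimally_zero R t v\<close> by (simp add: minimally_zero_def)
    next
      case (there v')
      then show False using letters_not_matched \<open>normal_word R (v @ a)\<close> by blast
    qed
  qed
next
  case (there u v k \<gamma>)
  show ?case
  proof
    assume "matched (\<gamma> # v) w k'"
    then show False
    proof (cases rule: matched_left_cases)
      case (here \<gamma>' t' b)
      then show False using letters_not_matched there.hyps(1) normal_word_appendD(2) by blast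
    next
      case (there v')
      then show False using there.IH by blast
    qed
  qed
qed

lemma matched_append: "matched u v k \<Longrightarrow> gs \<in> lists (chains X R) \<Longrightarrow> matched (gs @ u) (gs @ v) k"
  by (induction gs) (auto intro: matched.there)

lemma minimal_nonnormal_prefix:
  assumes "normal_word R t" "\<not> normal_word R (t @ a)"
  obtains v b where "a = v @ b" "v \<noteq> []" "minimally_zero R t v"
proof -
  let ?P = "\<lambda>n. \<not> normal_word R (t @ take n a)"
  define n where "n = (LEAST n. ?P n)"
  have P: "?P n" unfolding n_def by (rule LeastI[of ?P "length a"]) (use assms in simp)
  have least: "normal_word R (t @ take i a)" if "i < n" for i
    using not_less_Least[of i ?P] that by (auto simp: n_def)
  show ?thesis
  proof (rule that[of "take n a" "drop n a"])
    show "take n a \<noteq> []"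
    proof
      assume "take n a = []"
      then have "normal_word R (t @ take n a)" using assms(1) by (simp only: append_Nil2)
      then show False using P by blast
    qed
    show "minimally_zero R t (take n a)"
      unfolding minimally_zero_def
    proof (intro conjI allI impI)
      fix v' assume v': "strict_prefix v' (take n a)"
      then have "length v' < n" using prefix_length_less[OF v'] by simp
      moreover have "v' = take (length v') a"
        using v' by (metis append_eq_conv_conj prefix_def prefix_order.less_imp_le prefix_order.trans take_is_prefix)
      ultimately show "normal_word R (t @ v')" using least by metis
    qed (rule P)
  qed simp
qed

text \<open>
Read the word from the right as long as it consists of letters that form a normal monomial \<open>a\<close>, and
let \<open>\<gamma>\<close> be the chain before. If the last factor of \<open>\<gamma>\<close> and \<open>a\<close> form a non-normal monomial, then \<open>\<gamma>\<close>
extends to a longer chain and the word is a lower partner; otherwise it is an upper partner, or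
\<open>\<gamma>\<close> is a letter and the reading goes on.
\<close>

lemma matching_cases:
  assumes "w \<in> lists (chains X R)"
  obtains (critical) a where "a \<in> lists X" "normal_word R a" "w = letters a"
    | (upper) v k where "matched w v k"
    | (lower) u k where "matched u w k"
proof -
  have "(\<exists>a. a \<in> lists X \<and> normal_word R a \<and> w = letters a) \<or> (\<exists>v k. matched w v k) \<or> (\<exists>u k. matched u w k)"
    using assms
  proof (induction rule: lists.induct)
    case Nil
    then show ?case using normal_short[of "[]"] by (intro disjI1 exI[of _ "[]"]) auto
  next
    case (Cons \<gamma> w)
    from Cons.IH consider (c) a where "a \<in> lists X" "normal_word R a" "w = letters a"
      | (m) "(\<exists>v k. matched w v k) \<or> (\<exists>u k. matched u w k)" by blast
    then show ?case
    proof cases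
      case c
      from chains_tail[OF \<open>\<gamma> \<in> chains X R\<close>] obtain t where t: "chain_tail (dg \<gamma>) \<gamma> t" ..
      show ?thesis
      proof (cases "normal_word R (t @ a)")
        case False
        from minimal_nonnormal_prefix[OF chain_tail_facts(2)[OF t] False]
        obtain v b where "a = v @ b" "v \<noteq> []" "minimally_zero R t v" by blast
        then have "matched ((\<gamma> @ v) # letters b) (\<gamma> # letters (v @ b)) (length (\<gamma> @ v @ b))"
          using c t by (intro matched.here) auto
        then show ?thesis using c \<open>a = v @ b\<close> by blast
      next
        case n: True
        from t show ?thesis
        proof cases
          case (zero x)
          then show ?thesis using n c by (intro disjI1 exI[of _ "x # a"]) auto
        next
          case (Suc r \<gamma>' t')
          then have "matched ((\<gamma>' @ t) # letters a) (\<gamma>' # letters (t @ a)) (length (\<gamma>' @ t @ a))"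
            using c n by (intro matched.here) auto
          then show ?thesis using c Suc by blast
        qed
      qed
    next
      case m
      then show ?thesis using matched.there Cons.hyps by blast
    qed
  qed
  then show ?thesis using that by blast
qed

text \<open>
Acyclicity of the matching. Decomposing a chain to the left of the change leaves an upper partner,
which is not a lower one. Decomposing the chain of the change gives a word whose change lies
further to the right, unless all parts but the first are letters; then the first part is the
chain of the preceding degree that the given chain starts with, and the word is \<open>v\<close>.
\<close>

lemma matched_terms:
  assumes "matched u v k" "x \<in> keys (d' u :: ('x list, 'k::field) ncpoly)" "matched u' x k'"
  shows "x = v \<or> k' < k"
  using assms
proof (induction arbitrary: x u' k')
  case (here r \<gamma> t v a)
  have ct: "chain_tail (Suc r) (\<gamma> @ v) v" by (rule chain_tail_extend) fact+
  have "d' ((\<gamma> @ v) # letters a) = D' (\<gamma> @ v) * (mon (letters a) :: ('x list, 'k) ncpoly)"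
    using \<open>a \<in> lists X\<close> by (simp add: d'_letters)
  then obtain gs where gs: "gs \<in> decompositions X R (\<gamma> @ v)" "x = gs @ letters a"
    using keys_mult_append[of x "D' (\<gamma> @ v) :: ('x list, 'k) ncpoly" "mon (letters a)"] here.prems(1)
    by (auto simp: keys_monomial_diff_chain)
  obtain \<delta> gs' where gs': "gs = \<delta> # gs'" using gs(1) by (cases gs) (auto simp: decompositions_def)
  have dec: "\<delta> \<in> chains X R" "gs' \<in> lists (chains X R)" "\<delta> @ concat gs' = \<gamma> @ v" "dg \<delta> + wd gs' = r"
    using gs(1) chain_tail_degree[OF ct] by (auto simp: decompositions_def gs' word_degree_wdeg)
  from here.prems(2) have "matched u' (\<delta> # gs' @ letters a) k'" by (simp add: gs(2) gs')
  then show ?case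
  proof (cases rule: matched_right_cases)
    case (here s v' a')
    then obtain b where b: "gs' = letters b" using append_eq_letters by metis
    then have "b \<in> lists X" using concat_chains_in_lists[OF dec(2)] by simp
    then have "dg \<delta> = r" using dec(4) b wd_letters by simp
    then have "\<delta> = \<gamma>" using chain_prefix_unique[OF _ \<open>chain_tail r \<gamma> t\<close> dec(3)] here(1) by simp
    then show ?thesis using dec(3) gs(2) gs' b by simp
  next
    case (there u'')
    then have "k' \<le> length (concat (gs' @ letters a))" using matched_facts(5) by blast
    moreover have "length (\<gamma> @ v) = length \<delta> + length (concat gs')" using dec(3) by (metis length_append)
    moreover have "0 < length \<delta>" using chain_nonempty[OF dec(1)] by simp
    ultimately have "k' < length (\<gamma> @ v @ a)"
      unfolding length_append concat_append letters_simps by linarith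
    then show ?thesis ..
  qed
next
  case (there u v k \<gamma>)
  from keys_der_Cons[OF there.prems(1)] show ?case
  proof
    assume "\<exists>gs\<in>keys (D' \<gamma> :: ('x list, 'k) ncpoly). x = gs @ u"
    then obtain gs where "gs \<in> lists (chains X R)" "x = gs @ u"
      by (auto simp: keys_monomial_diff_chain decompositions_def)
    then have "matched x (gs @ v) k" using matched_append there.hyps(1) by blast
    then show ?thesis using matched_disjoint there.prems(2) by blast
  next
    assume "\<exists>y\<in>keys (d' u :: ('x list, 'k) ncpoly). x = \<gamma> # y"
    then obtain y where y: "y \<in> keys (d' u :: ('x list, 'k) ncpoly)" "x = \<gamma> # y" by blast
    from there.prems(2) have "matched u' (\<gamma> # y) k'" by (simp add: y)
    then show ?thesis
    proof (cases rule: matched_right_cases)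
      case (here s v' a')
      have "concat y = concat v"
        using keys_d'(1)[OF y(1)] matched_facts[OF there.hyps(1)] by simp
      then show ?thesis using here matched_facts(6)[OF there.hyps(1)] by simp
    next
      case (there u'')
      then show ?thesis using there.IH[OF y(1)] y(2) by blast
    qed
  qed
qed

text \<open>
The decomposition that releases the last factor occurs with coefficient \<open>1\<close> or \<open>-1\<close>, and it is not
cancelled: decomposing a chain further to the left leaves an upper partner.
\<close>

lemma matched_coefficient:
  assumes "matched u v k"
  shows "lookup (d' u :: ('x list, 'k::field) ncpoly) v \<noteq> 0"
  using assms
proof induction
  case (here r \<gamma> t v a)
  have ct: "chain_tail (Suc r) (\<gamma> @ v) v" by (rule chain_tail_extend) fact+
  have "d' ((\<gamma> @ v) # letters a) = D' (\<gamma> @ v) * (mon (letters a) :: ('x list, 'k) ncpoly)"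
    using \<open>a \<in> lists X\<close> by (simp add: d'_letters)
  moreover have "\<gamma> # letters (v @ a) = (\<gamma> # letters v) @ letters a" by simp
  moreover have "2 \<le> length (\<gamma> # letters v)" using \<open>v \<noteq> []\<close> by (cases v) auto
  then have "\<gamma> # letters v \<in> decompositions X R (\<gamma> @ v)"
    using chain_tail_chains[OF here(1)] letters_chains[OF here(2)] wd_letters[OF here(2)]
      chain_tail_degree[OF here(1)] chain_tail_degree[OF ct]
    by (simp add: decompositions_def word_degree_wdeg)
  ultimately show ?case by (simp only: lookup_mult_mon_right) (simp add: lookup_monomial_diff_chain)
next
  case (there u v k \<gamma>)
  have "\<gamma> # v \<notin> keys (D' \<gamma> * mon u :: ('x list, 'k) ncpoly)"
  proof
    assume "\<gamma> # v \<in> keys (D' \<gamma> * mon u :: ('x list, 'k) ncpoly)"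
    then obtain gs where "gs \<in> lists (chains X R)" "\<gamma> # v = gs @ u"
      using keys_mult_append[of "\<gamma> # v" "D' \<gamma> :: ('x list, 'k) ncpoly" "mon u"]
      by (auto simp: keys_monomial_diff_chain decompositions_def)
    then have "matched (\<gamma> # v) (gs @ v) k" using matched_append there.hyps(1) by metis
    then show False using matched_disjoint matched.there[OF there.hyps] by blast
  qed
  moreover have "lookup (mon [\<gamma>] * d' u :: ('x list, 'k) ncpoly) (\<gamma> # v) = lookup (d' u) v"
    using lookup_mult_mon_left[of "[\<gamma>]" "d' u" v] by simp
  ultimately show ?case
    using there.IH by (simp add: lookup_add minus_one_power lookup_scalar_mult in_keys_iff)
qed

end

section \<open>Lifting the differential\<close>

lemma lin_mult:
  assumes "\<And>v w. F (v @ w) = F v * F w"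
  shows "lin F (a * b) = lin F a * lin F b"
proof -
  have mon: "lin F (mon v * b) = F v * lin F b" for v
  proof (induction b rule: linear_induct[OF subset_UNIV])
    case (2 w c b)
    have "mon v * (scalar c * mon w + b) = scalar c * mon (v @ w) + mon v * b"
      by (simp add: distrib_left mult_scalar_left[of "mon v"] mon_append)
    then show ?case using 2
      by (simp add: lin_add lin_scalar distrib_left mult_scalar_left[of "F v"] assms)
  qed simp
  show ?thesis
  proof (induction a rule: linear_induct[OF subset_UNIV])
    case (2 w c a)
    have "(scalar c * mon w + a) * b = scalar c * (mon w * b) + a * b"
      by (simp add: distrib_right mult.assoc)
    then show ?case using 2 mon
      by (simp add: lin_add lin_scalar distrib_right mult.assoc)
  qed simp
qed

lemma lin_lin: "lin F (lin G b) = lin (\<lambda>w. lin F (G w)) b"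
  unfolding lin_def[of G] lin_def[of "\<lambda>w. lin F (G w)"] by (simp add: lin_sum lin_scalar)

lemma lin_fun_diff: "lin (\<lambda>w. F w - G w) b = lin F b - lin G b"
  by (simp add: lin_def right_diff_distrib sum_subtractf)

lemma lin_id: "lin mon b = b"
  by (simp add: lin_def expand_mon[symmetric])

lemma der_diff: "der dg D w - der dg E w = der dg (\<lambda>x. D x - E x) w"
proof (induction w)
  case (Cons x w)
  have "der dg D (x # w) - der dg E (x # w) =
      (D x - E x) * mon w + (- 1) ^ dg x * (mon [x] * (der dg D w - der dg E w))"
    by (simp add: left_diff_distrib right_diff_distrib)
  then show ?case by (simp add: Cons)
qed simp

locale groebner_setting = chain_words X R
  for X :: "'x set" and R :: "'x list set" +
  fixes r :: "'x list rel" and J G :: "('x, 'k::field) ncpoly set"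
  assumes order: "monomial_order X r"
    and ideal_J: "ideal J (free_algebra X)"
    and basis: "reduced_groebner_basis r J G"
    and R_leading: "R = leading_monomial r ` G"
begin

abbreviation less :: "'x list \<Rightarrow> 'x list \<Rightarrow> bool" (infix "\<prec>" 50)
  where "u \<prec> v \<equiv> (u, v) \<in> r \<and> u \<noteq> v"

lemma order_facts: "r \<subseteq> lists X \<times> lists X" "refl_on (lists X) r" "trans r" "antisym r"
    "total_on (lists X) r" "wf (r - Id)"
  using order by (auto simp: monomial_order_def well_order_on_def linear_order_on_def
      partial_order_on_def preorder_on_def)

lemma less_trans: "u \<prec> v \<Longrightarrow> v \<prec> w \<Longrightarrow> u \<prec> w"
  using order_facts by (meson antisymD transD)

lemma le_less_trans': "(u, v) \<in> r \<Longrightarrow> v \<prec> w \<Longrightarrow> u \<prec> w"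
  using order_facts by (meson antisymD transD)

lemma less_le_trans': "u \<prec> v \<Longrightarrow> (v, w) \<in> r \<Longrightarrow> u \<prec> w"
  using order_facts by (meson antisymD transD)

lemma le_trans': "(u, v) \<in> r \<Longrightarrow> (v, w) \<in> r \<Longrightarrow> (u, w) \<in> r"
  using order_facts by (meson transD)

lemma le_refl: "u \<in> lists X \<Longrightarrow> (u, u) \<in> r"
  using order_facts by (auto simp: refl_on_def)

lemma le_context: "(u, v) \<in> r \<Longrightarrow> a \<in> lists X \<Longrightarrow> b \<in> lists X \<Longrightarrow> (a @ u @ b, a @ v @ b) \<in> r"
  using order unfolding monomial_order_def by blast

lemma less_context: "u \<prec> v \<Longrightarrow> a \<in> lists X \<Longrightarrow> b \<in> lists X \<Longrightarrow> a @ u @ b \<prec> a @ v @ b"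
  using le_context by auto

lemma J_carrier: "f \<in> J \<Longrightarrow> keys f \<subseteq> lists X"
  using ideal.Icarr[OF ideal_J] by auto

lemma J_zero: "0 \<in> J"
  using additive_subgroup.zero_closed[OF ideal.axioms(1)[OF ideal_J]] by simp

lemma J_add: "f \<in> J \<Longrightarrow> g \<in> J \<Longrightarrow> f + g \<in> J"
  using additive_subgroup.a_closed[OF ideal.axioms(1)[OF ideal_J]] by simp

lemma J_mult: "f \<in> J \<Longrightarrow> keys g \<subseteq> lists X \<Longrightarrow> g * f \<in> J"
    "f \<in> J \<Longrightarrow> keys g \<subseteq> lists X \<Longrightarrow> f * g \<in> J"
  using ideal.I_l_closed[OF ideal_J, of f g] ideal.I_r_closed[OF ideal_J, of f g] by simp_all

lemma J_scalar: "f \<in> J \<Longrightarrow> scalar c * f \<in> J"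
  by (rule J_mult) auto

lemma J_sign: "f \<in> J \<Longrightarrow> (- 1) ^ n * f \<in> J"
  unfolding minus_one_power by (rule J_scalar)

lemma J_uminus: "f \<in> J \<Longrightarrow> - f \<in> J"
  using J_sign[of f 1] by simp

lemma J_diff: "f \<in> J \<Longrightarrow> g \<in> J \<Longrightarrow> f - g \<in> J"
  using J_add[of f "- g"] J_uminus by simp

lemma J_sum: "(\<And>a. a \<in> A \<Longrightarrow> f a \<in> J) \<Longrightarrow> sum f A \<in> J"
  by (induction A rule: infinite_finite_induct) (auto intro: J_zero J_add)

lemma J_lin: "(\<And>w. w \<in> keys b \<Longrightarrow> F w \<in> J) \<Longrightarrow> lin F b \<in> J"
  unfolding lin_def by (intro J_sum J_scalar)

lemma leading_monomial:
  assumes "f \<noteq> 0" "keys f \<subseteq> lists X"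
  shows "leading_monomial r f \<in> keys f" "w \<in> keys f \<Longrightarrow> (w, leading_monomial r f) \<in> r"
proof -
  have "\<exists>m\<in>keys f. \<forall>w\<in>keys f. (w, m) \<in> r"
  proof (rule ccontr)
    assume no: "\<not> ?thesis"
    have "keys f = {}"
    proof (rule finite_transitivity_chain[of "keys f" "\<lambda>u v. u \<prec> v"])
      fix u assume u: "u \<in> keys f"
      then obtain w where w: "w \<in> keys f" "(w, u) \<notin> r" using no by blast
      then have "u \<noteq> w" using le_refl assms(2) by blast
      then have "(u, w) \<in> r" using order_facts(5) u w assms(2) by (auto simp: total_on_def)
      then show "\<exists>v. v \<in> keys f \<and> u \<prec> v" using w \<open>u \<noteq> w\<close> by blast
    next
      show "u \<prec> w" if "u \<prec> v" "v \<prec> w" for u v w using that by (rule less_trans)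
    qed simp_all
    then show False using assms(1) keys_empty_imp_zero by blast
  qed
  then obtain m where m: "m \<in> keys f \<and> (\<forall>w\<in>keys f. (w, m) \<in> r)" by blast
  then have "leading_monomial r f = m"
    unfolding leading_monomial_def
    by (rule the_equality) (use m order_facts(4) in \<open>auto dest: antisymD\<close>)
  then show "leading_monomial r f \<in> keys f" "w \<in> keys f \<Longrightarrow> (w, leading_monomial r f) \<in> r"
    using m by auto
qed

lemma G_facts: "g \<in> G \<Longrightarrow> g \<in> J" "g \<in> G \<Longrightarrow> g \<noteq> 0" "g \<in> G \<Longrightarrow> lookup g (leading_monomial r g) = 1"
  using basis by (auto simp: reduced_groebner_basis_def groebner_basis_def)

text \<open>
Otherwise the leading monomial would be divisible by the leading monomial of a basis element.
\<close>

lemma normal_form_zero: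
  assumes "f \<in> J" "\<And>w. w \<in> keys f \<Longrightarrow> normal_word R w"
  shows "f = 0"
proof (rule ccontr)
  assume "f \<noteq> 0"
  then obtain g where g: "g \<in> G" "sublist (leading_monomial r g) (leading_monomial r f)"
    using basis assms(1) unfolding reduced_groebner_basis_def groebner_basis_def by blast
  then have "\<not> normal_word R (leading_monomial r f)"
    by (auto simp: normal_word_def R_leading)
  then show False using assms leading_monomial(1)[OF \<open>f \<noteq> 0\<close> J_carrier] by blast
qed

definition aug_word :: "'x list list \<Rightarrow> ('x, 'k) ncpoly"
  where "aug_word w = prod_list (map (\<lambda>\<gamma>. if is_chain X R 0 \<gamma> then mon \<gamma> else 0) w)"

abbreviation aug :: "('x list, 'k) ncpoly \<Rightarrow> ('x, 'k) ncpoly"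
  where "aug \<equiv> lin aug_word"

lemma aug_word_append: "aug_word (v @ w) = aug_word v * aug_word w"
  by (simp add: aug_word_def)

lemma aug_mult: "aug (a * b) = aug a * aug b"
  by (rule lin_mult) (rule aug_word_append)

lemma aug_letters: "a \<in> lists X \<Longrightarrow> aug_word (letters a) = mon a"
proof (induction a)
  case (Cons x a)
  then have "is_chain X R 0 [x]" by (auto simp: is_chain_iff_tail intro: chain_tail.zero)
  moreover have "aug_word (letters a) = mon a" using Cons by simp
  ultimately show ?case by (simp add: aug_word_def mon_Cons[of x a, symmetric])
qed (simp add: aug_word_def)

lemma aug_word_positive:
  assumes "w \<in> lists (chains X R)" "0 < wd w"
  shows "aug_word w = 0"
proof -
  have "\<exists>\<gamma>\<in>set w. dg \<gamma> \<noteq> 0" using assms(2) by (induction w) auto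
  then obtain \<gamma> where "\<gamma> \<in> set w" "dg \<gamma> \<noteq> 0" by blast
  then have "\<not> is_chain X R 0 \<gamma>" using chain_degree_eq by metis
  moreover obtain a b where "w = a @ \<gamma> # b" using split_list[OF \<open>\<gamma> \<in> set w\<close>] by blast
  ultimately show ?thesis by (simp add: aug_word_def)
qed

lemma keys_aug_word: "w \<in> lists (chains X R) \<Longrightarrow> keys (aug_word w) \<subseteq> {concat w} \<inter> lists X"
  using wd_0_letters[of w] aug_letters[of "concat w"] aug_word_positive[of w]
  by (cases "wd w = 0") auto

abbreviation d :: "('x list \<Rightarrow> ('x list, 'k) ncpoly) \<Rightarrow> ('x list, 'k) ncpoly \<Rightarrow> ('x list, 'k) ncpoly"
  where "d D \<equiv> lin (der dg D)"

text \<open>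
The requirements on the value \<open>y\<close> of the lifted differential at \<open>\<gamma>\<close>: it has the right degree, leading
part \<open>D' \<gamma>\<close> with respect to underlying monomials, is sent to zero in the algebra and is a cycle. The
last condition involves \<open>D\<close> only at chains of smaller degree than \<open>\<gamma>\<close>.
\<close>

definition good :: "('x list \<Rightarrow> ('x list, 'k) ncpoly) \<Rightarrow> 'x list \<Rightarrow> ('x list, 'k) ncpoly \<Rightarrow> bool"
  where "good D \<gamma> y \<longleftrightarrow> (\<forall>w\<in>keys y. w \<in> lists (chains X R) \<and> wd w + 1 = dg \<gamma>) \<and>
    (\<forall>w\<in>keys (y - D' \<gamma>). concat w \<prec> \<gamma>) \<and> aug y \<in> J \<and> d D y = 0"

definition valid :: "('x list \<Rightarrow> ('x list, 'k) ncpoly) \<Rightarrow> nat \<Rightarrow> bool"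
  where "valid D n \<longleftrightarrow> (\<forall>\<gamma>\<in>chains X R. dg \<gamma> \<le> n \<longrightarrow> good D \<gamma> (D \<gamma>))"

lemma dg_le_wd: "\<gamma> \<in> set w \<Longrightarrow> dg \<gamma> \<le> wd w"
  by (induction w) auto

lemma valid_goodD:
  assumes "valid D n" "w \<in> lists (chains X R)" "wd w \<le> n" "\<gamma> \<in> set w"
  shows "good D \<gamma> (D \<gamma>)"
  using assms dg_le_wd[OF assms(4)] unfolding valid_def by (meson in_listsD order_trans)

lemma der_minus_d':
  assumes "valid D n" "w \<in> lists (chains X R)" "wd w \<le> n" "v \<in> keys (der dg D w - d' w)"
  shows "concat v \<prec> concat w"
proof -
  obtain a x b u where w: "w = a @ x # b" and u: "u \<in> keys (D x - D' x)" and v: "v = a @ u @ b"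
    using keys_der[of v dg "\<lambda>x. D x - D' x" w] assms(4) by (auto simp: der_diff)
  have "concat u \<prec> x" using valid_goodD[OF assms(1-3), of x] u by (auto simp: w good_def)
  moreover have "concat a \<in> lists X" "concat b \<in> lists X"
    using assms(2) concat_chains_in_lists by (auto simp: w)
  ultimately show ?thesis using less_context by (simp add: w v)
qed

lemma keys_der_valid:
  assumes "valid D n" "w \<in> lists (chains X R)" "wd w \<le> n" "v \<in> keys (der dg D w)"
  shows "v \<in> lists (chains X R)" "wd v + 1 = wd w" "(concat v, concat w) \<in> r"
    "concat v \<noteq> concat w \<or> v \<in> keys (d' w :: ('x list, 'k) ncpoly)"
proof -
  obtain a x b u where w: "w = a @ x # b" and u: "u \<in> keys (D x)" and v: "v = a @ u @ b"
    using keys_der[OF assms(4)] by blast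
  have "u \<in> lists (chains X R)" "wd u + 1 = dg x"
    using valid_goodD[OF assms(1-3), of x] u by (auto simp: w good_def)
  then show "v \<in> lists (chains X R)" "wd v + 1 = wd w" using assms(2) by (auto simp: v w)
  have "v \<in> keys (der dg D w - d' w) \<or> v \<in> keys (d' w :: ('x list, 'k) ncpoly)"
    using assms(4) by (auto simp: in_keys_iff lookup_minus)
  then have "concat v \<prec> concat w \<or> v \<in> keys (d' w :: ('x list, 'k) ncpoly)"
    using der_minus_d'[OF assms(1-3)] by blast
  then show "(concat v, concat w) \<in> r" "concat v \<noteq> concat w \<or> v \<in> keys (d' w :: ('x list, 'k) ncpoly)"
    using keys_d'(1) assms(2) le_refl concat_chains_in_lists by metis+
qed

lemma d_square:
  assumes "valid D n" "\<And>w. w \<in> keys b \<Longrightarrow> w \<in> lists (chains X R) \<and> wd w \<le> n"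
  shows "d D (d D b) = 0"
proof -
  have "d D (der dg D w) = 0" if "w \<in> keys b" for w
    by (rule der_square) (use valid_goodD[OF assms(1)] assms(2)[OF that] in \<open>auto simp: good_def\<close>)
  then have "lin (\<lambda>w. d D (der dg D w)) b = lin (\<lambda>w. 0) b" by (rule lin_cong)
  also have "\<dots> = 0" by (simp add: lin_def)
  finally show ?thesis by (simp add: lin_lin)
qed

text \<open>
The place of the change in a lower partner, measured from the end; it is unique by \<open>matched_inj\<close>.
\<close>

definition rank :: "'x list list \<Rightarrow> nat"
  where "rank v = (THE k. \<exists>u. matched u v k)"

lemma rank_eq: "matched u v k \<Longrightarrow> rank v = k"
  unfolding rank_def by (rule the_equality) (auto dest: matched_inj)

lemma matched_d_terms:
  assumes "valid D n" "wd w \<le> n" "matched w v k" "x \<in> keys (der dg D w)" "matched u x k'"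
  shows "concat x \<prec> concat w \<or> concat x = concat w \<and> (x = v \<or> k' < k)"
proof -
  have w: "w \<in> lists (chains X R)" using matched_facts(1)[OF assms(3)] .
  note K = keys_der_valid[OF assms(1) w assms(2,4)]
  show ?thesis
    using K(3,4) matched_terms[OF assms(3) _ assms(5)] by blast
qed

lemma matched_d_coefficient:
  assumes "valid D n" "wd u \<le> n" "matched u v k"
  shows "lookup (der dg D u) v \<noteq> 0"
proof -
  have "v \<notin> keys (der dg D u - d' u)"
    using der_minus_d'[OF assms(1) matched_facts(1)[OF assms(3)] assms(2), of v]
      matched_facts(3)[OF assms(3)] by auto
  then have "lookup (der dg D u) v = lookup (d' u) v" by (simp add: in_keys_iff lookup_minus)
  then show ?thesis using matched_coefficient[OF assms(3)] by simp
qed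

definition lower :: "'x list list \<Rightarrow> bool"
  where "lower v \<longleftrightarrow> (\<exists>u k. matched u v k)"

text \<open>
Homogeneity together with a filtration condition; several bounds are allowed at once because the
bound \<open>\<prec> \<gamma>\<close> need not be of the form \<open>\<preceq> m\<close>.
\<close>

definition bounded :: "'x list set \<Rightarrow> nat \<Rightarrow> ('x list, 'k) ncpoly \<Rightarrow> bool"
  where "bounded M i b \<longleftrightarrow> (\<forall>w\<in>keys b. w \<in> lists (chains X R) \<and> wd w = i \<and> (\<exists>m\<in>M. (concat w, m) \<in> r))"

lemma bounded_lin:
  assumes "\<And>w. w \<in> keys b \<Longrightarrow> bounded M i (F w)"
  shows "bounded M i (lin F b)"
  using assms unfolding bounded_def by (blast dest: keys_lin)

lemma bounded_add: "bounded M i a \<Longrightarrow> bounded M i b \<Longrightarrow> bounded M i (a + b)"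
  unfolding bounded_def using Poly_Mapping.keys_add[of a b] by blast

lemma bounded_scalar: "bounded M i a \<Longrightarrow> bounded M i (scalar c * a)"
  unfolding bounded_def using keys_scalar_mult[of c a] by blast

lemma bounded_mono:
  assumes "bounded M i b" "\<And>m. m \<in> M \<Longrightarrow> \<exists>m'\<in>M'. (m, m') \<in> r"
  shows "bounded M' i b"
  using assms unfolding bounded_def by (meson le_trans')

text \<open>
If \<open>v\<close> is the lower partner of \<open>u\<close>, then subtracting a multiple of the boundary of \<open>u\<close> replaces \<open>v\<close> by
words all of whose lower partners are smaller: either their monomial is smaller, or the monomial is
the same and the change lies further to the right. The recursion ends as the monomial order is a
well-order.
\<close>

lemma reduce_word:
  assumes D: "valid D n"
  shows "v \<in> lists (chains X R) \<Longrightarrow> wd v + 1 \<le> n \<Longrightarrow>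
    \<exists>y. bounded {concat v} (wd v + 1) y \<and> bounded {concat v} (wd v) (mon v - d D y) \<and>
      (\<forall>w\<in>keys (mon v - d D y). \<not> lower w)"
proof (induction "(concat v, rank v)" arbitrary: v
    rule: wf_induct_rule[OF wf_lex_prod[OF order_facts(6) wf_less_than]])
  case 1
  have vX: "(concat v, concat v) \<in> r" using 1(2) concat_chains_in_lists le_refl by blast
  show ?case
  proof (cases "lower v")
    case False
    then show ?thesis using 1(2) vX by (intro exI[of _ 0]) (auto simp: bounded_def)
  next
    case True
    then obtain u k where m: "matched u v k" by (auto simp: lower_def)
    note mf = matched_facts[OF m]
    have un: "wd u \<le> n" using mf(4) 1(3) by simp
    (* the multiple that cancels v *)
    define c where "c = inverse (lookup (der dg D u) v)"
    define b where "b = mon v - scalar c * der dg D u"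
    have "lookup b v = 0"
      using matched_d_coefficient[OF D un m] by (simp add: b_def c_def lookup_minus lookup_scalar_mult)
    then have vb: "v \<notin> keys b" by (simp add: in_keys_iff)
    have kb: "w \<in> keys (der dg D u)" if "w \<in> keys b" for w
    proof -
      have "w \<noteq> v" using vb that by blast
      then show ?thesis
        using that keys_minus_subset[of "mon v" "scalar c * der dg D u"] keys_scalar_mult[of c "der dg D u"]
        by (auto simp: b_def)
    qed
    have "\<exists>y. bounded {concat v} (wd v + 1) y \<and> bounded {concat v} (wd v) (mon w - d D y) \<and>
      (\<forall>w'\<in>keys (mon w - d D y). \<not> lower w')" if w: "w \<in> keys b" for w
    proof -
      have K: "w \<in> lists (chains X R)" "wd w = wd v" "(concat w, concat v) \<in> r"
        using keys_der_valid(1-3)[OF D mf(1) un kb[OF w]] mf(3,4) by simp_all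
      show ?thesis
      proof (cases "lower w")
        case False
        then show ?thesis using K by (intro exI[of _ 0]) (auto simp: bounded_def)
      next
        case True
        then obtain u' k' where m': "matched u' w k'" by (auto simp: lower_def)
        have "w \<noteq> v" using w vb by blast
        then have "((concat w, rank w), (concat v, rank v)) \<in> (r - Id) <*lex*> less_than"
          using matched_d_terms[OF D un m kb[OF w] m'] mf(3) rank_eq[OF m] rank_eq[OF m'] by auto
        from 1(1)[OF this K(1)] obtain y where y: "bounded {concat w} (wd v + 1) y"
            "bounded {concat w} (wd v) (mon w - d D y)" "\<forall>w'\<in>keys (mon w - d D y). \<not> lower w'"
          using K(2) 1(3) by auto
        then show ?thesis
          using bounded_mono[OF y(1), of "{concat v}"] bounded_mono[OF y(2), of "{concat v}"] K(3) by auto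
      qed
    qed
    then obtain Y where Y: "\<And>w. w \<in> keys b \<Longrightarrow> bounded {concat v} (wd v + 1) (Y w)"
        "\<And>w. w \<in> keys b \<Longrightarrow> bounded {concat v} (wd v) (mon w - d D (Y w))"
        "\<And>w w'. w \<in> keys b \<Longrightarrow> w' \<in> keys (mon w - d D (Y w)) \<Longrightarrow> \<not> lower w'" by metis
    define y where "y = scalar c * mon u + lin Y b"
    have "mon v - d D y = b - d D (lin Y b)"
      by (simp add: y_def b_def lin_add lin_scalar)
    also have "\<dots> = lin (\<lambda>w. mon w - d D (Y w)) b"
      by (simp add: lin_fun_diff lin_id lin_lin)
    finally have e: "mon v - d D y = lin (\<lambda>w. mon w - d D (Y w)) b" .
    have "bounded {concat v} (wd v + 1) (mon u)" using mf vX by (simp add: bounded_def)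
    then have "bounded {concat v} (wd v + 1) y"
      unfolding y_def by (intro bounded_add bounded_scalar bounded_lin Y)
    moreover have "bounded {concat v} (wd v) (mon v - d D y)"
      unfolding e by (intro bounded_lin Y)
    moreover have "\<not> lower w" if "w \<in> keys (mon v - d D y)" for w
      using that Y(3) unfolding e by (blast dest: keys_lin)
    ultimately show ?thesis by blast
  qed
qed

lemma reduce:
  assumes D: "valid D n" and z: "bounded M i z" "i + 1 \<le> n"
  obtains y where "bounded M (i + 1) y" "bounded M i (z - d D y)"
    "\<And>w. w \<in> keys (z - d D y) \<Longrightarrow> \<not> lower w"
proof -
  have "\<exists>y. bounded M (i + 1) y \<and> bounded M i (mon v - d D y) \<and> (\<forall>w\<in>keys (mon v - d D y). \<not> lower w)"
    if v: "v \<in> keys z" for v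
  proof -
    have K: "v \<in> lists (chains X R)" "wd v = i" "\<exists>m\<in>M. (concat v, m) \<in> r"
      using z(1) v by (auto simp: bounded_def)
    from reduce_word[OF D K(1)] obtain y where y: "bounded {concat v} (i + 1) y"
        "bounded {concat v} i (mon v - d D y)" "\<forall>w\<in>keys (mon v - d D y). \<not> lower w"
      using K(2) z(2) by auto
    then show ?thesis using bounded_mono[OF y(1), of M] bounded_mono[OF y(2), of M] K(3) by auto
  qed
  then obtain Y where Y: "\<And>v. v \<in> keys z \<Longrightarrow> bounded M (i + 1) (Y v)"
      "\<And>v. v \<in> keys z \<Longrightarrow> bounded M i (mon v - d D (Y v))"
      "\<And>v w. v \<in> keys z \<Longrightarrow> w \<in> keys (mon v - d D (Y v)) \<Longrightarrow> \<not> lower w" by metis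
  have e: "z - d D (lin Y z) = lin (\<lambda>v. mon v - d D (Y v)) z"
    by (simp add: lin_fun_diff lin_id lin_lin)
  show ?thesis
  proof (rule that[of "lin Y z"])
    show "bounded M (i + 1) (lin Y z)" by (intro bounded_lin Y)
    show "bounded M i (z - d D (lin Y z))" unfolding e by (intro bounded_lin Y)
    show "\<not> lower w" if "w \<in> keys (z - d D (lin Y z))" for w
      using that Y(3) unfolding e by (blast dest: keys_lin)
  qed
qed

text \<open>
Choose a largest word \<open>u\<close> of the cycle with respect to the monomial and then to the place of the
change. By acyclicity, the lower partner of \<open>u\<close> occurs in the boundary of no other word of the cycle.
\<close>

lemma upper_cycle_zero:
  assumes D: "valid D n"
    and z: "\<And>w. w \<in> keys z \<Longrightarrow> wd w \<le> n" "\<And>w. w \<in> keys z \<Longrightarrow> \<exists>v k. matched w v k" "d D z = 0"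
  shows "z = 0"
proof -
  obtain V K where VK: "\<And>w. w \<in> keys z \<Longrightarrow> matched w (V w) (K w)" using z(2) by metis
  define less' where "less' = (\<lambda>u w. concat u \<prec> concat w \<or> concat u = concat w \<and> K u < (K w :: nat))"
  have "keys z = {}"
  proof (rule finite_transitivity_chain[of "keys z" less'])
    show "\<not> less' u u" for u by (simp add: less'_def)
    show "less' u w" if "less' u v" "less' v w" for u v w
      using that less_trans[of "concat u" "concat v" "concat w"] by (auto simp: less'_def)
    fix u assume u: "u \<in> keys z"
    show "\<exists>w. w \<in> keys z \<and> less' u w"
    proof (rule ccontr)
      assume no: "\<not> ?thesis"
      have zero: "lookup (der dg D w) (V u) = 0" if w: "w \<in> keys z" "w \<noteq> u" for w
      proof (rule ccontr)
        assume "lookup (der dg D w) (V u) \<noteq> 0"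
        then have "V u \<in> keys (der dg D w)" by (simp add: in_keys_iff)
        from matched_d_terms[OF D z(1)[OF w(1)] VK[OF w(1)] this VK[OF u]]
        have "less' u w \<or> V u = V w"
          using matched_facts(3)[OF VK[OF u]] by (auto simp: less'_def)
        then show False using no w matched_inj VK[OF u] VK[OF w(1)] by metis
      qed
      have "lookup (d D z) (V u) = (\<Sum>w\<in>keys z. lookup z w * lookup (der dg D w) (V u))"
        by (rule lookup_lin)
      also have "\<dots> = (\<Sum>w\<in>{u}. lookup z w * lookup (der dg D w) (V u))"
        by (rule sum.mono_neutral_right) (use u zero in auto)
      finally have "lookup z u * lookup (der dg D u) (V u) = 0" by (simp add: z(3))
      then show False using matched_d_coefficient[OF D z(1)[OF u] VK[OF u]] u
        by (simp add: in_keys_iff)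
    qed
  qed simp
  then show ?thesis by (rule keys_empty_imp_zero)
qed

lemma aug_der:
  assumes "valid D n" "w \<in> lists (chains X R)" "wd w \<le> n"
  shows "aug (der dg D w) \<in> J"
  using assms(2,3)
proof (induction rule: lists.induct)
  case (Cons x w)
  have "good D x (D x)" using valid_goodD[OF assms(1) _ Cons.prems] Cons.hyps by simp
  then have "aug (D x * mon w) \<in> J"
    unfolding aug_mult using keys_aug_word[of w] Cons.hyps by (intro J_mult(2)) (auto simp: good_def)
  moreover have "aug (mon [x] * der dg D w) \<in> J"
    unfolding aug_mult using keys_aug_word[of "[x]"] Cons by (intro J_mult(1)) auto
  ultimately show ?case by (simp add: lin_add lin_sign J_add J_sign)
qed (simp add: J_zero)

text \<open>
The reduced cycle has neither lower partners nor, in positive degree, critical words.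
\<close>

lemma exact_positive:
  assumes D: "valid D n" and z: "bounded M (Suc i) z" "d D z = 0" and n: "i + 2 \<le> n"
  shows "\<exists>y. bounded M (i + 2) y \<and> d D y = z"
proof -
  obtain y where y: "bounded M (Suc i + 1) y" "bounded M (Suc i) (z - d D y)"
    "\<And>w. w \<in> keys (z - d D y) \<Longrightarrow> \<not> lower w"
    by (rule reduce[OF D z(1)]) (use n in auto)
  have "z - d D y = 0"
  proof (rule upper_cycle_zero[OF D])
    fix w assume w: "w \<in> keys (z - d D y)"
    then have W: "w \<in> lists (chains X R)" "wd w = Suc i" using y(2) by (auto simp: bounded_def)
    then show "wd w \<le> n" using n by simp
    show "\<exists>v k. matched w v k"
      using W(1)
    proof (cases rule: matching_cases)
      case (critical a)
      then show ?thesis using wd_letters W(2) by simp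
    qed (use y(3)[OF w] in \<open>auto simp: lower_def\<close>)
  next
    have "d D (d D y) = 0" by (rule d_square[OF D]) (use y(1) n in \<open>auto simp: bounded_def\<close>)
    then show "d D (z - d D y) = 0" by (simp add: lin_diff z(2))
  qed
  then show ?thesis using y(1) by auto
qed

text \<open>
In degree \<open>0\<close> there are no upper partners, so the reduced element consists of critical words, and
its image is a combination of normal monomials in \<open>J\<close>.
\<close>

lemma exact_zero:
  assumes D: "valid D n" and z: "bounded M 0 z" "aug z \<in> J" and n: "1 \<le> n"
  shows "\<exists>y. bounded M 1 y \<and> d D y = z"
proof -
  obtain y where y: "bounded M (0 + 1) y" "bounded M 0 (z - d D y)"
    "\<And>w. w \<in> keys (z - d D y) \<Longrightarrow> \<not> lower w"
    by (rule reduce[OF D z(1)]) (use n in auto)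
  define z' where "z' = z - d D y"
  have crit: "\<exists>a. a \<in> lists X \<and> normal_word R a \<and> w = letters a" if w: "w \<in> keys z'" for w
  proof -
    have W: "w \<in> lists (chains X R)" "wd w = 0" using y(2) w by (auto simp: bounded_def z'_def)
    from W(1) show ?thesis
    proof (cases rule: matching_cases)
      case (upper v k)
      then show ?thesis using matched_facts(4) W(2) by fastforce
    qed (use y(3) w in \<open>auto simp: lower_def z'_def\<close>)
  qed
  have "aug (d D y) = lin (\<lambda>w. aug (der dg D w)) y" by (rule lin_lin)
  also have "\<dots> \<in> J"
    by (intro J_lin aug_der[OF D]) (use y(1) n in \<open>auto simp: bounded_def\<close>)
  finally have "aug z' \<in> J" unfolding z'_def lin_diff using z(2) J_diff by blast
  moreover have "normal_word R a" if "a \<in> keys (aug z')" for a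
    using keys_lin[OF that] crit aug_letters by fastforce
  ultimately have zero: "aug z' = 0" by (rule normal_form_zero)
  have "lookup z' w = 0" for w
  proof (rule ccontr)
    assume "lookup z' w \<noteq> 0"
    then have w: "w \<in> keys z'" by (simp add: in_keys_iff)
    obtain a where a: "a \<in> lists X" "w = letters a" using crit[OF w] by blast
    have "lookup (aug_word v) a = (if v = w then 1 else 0)" if v: "v \<in> keys z'" for v
    proof -
      obtain b where "b \<in> lists X" "v = letters b" using crit[OF v] by blast
      then show ?thesis using aug_letters[of b] a by (simp add: lookup_single when_def)
    qed
    then have "lookup (aug z') a = (\<Sum>v\<in>keys z'. lookup z' v * (if v = w then 1 else 0))"
      unfolding lookup_lin by (intro sum.cong) auto
    also have "\<dots> = lookup z' w" using w by (simp add: if_distrib cong: if_cong)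
    finally show False using zero \<open>lookup z' w \<noteq> 0\<close> by simp
  qed
  then have "z' = 0" by (intro poly_mapping_eqI) simp
  then show ?thesis using y(1) by (auto simp: z'_def)
qed

text \<open>
As the second factor is normal, a relation inside the chain starts at the beginning of the chain,
and by minimality it ends at the end.
\<close>

lemma chain_degree_1:
  assumes "\<gamma> \<in> chains X R" "dg \<gamma> = 1"
  shows "\<gamma> \<in> R"
proof -
  obtain v where "chain_tail (Suc 0) \<gamma> v" using chains_tail[OF assms(1)] assms(2) by auto
  then obtain x where x: "\<gamma> = x # v" "normal_word R v" "minimally_zero R [x] v"
    by cases (auto simp: chain_tail_letter)
  then obtain \<rho> where \<rho>: "\<rho> \<in> R" "sublist \<rho> (x # v)"
    by (auto simp: minimally_zero_def normal_word_def)
  then have "\<not> sublist \<rho> v" using x(2) by (auto simp: normal_word_def)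
  then have "prefix \<rho> (x # v)" using \<rho>(2) by (auto simp: sublist_Cons_right)
  then obtain \<rho>' where \<rho>': "\<rho> = x # \<rho>'" "prefix \<rho>' v"
    using R_length[OF \<rho>(1)] by (cases \<rho>) auto
  have "\<not> strict_prefix \<rho>' v"
    using x(3) \<rho>(1) \<rho>'(1) by (auto simp: minimally_zero_def normal_word_def)
  then show ?thesis using \<rho>' x(1) \<rho>(1) by (auto simp: strict_prefix_def)
qed

text \<open>
The element of the Groebner basis with leading monomial \<open>\<gamma>\<close>, written in separate letters, with the
sign of the only term of \<open>D' \<gamma>\<close>.
\<close>

lemma good_degree_1:
  assumes f: "\<And>x. x \<in> X \<Longrightarrow> good f [x] (f [x])" and \<gamma>: "\<gamma> \<in> chains X R" "dg \<gamma> = 1"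
  shows "\<exists>y. good f \<gamma> y"
proof -
  obtain g where g: "g \<in> G" "\<gamma> = leading_monomial r g"
    using chain_degree_1[OF \<gamma>] R_leading by blast
  have gX: "keys g \<subseteq> lists X" using G_facts(1)[OF g(1)] J_carrier by blast
  have \<gamma>X: "\<gamma> \<in> lists X" using chain_in_lists[OF \<gamma>(1)] .
  have "2 \<le> length \<gamma>" using chain_degree_1[OF \<gamma>] R_length by blast
  then have dec: "decompositions X R \<gamma> = {letters \<gamma>}"
    using wd_0_letters letters_chains[OF \<gamma>X] wd_letters[OF \<gamma>X] \<gamma>(2)
    by (auto simp: decompositions_def word_degree_wdeg)
  define \<epsilon> :: 'k where "\<epsilon> = sg (letters \<gamma>)"
  have D': "D' \<gamma> = scalar \<epsilon> * mon (letters \<gamma>)"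
    by (simp add: monomial_diff_chain_sum dec \<epsilon>_def scalar_mult_mon)
  define y where "y = scalar \<epsilon> * lin (\<lambda>a. mon (letters a)) g"
  have ky: "\<exists>a\<in>keys g. w = letters a" if "w \<in> keys y" for w
    using that keys_scalar_mult[of \<epsilon> "lin (\<lambda>a. mon (letters a)) g"] keys_lin[of w "\<lambda>a. mon (letters a)" g]
    by (auto simp: y_def)
  have "y - D' \<gamma> = scalar \<epsilon> * lin (\<lambda>a. mon (letters a)) (g - mon \<gamma>)"
    by (simp add: y_def D' lin_diff right_diff_distrib)
  then have kd: "\<exists>a\<in>keys (g - mon \<gamma>). w = letters a" if "w \<in> keys (y - D' \<gamma>)" for w
    using that keys_scalar_mult[of \<epsilon> "lin (\<lambda>a. mon (letters a)) (g - mon \<gamma>)"]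
      keys_lin[of w "\<lambda>a. mon (letters a)" "g - mon \<gamma>"] by auto
  have lower: "a \<prec> \<gamma>" if a: "a \<in> keys (g - mon \<gamma>)" for a
  proof -
    have "a \<noteq> \<gamma>" using a G_facts(3)[OF g(1)] g(2) by (auto simp: in_keys_iff lookup_minus)
    moreover have "a \<in> keys g" using a \<open>a \<noteq> \<gamma>\<close>
      by (auto simp: in_keys_iff lookup_minus lookup_single when_def)
    then have "(a, \<gamma>) \<in> r" using leading_monomial(2)[OF G_facts(2)[OF g(1)] gX] g(2) by simp
    ultimately show ?thesis by blast
  qed
  have "aug y = scalar \<epsilon> * lin (\<lambda>a. aug (mon (letters a))) g"
    by (simp add: y_def lin_scalar lin_lin)
  also have "lin (\<lambda>a. aug (mon (letters a))) g = lin mon g"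
    by (rule lin_cong) (simp add: aug_letters[OF subsetD[OF gX]])
  finally have aug: "aug y = scalar \<epsilon> * g" by (simp add: lin_id)
  have fx: "f [x] = 0" if "x \<in> X" for x
    using f[OF that] dg_letter[OF that] by (intro keys_empty_imp_zero) (auto simp: good_def)
  have "der dg f (letters a) = 0" if "a \<in> lists X" for a
    using that by (induction a) (auto simp: fx)
  then have "d f y = lin (\<lambda>w. 0) y"
    by (intro lin_cong) (use ky gX in blast)
  also have "\<dots> = 0" by (simp add: lin_def)
  finally have "d f y = 0" .
  moreover have "w \<in> lists (chains X R) \<and> wd w + 1 = dg \<gamma>" if "w \<in> keys y" for w
    using ky[OF that] gX letters_chains wd_letters \<gamma>(2) by force
  moreover have "concat w \<prec> \<gamma>" if w: "w \<in> keys (y - D' \<gamma>)" for w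
  proof -
    obtain a where "a \<in> keys (g - mon \<gamma>)" "w = letters a" using kd[OF w] by blast
    then show ?thesis using lower[of a] by simp
  qed
  ultimately have "good f \<gamma> y"
    using aug J_scalar[OF G_facts(1)[OF g(1)]] by (simp add: good_def)
  then show ?thesis by blast
qed

text \<open>
Since the square of the monomial differential vanishes at \<open>\<gamma>\<close>, only terms strictly below \<open>\<gamma>\<close> remain
in \<open>z = d (D' \<gamma>)\<close>. This is a cycle, or maps to \<open>J\<close> in degree \<open>0\<close>, hence it bounds strictly below \<open>\<gamma>\<close>.
\<close>

lemma good_degree_ge_2:
  assumes f: "valid f (Suc i)" and \<gamma>: "\<gamma> \<in> chains X R" "dg \<gamma> = Suc (Suc i)"
  shows "\<exists>y. good f \<gamma> y"
proof -
  let ?D' = "D' \<gamma> :: ('x list, 'k) ncpoly"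
  have kD': "w \<in> lists (chains X R)" "wd w = Suc i" "concat w = \<gamma>" if "w \<in> keys ?D'" for w
    using that \<gamma>(2) by (auto simp: keys_monomial_diff_chain decompositions_def word_degree_wdeg)
  define z where "z = d f ?D'"
  have "z = lin (\<lambda>w. der dg f w - d' w) ?D' + lin d' ?D'"
    by (simp add: z_def lin_fun_diff)
  then have "z = lin (\<lambda>w. der dg f w - d' w) ?D'" using monomial_diff_square[OF \<gamma>(1)] by simp
  then have lt: "concat v \<prec> \<gamma>" if "v \<in> keys z" for v
    using keys_lin[of v "\<lambda>w. der dg f w - d' w" ?D'] that der_minus_d'[OF f] kD' by fastforce
  have kz: "v \<in> lists (chains X R) \<and> wd v = i" if v: "v \<in> keys z" for v
  proof -
    obtain w where "w \<in> keys ?D'" "v \<in> keys (der dg f w)" using keys_lin v unfolding z_def by blast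
    then show ?thesis using keys_der_valid(1,2)[OF f, of w v] kD'[of w] by simp
  qed
  let ?M = "{m. m \<prec> \<gamma>}"
  have bz: "bounded ?M i z"
    unfolding bounded_def
  proof (intro ballI conjI)
    fix w assume w: "w \<in> keys z"
    then show "w \<in> lists (chains X R)" "wd w = i" using kz by blast+
    then show "\<exists>m\<in>?M. (concat w, m) \<in> r"
      using lt[OF w] le_refl concat_chains_in_lists by (intro bexI[of _ "concat w"]) auto
  qed
  have "\<exists>y. bounded ?M (i + 1) y \<and> d f y = z"
  proof (cases i)
    case 0
    have "aug z = lin (\<lambda>w. aug (der dg f w)) ?D'" unfolding z_def by (rule lin_lin)
    also have "\<dots> \<in> J"
    proof (rule J_lin)
      fix w assume "w \<in> keys ?D'"
      then show "aug (der dg f w) \<in> J" using aug_der[OF f, of w] kD'[of w] by simp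
    qed
    finally have "aug z \<in> J" .
    then show ?thesis using exact_zero[OF f, of ?M z] bz 0 by simp
  next
    case (Suc i')
    have "d f z = 0" unfolding z_def by (rule d_square[OF f]) (use kD' in auto)
    then show ?thesis using exact_positive[OF f, of ?M i' z] bz Suc by simp
  qed
  then obtain y where y: "bounded ?M (i + 1) y" "d f y = z" by blast
  have ky: "w \<in> lists (chains X R) \<and> wd w = Suc i \<and> concat w \<prec> \<gamma>" if "w \<in> keys y" for w
  proof -
    from y(1) that obtain m where m: "w \<in> lists (chains X R)" "wd w = Suc i" "m \<prec> \<gamma>" "(concat w, m) \<in> r"
      unfolding bounded_def by auto
    then show ?thesis using le_less_trans'[OF m(4,3)] by blast
  qed
  have kd: "w \<in> lists (chains X R) \<and> wd w = Suc i" if "w \<in> keys (?D' - y)" for w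
    using keys_minus_subset[of ?D' y] that kD' ky by blast
  have "aug (?D' - y) = lin (\<lambda>w. 0) (?D' - y)"
    by (rule lin_cong) (use aug_word_positive kd in auto)
  then have "aug (?D' - y) = 0" by (simp add: lin_def)
  moreover have "d f (?D' - y) = 0" by (simp add: lin_diff y(2) z_def)
  moreover have "concat w \<prec> \<gamma>" if "w \<in> keys (?D' - y - ?D')" for w
  proof -
    have "?D' - y - ?D' = - y" by simp
    then show ?thesis using that ky by simp
  qed
  ultimately have "good f \<gamma> (?D' - y)"
    using kd \<gamma>(2) J_zero by (simp add: good_def)
  then show ?thesis by blast
qed

text \<open>
Well-founded recursion on the degree of chains: the requirements at a chain involve only the values
at chains of smaller degree.
\<close>

theorem perturbed_differential: "\<exists>D. \<forall>n. valid D n"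
proof -
  define P where "P = (\<lambda>f \<gamma> y. \<gamma> \<in> chains X R \<longrightarrow> good f \<gamma> y)"
  have "\<exists>f. \<forall>\<gamma>. P f \<gamma> (f \<gamma>)"
  proof (rule dependent_wf_choice[OF wf_measure[of dg]])
    fix f g :: "'x list \<Rightarrow> ('x list, 'k) ncpoly" and \<gamma> y
    assume fg: "\<And>z. (z, \<gamma>) \<in> measure dg \<Longrightarrow> f z = g z"
    have "d f y = d g y" if "\<forall>w\<in>keys y. w \<in> lists (chains X R) \<and> wd w + 1 = dg \<gamma>"
    proof (intro lin_cong der_cong)
      fix w x assume "w \<in> keys y" "x \<in> set w"
      then have "dg x < dg \<gamma>" using that dg_le_wd[of x w] by fastforce
      then show "f x = g x" using fg by simp
    qed
    then show "P f \<gamma> y = P g \<gamma> y" unfolding P_def good_def by auto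
  next
    fix \<gamma> and f :: "'x list \<Rightarrow> ('x list, 'k) ncpoly"
    assume f: "\<And>y. (y, \<gamma>) \<in> measure dg \<Longrightarrow> P f y (f y)"
    have "\<exists>y. good f \<gamma> y" if \<gamma>: "\<gamma> \<in> chains X R"
    proof -
      consider "dg \<gamma> = 0" | "dg \<gamma> = 1" | i where "dg \<gamma> = Suc (Suc i)"
        by (metis One_nat_def not0_implies_Suc)
      then show ?thesis
      proof cases
        case 1
        have "D' \<gamma> = (0 :: ('x list, 'k) ncpoly)" by (rule D'_degree_0[OF 1])
        then show ?thesis using J_zero by (intro exI[of _ 0]) (simp add: good_def)
      next
        case 2
        show ?thesis
          by (rule good_degree_1[OF _ \<gamma> 2]) (use f 2 dg_letter letter_chain in \<open>auto simp: P_def\<close>)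
      next
        case (3 i)
        have "valid f (Suc i)" using f 3 by (auto simp: valid_def P_def)
        then show ?thesis using good_degree_ge_2 \<gamma> 3 by blast
      qed
    qed
    then show "\<exists>y. P f \<gamma> y" by (auto simp: P_def)
  qed
  then show ?thesis by (auto simp: P_def valid_def)
qed

end

section \<open>The lifted differential gives a model\<close>

lemma free_algebra_uminus: "f \<in> carrier (free_algebra S) \<Longrightarrow> \<ominus>\<^bsub>free_algebra S\<^esub> f = - (f :: ('s, 'k::field) ncpoly)"
  by (rule abelian_group.minus_equality[OF ring.is_abelian_group[OF ring_free_algebra]]) auto

lemma keys_add_lists:
  "keys f \<subseteq> lists S \<Longrightarrow> keys g \<subseteq> lists S \<Longrightarrow> keys (f + g :: ('s, 'k::field) ncpoly) \<subseteq> lists S"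
  using Poly_Mapping.keys_add[of f g] by blast

lemma free_algebra_coset:
  "H +>\<^bsub>free_algebra S\<^esub> f = (\<lambda>h. h + f) ` (H :: ('s, 'k::field) ncpoly set)"
  by (auto simp: a_r_coset_def')

locale quotient_of_free_algebra =
  fixes X :: "'x set" and I :: "('x, 'k::field) ncpoly set"
  assumes ideal_I: "ideal I (free_algebra X)"
begin

lemma cls_hom: "cls X I \<in> ring_hom (free_algebra X) (free_algebra X Quot I)"
  by (rule ideal.rcos_ring_hom[OF ideal_I])

lemma I_zero: "0 \<in> I" and I_add: "a \<in> I \<Longrightarrow> b \<in> I \<Longrightarrow> a + b \<in> I"
    and I_uminus: "a \<in> I \<Longrightarrow> - a \<in> I" and I_carrier: "a \<in> I \<Longrightarrow> keys a \<subseteq> lists X"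
proof -
  note G = additive_subgroup.zero_closed[OF ideal.axioms(1)[OF ideal_I]]
    additive_subgroup.a_closed[OF ideal.axioms(1)[OF ideal_I]]
    additive_subgroup.a_inv_closed[OF ideal.axioms(1)[OF ideal_I]] ideal.Icarr[OF ideal_I]
  show "0 \<in> I" "a \<in> I \<Longrightarrow> b \<in> I \<Longrightarrow> a + b \<in> I" using G(1,2) by simp_all
  show "a \<in> I \<Longrightarrow> keys a \<subseteq> lists X" using G(4) by simp
  then show "a \<in> I \<Longrightarrow> - a \<in> I" using G(3)[of a] free_algebra_uminus[of a X] by simp
qed

lemma cls_eq_iff: "cls X I f = cls X I g \<longleftrightarrow> f - g \<in> I"
proof
  assume "cls X I f = cls X I g"
  moreover have "f \<in> cls X I f" unfolding free_algebra_coset using I_zero by force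
  ultimately obtain h where "h \<in> I" "f = h + g" unfolding free_algebra_coset by auto
  then show "f - g \<in> I" by simp
next
  assume fg: "f - g \<in> I"
  show "cls X I f = cls X I g"
    unfolding free_algebra_coset
  proof (intro equalityI image_subsetI)
    fix h assume "h \<in> I"
    then show "h + f \<in> (\<lambda>h. h + g) ` I" using I_add[OF _ fg] by (intro image_eqI[of _ _ "h + (f - g)"]) auto
    show "h + g \<in> (\<lambda>h. h + f) ` I"
      using I_add[OF \<open>h \<in> I\<close> I_uminus[OF fg]] by (intro image_eqI[of _ _ "h + - (f - g)"]) auto
  qed
qed

lemma zero_Quot: "\<zero>\<^bsub>free_algebra X Quot I\<^esub> = I"
  by (simp add: FactRing_def)

lemma cls_zero_iff: "cls X I f = \<zero>\<^bsub>free_algebra X Quot I\<^esub> \<longleftrightarrow> f \<in> I"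
proof -
  have "cls X I 0 = I" unfolding free_algebra_coset by simp
  then show ?thesis using cls_eq_iff[of f 0] by (simp add: zero_Quot)
qed

lemma carrier_Quot: "carrier (free_algebra X Quot I) = cls X I ` carrier (free_algebra X)"
  by (auto simp: FactRing_def A_RCOSETS_def')

end

context groebner_setting
begin

sublocale Q: quotient_of_free_algebra X J
  by (rule quotient_of_free_algebra.intro) (rule ideal_J)

lemma keys_aug:
  assumes "keys b \<subseteq> lists (chains X R)"
  shows "keys (aug b) \<subseteq> lists X"
proof
  fix v assume "v \<in> keys (aug b)"
  then obtain w where "w \<in> keys b" "v \<in> keys (aug_word w)" using keys_lin by blast
  then show "v \<in> lists X" using keys_aug_word[of w] assms by blast
qed

lemma aug_scalar: "aug (scalar c) = scalar c"
  by (simp add: lin_single aug_word_def)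

lemma aug_hom: "aug \<in> ring_hom (free_algebra (chains X R)) (free_algebra X)"
proof (rule ring_hom_memI)
  show "aug \<one>\<^bsub>free_algebra (chains X R)\<^esub> = \<one>\<^bsub>free_algebra X\<^esub>" using aug_scalar[of 1] by simp
qed (use keys_aug in \<open>auto simp: aug_mult lin_add\<close>)

abbreviation phi :: "('x list, 'k) ncpoly \<Rightarrow> ('x, 'k) ncpoly set"
  where "phi b \<equiv> cls X J (aug b)"

lemma phi_hom: "phi \<in> ring_hom (free_algebra (chains X R)) (free_algebra X Quot J)"
  using ring_hom_trans[OF aug_hom Q.cls_hom] by (simp add: comp_def)

lemma chain_grading_iff:
  "b \<in> chain_grading X R n \<longleftrightarrow> (\<forall>w\<in>keys b. w \<in> lists (chains X R) \<and> wd w = n)"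
  by (auto simp: chain_grading_def word_degree_wdeg)

lemma keys_d:
  assumes D: "\<And>n. valid D n" and b: "keys b \<subseteq> lists (chains X R)" and v: "v \<in> keys (d D b)"
  shows "\<exists>w\<in>keys b. v \<in> lists (chains X R) \<and> wd v + 1 = wd w \<and> (concat v, concat w) \<in> r"
proof -
  obtain w where w: "w \<in> keys b" "v \<in> keys (der dg D w)" using keys_lin[OF v] by blast
  then show ?thesis using keys_der_valid(1-3)[OF D[of "wd w"], of w v] b by blast
qed

lemma d_grading_0:
  assumes D: "\<And>n. valid D n" and b: "b \<in> chain_grading X R 0"
  shows "d D b = 0"
proof (rule keys_empty_imp_zero, rule equals0I)
  fix v assume "v \<in> keys (d D b)"
  moreover have "keys b \<subseteq> lists (chains X R)" "\<forall>w\<in>keys b. wd w = 0"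
    using b by (auto simp: chain_grading_iff)
  ultimately show False using keys_d[OF D, of b v] by force
qed

lemma dg_differential_d:
  assumes D: "\<And>n. valid D n"
  shows "dg_differential (free_algebra (chains X R)) scalar (chain_grading X R) (d D)"
  unfolding dg_differential_def
proof (intro conjI allI ballI)
  show "d D \<in> carrier (free_algebra (chains X R)) \<rightarrow> carrier (free_algebra (chains X R))"
    using keys_d[OF D] by (fastforce simp: free_algebra_def)
  show "d D ` chain_grading X R (Suc n) \<subseteq> chain_grading X R n" for n
  proof
    fix c assume "c \<in> d D ` chain_grading X R (Suc n)"
    then obtain b where b: "b \<in> chain_grading X R (Suc n)" "c = d D b" by blast
    then have bk: "keys b \<subseteq> lists (chains X R)" by (auto simp: chain_grading_iff)
    show "c \<in> chain_grading X R n"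
      using keys_d[OF D bk] b by (fastforce simp: chain_grading_iff)
  qed
  show "d D ` chain_grading X R 0 \<subseteq> {\<zero>\<^bsub>free_algebra (chains X R)\<^esub>}"
    using d_grading_0[OF D] by auto
next
  fix n x y
  assume x: "x \<in> (chain_grading X R n :: ('x list, 'k) ncpoly set)"
    and y: "y \<in> carrier (free_algebra (chains X R) :: ('x list, 'k) ncpoly ring)"
  have xk: "keys x \<subseteq> lists (chains X R)" and deg: "\<And>w. w \<in> keys x \<Longrightarrow> wd w = n"
    using x by (auto simp: chain_grading_iff)
  have "keys (d D y) \<subseteq> lists (chains X R)" using keys_d[OF D] y by (fastforce simp: free_algebra_def)
  then have "\<ominus>\<^bsub>free_algebra (chains X R)\<^esub> (x * d D y) = - (x * d D y)"
    using xk by (intro free_algebra_uminus) (simp add: keys_mult_lists)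
  then show "d D (x \<otimes>\<^bsub>free_algebra (chains X R)\<^esub> y) = d D x \<otimes>\<^bsub>free_algebra (chains X R)\<^esub> y
      \<oplus>\<^bsub>free_algebra (chains X R)\<^esub> (if even n then x \<otimes>\<^bsub>free_algebra (chains X R)\<^esub> d D y
        else \<ominus>\<^bsub>free_algebra (chains X R)\<^esub> (x \<otimes>\<^bsub>free_algebra (chains X R)\<^esub> d D y))"
    using lin_der_mult[of x dg n D y] deg by auto
next
  fix x :: "('x list, 'k) ncpoly"
  assume x: "x \<in> carrier (free_algebra (chains X R))"
  show "d D (d D x) = \<zero>\<^bsub>free_algebra (chains X R)\<^esub>"
  proof -
    (* the square was computed with a bound on the degree; inserting 0 covers x = 0 *)
    let ?n = "Max (insert 0 (wd ` keys x))"
    have "d D (d D x) = 0"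
      by (rule d_square[OF D[of ?n]]) (use x in \<open>auto intro!: Max_ge\<close>)
    then show ?thesis by simp
  qed
qed (simp_all add: lin_add lin_scalar)

lemma aug_positive: "b \<in> chain_grading X R (Suc n) \<Longrightarrow> aug b = 0"
proof -
  assume "b \<in> chain_grading X R (Suc n)"
  then have "aug b = lin (\<lambda>w. 0) b"
    by (intro lin_cong aug_word_positive) (auto simp: chain_grading_iff)
  then show ?thesis by (simp add: lin_def)
qed

lemma aug_d:
  assumes D: "\<And>n. valid D n" and b: "keys b \<subseteq> lists (chains X R)"
  shows "aug (d D b) \<in> J"
proof -
  have "lin (\<lambda>w. aug (der dg D w)) b \<in> J"
    by (rule J_lin) (use b aug_der[OF D] in blast)
  then show ?thesis by (simp add: lin_lin)
qed

lemma grading_bounded: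
  assumes "z \<in> chain_grading X R n"
  shows "bounded (lists X) n z"
  unfolding bounded_def
proof (intro ballI conjI)
  fix w assume "w \<in> keys z"
  then show w: "w \<in> lists (chains X R)" "wd w = n" using assms by (auto simp: chain_grading_iff)
  show "\<exists>m\<in>lists X. (concat w, m) \<in> r"
    using concat_chains_in_lists[OF w(1)] le_refl by blast
qed

lemma bounded_grading: "bounded M n y \<Longrightarrow> y \<in> chain_grading X R n"
  by (auto simp: bounded_def chain_grading_iff)

lemma exact_d_positive:
  assumes D: "\<And>n. valid D n" and z: "z \<in> chain_grading X R (Suc n)" "d D z = 0"
  shows "z \<in> d D ` chain_grading X R (Suc (Suc n))"
proof -
  from exact_positive[OF D grading_bounded[OF z(1)] z(2) order_refl] obtain y where
    "bounded (lists X) (n + 2) y" "d D y = z" by blast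
  then show ?thesis using bounded_grading[of "lists X" "n + 2" y] by auto
qed

lemma exact_d_zero:
  assumes D: "\<And>n. valid D n" and z: "z \<in> chain_grading X R 0" "aug z \<in> J"
  shows "z \<in> d D ` chain_grading X R (Suc 0)"
proof -
  from exact_zero[OF D grading_bounded[OF z(1)] z(2) order_refl] obtain y where
    "bounded (lists X) 1 y" "d D y = z" by blast
  then show ?thesis using bounded_grading[of "lists X" 1 y] by auto
qed

lemma grading_diff: "a \<in> chain_grading X R n \<Longrightarrow> b \<in> chain_grading X R n \<Longrightarrow> a - b \<in> chain_grading X R n"
  using keys_minus_subset[of a b] by (auto simp: chain_grading_iff)

lemma grading_add: "a \<in> chain_grading X R n \<Longrightarrow> b \<in> chain_grading X R n \<Longrightarrow> a + b \<in> chain_grading X R n"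
  using Poly_Mapping.keys_add[of a b] by (auto simp: chain_grading_iff)

text \<open>
In positive degrees both homologies vanish. In degree \<open>0\<close> every element is a cycle, the boundaries
are the elements that the augmentation sends to \<open>J\<close>, and separating the letters of monomials lifts
every element of the quotient.
\<close>

lemma quasi_iso_phi:
  assumes D: "\<And>n. valid D n"
  shows "quasi_iso (free_algebra (chains X R)) (chain_grading X R) (d D) (free_algebra X Quot J)
    (\<lambda>n. if n = 0 then carrier (free_algebra X Quot J) else {\<zero>\<^bsub>free_algebra X Quot J\<^esub>})
    (\<lambda>_. \<zero>\<^bsub>free_algebra X Quot J\<^esub>) phi"
  unfolding quasi_iso_def
proof
  fix n
  let ?B = "free_algebra (chains X R) :: ('x list, 'k) ncpoly ring"
  let ?A = "free_algebra X Quot J"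
  let ?GrA = "\<lambda>n::nat. if n = 0 then carrier ?A else {\<zero>\<^bsub>?A\<^esub>}"
  let ?h = "homology_map ?A ?GrA (\<lambda>_. \<zero>\<^bsub>?A\<^esub>) phi n"
  interpret A: ring ?A by (rule ideal.quotient_is_ring[OF ideal_J])
  have bnd: "(\<lambda>_. \<zero>\<^bsub>?A\<^esub>) ` ?GrA (Suc n) = {\<zero>\<^bsub>?A\<^esub>}" by auto
  let ?bd = "d D ` chain_grading X R (Suc n) :: ('x list, 'k) ncpoly set"
  have phi_carrier: "phi z \<in> carrier ?A" if "z \<in> chain_grading X R m" for z m
    using ring_hom_closed[OF phi_hom, of z] that by (auto simp: chain_grading_iff)
  have phi_bd: "phi (b + z) = phi z" if b: "b \<in> ?bd" for b z
  proof -
    obtain y where "y \<in> chain_grading X R (Suc n)" "b = d D y" using b by blast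
    then have "aug b \<in> J" using aug_d[OF D, of y] by (auto simp: chain_grading_iff)
    then show ?thesis by (simp add: Q.cls_eq_iff lin_add)
  qed
  have zero_bd: "0 \<in> ?bd"
    by (rule image_eqI[of _ _ 0]) (auto simp: chain_grading_iff)
  have h: "?h (?bd +>\<^bsub>?B\<^esub> z) = {phi z}" if z: "z \<in> chain_grading X R n" for z
  proof -
    have "phi ` (?bd +>\<^bsub>?B\<^esub> z) = {phi z}"
    proof (intro equalityI subsetI)
      fix c assume "c \<in> phi ` (?bd +>\<^bsub>?B\<^esub> z)"
      then obtain b where "b \<in> ?bd" "c = phi (b + z)" unfolding free_algebra_coset by blast
      then show "c \<in> {phi z}" using phi_bd by simp
    next
      fix c assume "c \<in> {phi z}"
      then have "c = phi (0 + z)" by simp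
      then show "c \<in> phi ` (?bd +>\<^bsub>?B\<^esub> z)" unfolding free_algebra_coset using zero_bd by blast
    qed
    then show ?thesis
      using phi_carrier[OF z] by (simp add: homology_map_def set_add_def')
  qed
  have target: "\<And>a. a \<in> carrier ?A \<Longrightarrow> (\<lambda>_. \<zero>\<^bsub>?A\<^esub>) ` ?GrA (Suc n) +>\<^bsub>?A\<^esub> a = {a}"
    by (simp add: a_r_coset_def')
  show "bij_betw ?h (dg_homology ?B (chain_grading X R) (d D) n) (dg_homology ?A ?GrA (\<lambda>_. \<zero>\<^bsub>?A\<^esub>) n)"
  proof (rule bij_betw_imageI)
    show "inj_on ?h (dg_homology ?B (chain_grading X R) (d D) n)"
    proof (rule inj_onI)
      fix C C' assume "C \<in> dg_homology ?B (chain_grading X R) (d D) n"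
        "C' \<in> dg_homology ?B (chain_grading X R) (d D) n" and eq: "?h C = ?h C'"
      then obtain z z' where z: "z \<in> chain_grading X R n" "d D z = 0" "C = ?bd +>\<^bsub>?B\<^esub> z"
        and z': "z' \<in> chain_grading X R n" "d D z' = 0" "C' = ?bd +>\<^bsub>?B\<^esub> z'"
        by (auto simp: dg_homology_def)
      (* equal images make the difference of the cycles a boundary, by exactness *)
      have "aug (z - z') \<in> J" using eq h[OF z(1)] h[OF z'(1)] z(3) z'(3)
        by (simp add: Q.cls_eq_iff lin_diff)
      moreover have "z - z' \<in> chain_grading X R n" by (rule grading_diff) fact+
      moreover have "d D (z - z') = 0" by (simp add: lin_diff z z')
      ultimately have zz: "z - z' \<in> ?bd"
        using exact_d_positive[OF D] exact_d_zero[OF D] by (cases n) auto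
      have closed: "b + c \<in> ?bd" "b - c \<in> ?bd" if bc: "b \<in> ?bd" "c \<in> ?bd" for b c
      proof -
        obtain y y' where y: "y \<in> chain_grading X R (Suc n)" "b = d D y"
          "y' \<in> chain_grading X R (Suc n)" "c = d D y'" using bc by blast
        have "y + y' \<in> chain_grading X R (Suc n)" "y - y' \<in> chain_grading X R (Suc n)"
          using y grading_add grading_diff by blast+
        then show "b + c \<in> ?bd" "b - c \<in> ?bd"
          using y lin_add[of "der dg D" y y'] lin_diff[of "der dg D" y y'] by (metis image_eqI)+
      qed
      show "C = C'"
        unfolding z(3) z'(3) free_algebra_coset
      proof (intro equalityI image_subsetI)
        fix b assume b: "b \<in> ?bd"
        show "b + z \<in> (\<lambda>b. b + z') ` ?bd"
          by (rule image_eqI[OF _ closed(1)[OF b zz]]) simp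
        show "b + z' \<in> (\<lambda>b. b + z) ` ?bd"
          by (rule image_eqI[OF _ closed(2)[OF b zz]]) simp
      qed
    qed
    have source: "?h ` dg_homology ?B (chain_grading X R) (d D) n =
        (\<lambda>z. {phi z}) ` {z \<in> chain_grading X R n. d D z = 0}"
      unfolding dg_homology_def image_image using h by (intro image_cong) auto
    have tgt: "dg_homology ?A ?GrA (\<lambda>_. \<zero>\<^bsub>?A\<^esub>) n = (\<lambda>a. {a}) ` ?GrA n"
      unfolding dg_homology_def
    proof (rule image_cong)
      fix a assume "a \<in> ?GrA n"
      then have "a \<in> carrier ?A" using A.zero_closed by (cases n) auto
      then show "(\<lambda>_. \<zero>\<^bsub>?A\<^esub>) ` ?GrA (Suc n) +>\<^bsub>?A\<^esub> a = {a}" by (rule target)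
    qed simp
    show "?h ` dg_homology ?B (chain_grading X R) (d D) n = dg_homology ?A ?GrA (\<lambda>_. \<zero>\<^bsub>?A\<^esub>) n"
      unfolding source tgt
    proof (intro equalityI image_subsetI)
      fix z assume z: "z \<in> {z \<in> chain_grading X R n. d D z = 0}"
      have "phi z \<in> ?GrA n"
      proof (cases n)
        case 0
        have "z \<in> chain_grading X R n" using z by blast
        then have "phi z \<in> carrier ?A" by (rule phi_carrier)
        then show ?thesis by (simp only: 0 refl if_True)
      next
        case (Suc m)
        have "z \<in> chain_grading X R n" using z by blast
        then have "aug z = 0" unfolding Suc by (rule aug_positive)
        then have "phi z = \<zero>\<^bsub>?A\<^esub>" using Q.cls_zero_iff J_zero by metis
        then show ?thesis by (simp only: Suc nat.simps if_False singleton_iff)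
      qed
      then show "{phi z} \<in> (\<lambda>a. {a}) ` ?GrA n" by (rule imageI)
    next
      fix a assume a: "a \<in> ?GrA n"
      show "{a} \<in> (\<lambda>z. {phi z}) ` {z \<in> chain_grading X R n. d D z = 0}"
      proof (cases n)
        case 0
        have "a \<in> carrier ?A" using a by (simp only: 0 refl if_True)
        then obtain f where "f \<in> carrier (free_algebra X)" and fa: "a = cls X J f"
          unfolding Q.carrier_Quot by blast
        then have f: "keys f \<subseteq> lists X" by simp
        let ?z = "lin (\<lambda>a. mon (letters a)) f"
        have "\<exists>a\<in>keys f. w = letters a" if "w \<in> keys ?z" for w using keys_lin[OF that] by auto
        then have "w \<in> lists (chains X R) \<and> wd w = 0" if "w \<in> keys ?z" for w
          using letters_chains[OF subsetD[OF f]] wd_letters[OF subsetD[OF f]] that by fastforce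
        then have z: "?z \<in> chain_grading X R 0" unfolding chain_grading_iff by blast
        moreover have "d D ?z = 0" by (rule d_grading_0[OF D z])
        moreover have "aug ?z = lin mon f"
          unfolding lin_lin by (rule lin_cong) (simp add: aug_letters[OF subsetD[OF f]])
        then have "phi ?z = a" by (simp only: lin_id fa)
        ultimately show ?thesis unfolding 0 by blast
      next
        case (Suc m)
        have "a = \<zero>\<^bsub>?A\<^esub>" using a by (simp only: Suc nat.simps if_False singleton_iff)
        moreover have "aug 0 = 0" by (rule lin_zero)
        then have "phi 0 = \<zero>\<^bsub>?A\<^esub>" using Q.cls_zero_iff J_zero by metis
        moreover have "0 \<in> {z \<in> chain_grading X R n. d D z = 0}" by (simp add: chain_grading_iff)
        ultimately show ?thesis by blast
      qed
    qed
  qed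
qed

theorem model_on_chains_d:
  assumes D: "\<And>n. valid D n"
  shows "model_on_chains X R J (d D) phi"
  unfolding model_on_chains_def Let_def
proof (intro conjI)
  let ?A = "free_algebra X Quot J"
  show "dg_hom (free_algebra (chains X R)) scalar (chain_grading X R) (d D) ?A
    (\<lambda>c. cls X J (scalar c)) (\<lambda>n. if n = 0 then carrier ?A else {\<zero>\<^bsub>?A\<^esub>}) (\<lambda>_. \<zero>\<^bsub>?A\<^esub>) phi"
    unfolding dg_hom_def
  proof (intro conjI allI ballI)
    fix n show "phi ` chain_grading X R n \<subseteq> (if n = 0 then carrier ?A else {\<zero>\<^bsub>?A\<^esub>})"
    proof (cases n)
      case 0
      then show ?thesis using ring_hom_closed[OF phi_hom] by (fastforce simp: chain_grading_iff)
    next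
      case (Suc m)
      then show ?thesis using aug_positive Q.cls_zero_iff[of 0] J_zero by (auto simp del: free_algebra_simps)
    qed
  next
    fix x :: "('x list, 'k) ncpoly"
    assume "x \<in> carrier (free_algebra (chains X R))"
    then show "phi (d D x) = \<zero>\<^bsub>?A\<^esub>" using aug_d[OF D, of x] by (simp add: Q.cls_zero_iff)
  qed (simp_all add: phi_hom aug_scalar)
qed (rule dg_differential_d[OF D], rule quasi_iso_phi[OF D])

end

section \<open>The associated graded morphism\<close>

text \<open>
Both filtered algebras of the comparison are images of a free algebra filtered by the underlying
monomials \<open>u\<close>: the model under the identity, the quotient of \<open>TV\<close> by \<open>J\<close> under the quotient map.
\<close>

locale filtered_image = groebner_setting X R r J G
  for X :: "'x set" and R r and J G :: "('x, 'k::field) ncpoly set" +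
  fixes S :: "'s set" and u :: "'s list \<Rightarrow> 'x list"
    and V :: "'b ring" and \<kappa> :: "('s, 'k) ncpoly \<Rightarrow> 'b"
  assumes u_append: "u (v @ w) = u v @ u w"
    and u_in: "w \<in> lists S \<Longrightarrow> u w \<in> lists X"
    and hom: "\<kappa> \<in> ring_hom (free_algebra S) V"
begin

abbreviation L :: "'x list \<Rightarrow> ('s, 'k) ncpoly set" where "L \<equiv> filt_less r u S"
abbreviation E :: "'x list \<Rightarrow> ('s, 'k) ncpoly set" where "E \<equiv> filt_le r u S"
abbreviation H :: "'x list \<Rightarrow> ('s, 'k) ncpoly set" where "H \<equiv> homog u S"

text \<open>
The class of \<open>f\<close> in the associated graded object: the coset of the image of \<open>f\<close> modulo the image of
the strictly smaller part, described by representatives in the free algebra.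
\<close>

definition K :: "'x list \<Rightarrow> ('s, 'k) ncpoly \<Rightarrow> 'b set"
  where "K m f = (\<lambda>g. \<kappa> (g + f)) ` L m"

lemma L_iff: "f \<in> L m \<longleftrightarrow> (\<forall>w\<in>keys f. w \<in> lists S \<and> u w \<prec> m)"
  by (auto simp: filt_less_def)

lemma E_iff: "f \<in> E m \<longleftrightarrow> (\<forall>w\<in>keys f. w \<in> lists S \<and> (u w, m) \<in> r)"
  by (auto simp: filt_le_def)

lemma H_iff: "f \<in> H m \<longleftrightarrow> (\<forall>w\<in>keys f. w \<in> lists S \<and> u w = m)"
  by (auto simp: homog_def)

lemma L_carrier: "f \<in> L m \<Longrightarrow> keys f \<subseteq> lists S"
  by (auto simp: L_iff)

lemma E_carrier: "f \<in> E m \<Longrightarrow> keys f \<subseteq> lists S"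
  by (auto simp: E_iff)

lemma H_carrier: "f \<in> H m \<Longrightarrow> keys f \<subseteq> lists S"
  by (auto simp: H_iff)

lemma L_zero: "0 \<in> L m"
  by (simp add: L_iff)

lemma L_add: "f \<in> L m \<Longrightarrow> g \<in> L m \<Longrightarrow> f + g \<in> L m"
  unfolding L_iff using Poly_Mapping.keys_add[of f g] by blast

lemma L_uminus: "f \<in> L m \<Longrightarrow> - f \<in> L m"
  by (simp add: L_iff)

lemma L_diff: "f \<in> L m \<Longrightarrow> g \<in> L m \<Longrightarrow> f - g \<in> L m"
  using L_add[of f m "- g"] L_uminus by simp

lemma E_add: "f \<in> E m \<Longrightarrow> g \<in> E m \<Longrightarrow> f + g \<in> E m"
  unfolding E_iff using Poly_Mapping.keys_add[of f g] by blast

lemma H_add: "f \<in> H m \<Longrightarrow> g \<in> H m \<Longrightarrow> f + g \<in> H m"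
  unfolding H_iff using Poly_Mapping.keys_add[of f g] by blast

lemma H_diff: "f \<in> H m \<Longrightarrow> g \<in> H m \<Longrightarrow> f - g \<in> H m"
  unfolding H_iff using keys_minus_subset[of f g] by blast

lemma L_E: "f \<in> L m \<Longrightarrow> f \<in> E m"
  by (auto simp: L_iff E_iff)

lemma H_E: "m \<in> lists X \<Longrightarrow> f \<in> H m \<Longrightarrow> f \<in> E m"
  using le_refl by (auto simp: H_iff E_iff)

lemma less_append:
  assumes "(a, l) \<in> r" "(b, m) \<in> r" "a \<noteq> l \<or> b \<noteq> m"
  shows "a @ b \<prec> l @ m"
proof -
  have X: "a \<in> lists X" "l \<in> lists X" "b \<in> lists X" "m \<in> lists X" using assms order_facts(1) by auto
  have 1: "(a @ b, l @ b) \<in> r" using le_context[of a l "[]" b] assms(1) X by simp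
  have 2: "(l @ b, l @ m) \<in> r" using le_context[of b m l "[]"] assms(2) X by simp
  show ?thesis
  proof (cases "a = l")
    case True
    then show ?thesis using assms(3) 2 by auto
  next
    case False
    then have "a @ b \<prec> l @ b" using 1 by simp
    then show ?thesis using less_le_trans'[OF _ 2] by blast
  qed
qed

lemma L_mult:
  assumes "f \<in> E l" "g \<in> E m" "f \<in> L l \<or> g \<in> L m"
  shows "f * g \<in> L (l @ m)"
  unfolding L_iff
proof
  fix w assume "w \<in> keys (f * g)"
  then obtain a b where ab: "a \<in> keys f" "b \<in> keys g" "w = a @ b" using keys_mult_append by blast
  then have "(u a, l) \<in> r" "(u b, m) \<in> r" "u a \<noteq> l \<or> u b \<noteq> m" "a \<in> lists S" "b \<in> lists S"
    using assms by (auto simp: E_iff L_iff)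
  then show "w \<in> lists S \<and> u w \<prec> l @ m" using less_append[of "u a" l "u b" m] ab(3) by (simp add: u_append)
qed

lemma H_mult:
  assumes "f \<in> H l" "g \<in> H m"
  shows "f * g \<in> H (l @ m)"
  unfolding H_iff
proof
  fix w assume "w \<in> keys (f * g)"
  then obtain a b where "a \<in> keys f" "b \<in> keys g" "w = a @ b" using keys_mult_append by blast
  then show "w \<in> lists S \<and> u w = l @ m" using assms by (auto simp: H_iff u_append)
qed

lemma hom_add: "keys f \<subseteq> lists S \<Longrightarrow> keys g \<subseteq> lists S \<Longrightarrow> \<kappa> f \<oplus>\<^bsub>V\<^esub> \<kappa> g = \<kappa> (f + g)"
  using ring_hom_add[OF hom, of f g] by simp

lemma hom_mult: "keys f \<subseteq> lists S \<Longrightarrow> keys g \<subseteq> lists S \<Longrightarrow> \<kappa> f \<otimes>\<^bsub>V\<^esub> \<kappa> g = \<kappa> (f * g)"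
  using ring_hom_mult[OF hom, of f g] by simp

lemma K_cong: "f - f' \<in> L m \<Longrightarrow> K m f = K m f'"
  unfolding K_def
proof (intro equalityI image_subsetI)
  fix g assume f: "f - f' \<in> L m" and g: "g \<in> L m"
  show "\<kappa> (g + f) \<in> (\<lambda>g. \<kappa> (g + f')) ` L m"
    by (rule image_eqI[OF _ L_add[OF g f]]) simp
  show "\<kappa> (g + f') \<in> (\<lambda>g. \<kappa> (g + f)) ` L m"
    by (rule image_eqI[OF _ L_diff[OF g f]]) simp
qed

lemma K_absorb:
  assumes T: "T \<noteq> {}" "\<And>t. t \<in> T \<Longrightarrow> keys t \<subseteq> lists S" and f: "keys f \<subseteq> lists S"
    and rep: "\<And>t. t \<in> T \<Longrightarrow> \<exists>g\<in>L m. \<kappa> t = \<kappa> (g + f)"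
  shows "\<kappa> ` L m <+>\<^bsub>V\<^esub> \<kappa> ` T = K m f"
proof (intro equalityI subsetI)
  fix x assume "x \<in> \<kappa> ` L m <+>\<^bsub>V\<^esub> \<kappa> ` T"
  then obtain g t where g: "g \<in> L m" and t: "t \<in> T" and x: "x = \<kappa> g \<oplus>\<^bsub>V\<^esub> \<kappa> t"
    by (auto simp: set_add_def')
  obtain g' where g': "g' \<in> L m" "\<kappa> t = \<kappa> (g' + f)" using rep[OF t] by blast
  have "x = \<kappa> ((g + g') + f)"
    using hom_add[OF L_carrier[OF g] keys_add_lists[OF L_carrier[OF g'(1)] f]]
    by (simp add: x g'(2) add.assoc)
  then show "x \<in> K m f" unfolding K_def using L_add[OF g g'(1)] by blast
next
  fix x assume "x \<in> K m f"
  then obtain g where g: "g \<in> L m" "x = \<kappa> (g + f)" unfolding K_def by blast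
  obtain t where t: "t \<in> T" using T(1) by blast
  obtain g' where g': "g' \<in> L m" "\<kappa> t = \<kappa> (g' + f)" using rep[OF t] by blast
  have "\<kappa> (g - g') \<oplus>\<^bsub>V\<^esub> \<kappa> t = x"
    using hom_add[OF L_carrier[OF L_diff[OF g(1) g'(1)]] keys_add_lists[OF L_carrier[OF g'(1)] f]]
    by (simp add: g'(2) g(2))
  then show "x \<in> \<kappa> ` L m <+>\<^bsub>V\<^esub> \<kappa> ` T"
    using L_diff[OF g(1) g'(1)] t by (force simp: set_add_def')
qed

lemma coset_K: "keys f \<subseteq> lists S \<Longrightarrow> \<kappa> ` L m +>\<^bsub>V\<^esub> \<kappa> f = K m f"
  unfolding K_def a_r_coset_def' using hom_add L_carrier by (auto simp: image_iff)

lemma K_add: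
  assumes "keys f \<subseteq> lists S" "keys f' \<subseteq> lists S"
  shows "K m f <+>\<^bsub>V\<^esub> K m f' = K m (f + f')"
proof (intro equalityI subsetI)
  fix x assume "x \<in> K m f <+>\<^bsub>V\<^esub> K m f'"
  then obtain g g' where g: "g \<in> L m" "g' \<in> L m" "x = \<kappa> (g + f) \<oplus>\<^bsub>V\<^esub> \<kappa> (g' + f')"
    by (auto simp: set_add_def' K_def)
  then have "x = \<kappa> ((g + f) + (g' + f'))"
    using hom_add[OF keys_add_lists keys_add_lists] L_carrier assms by metis
  then have "x = \<kappa> ((g + g') + (f + f'))" by (simp add: ac_simps)
  then show "x \<in> K m (f + f')" unfolding K_def using L_add[OF g(1,2)] by blast
next
  fix x assume "x \<in> K m (f + f')"
  then obtain g where g: "g \<in> L m" "x = \<kappa> (g + (f + f'))" unfolding K_def by blast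
  have "\<kappa> (g + f) \<oplus>\<^bsub>V\<^esub> \<kappa> (0 + f') = x"
    using hom_add[OF keys_add_lists[OF L_carrier[OF g(1)] assms(1)], of "0 + f'"] assms(2) g(2)
    by (simp add: add.assoc)
  moreover have "\<kappa> (g + f) \<in> K m f" "\<kappa> (0 + f') \<in> K m f'" unfolding K_def using g(1) L_zero by blast+
  ultimately show "x \<in> K m f <+>\<^bsub>V\<^esub> K m f'" unfolding set_add_def' by blast
qed

lemma K_mult:
  assumes f: "f \<in> E l" and f': "f' \<in> E m"
  shows "\<kappa> ` L (l @ m) <+>\<^bsub>V\<^esub> (K l f <#>\<^bsub>V\<^esub> K m f') = K (l @ m) (f * f')"
proof -
  let ?T = "{(g + f) * (g' + f') | g g'. g \<in> L l \<and> g' \<in> L m}"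
  have "K l f <#>\<^bsub>V\<^esub> K m f' = \<kappa> ` ?T"
  proof (intro equalityI subsetI)
    fix x assume "x \<in> K l f <#>\<^bsub>V\<^esub> K m f'"
    then obtain g g' where g: "g \<in> L l" "g' \<in> L m" "x = \<kappa> (g + f) \<otimes>\<^bsub>V\<^esub> \<kappa> (g' + f')"
      by (auto simp: set_mult_def K_def)
    then have "x = \<kappa> ((g + f) * (g' + f'))"
      using hom_mult[OF keys_add_lists keys_add_lists] L_carrier E_carrier f f' by metis
    then show "x \<in> \<kappa> ` ?T" using g by blast
  next
    fix x assume "x \<in> \<kappa> ` ?T"
    then obtain g g' where g: "g \<in> L l" "g' \<in> L m" "x = \<kappa> ((g + f) * (g' + f'))" by blast
    then have "x = \<kappa> (g + f) \<otimes>\<^bsub>V\<^esub> \<kappa> (g' + f')"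
      using hom_mult[OF keys_add_lists keys_add_lists] L_carrier E_carrier f f' by metis
    then show "x \<in> K l f <#>\<^bsub>V\<^esub> K m f'" using g by (auto simp: set_mult_def K_def)
  qed
  moreover have "\<kappa> ` L (l @ m) <+>\<^bsub>V\<^esub> \<kappa> ` ?T = K (l @ m) (f * f')"
  proof (rule K_absorb)
    show "?T \<noteq> {}" using L_zero by blast
    show "keys (f * f') \<subseteq> lists S" by (rule keys_mult_lists[OF E_carrier[OF f] E_carrier[OF f']])
    fix t assume "t \<in> ?T"
    then obtain g g' where t: "g \<in> L l" "g' \<in> L m" "t = (g + f) * (g' + f')" by blast
    show "keys t \<subseteq> lists S"
      unfolding t(3) by (intro keys_mult_lists keys_add_lists L_carrier[OF t(1)] L_carrier[OF t(2)]
          E_carrier[OF f] E_carrier[OF f'])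
    have "g * (g' + f') \<in> L (l @ m)" by (rule L_mult) (use t f' L_E E_add in auto)
    moreover have "f * g' \<in> L (l @ m)" by (rule L_mult) (use t f L_E in auto)
    ultimately have "g * (g' + f') + f * g' \<in> L (l @ m)" by (rule L_add)
    moreover have "t = (g * (g' + f') + f * g') + f * f'"
      by (simp add: t(3) distrib_left distrib_right add.assoc)
    ultimately show "\<exists>g\<in>L (l @ m). \<kappa> t = \<kappa> (g + f * f')" by blast
  qed
  ultimately show ?thesis by simp
qed

lemma top_part:
  assumes "f \<in> E m"
  shows "\<exists>h\<in>H m. f - h \<in> L m"
proof -
  (* the sum of the terms of f with underlying monomial m, and the rest *)
  define h where "h = lin (\<lambda>w. if u w = m then mon w else 0) f"
  define g where "g = lin (\<lambda>w. if u w = m then 0 else mon w) f"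
  have "f - h = lin (\<lambda>w. mon w - (if u w = m then mon w else 0)) f"
    by (simp add: lin_fun_diff lin_id h_def)
  also have "\<dots> = g" unfolding g_def by (rule lin_cong) simp
  finally have "f - h = g" .
  moreover have "h \<in> H m"
    unfolding H_iff
  proof
    fix v assume "v \<in> keys h"
    then obtain w where "w \<in> keys f" "v \<in> keys (if u w = m then mon w else 0 :: ('s, 'k) ncpoly)"
      unfolding h_def using keys_lin by blast
    then show "v \<in> lists S \<and> u v = m" using assms unfolding E_iff by (auto split: if_splits)
  qed
  moreover have "g \<in> L m"
    unfolding L_iff
  proof
    fix v assume "v \<in> keys g"
    then obtain w where "w \<in> keys f" "v \<in> keys (if u w = m then 0 else mon w :: ('s, 'k) ncpoly)"
      unfolding g_def using keys_lin by blast
    then show "v \<in> lists S \<and> u v \<prec> m" using assms unfolding E_iff by (auto split: if_splits)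
  qed
  ultimately show ?thesis by blast
qed

text \<open>
Each coset in the associated graded object has a representative that is homogeneous with respect
to the underlying monomial, so only well-definedness and injectivity depend on the case at hand.
\<close>

lemma gr_identificationI:
  assumes hom0: "\<kappa>0 \<in> ring_hom (free_algebra S) U"
    and \<theta>: "\<And>m h. m \<in> lists X \<Longrightarrow> h \<in> H m \<Longrightarrow> \<theta> m (\<kappa>0 h) = K m h"
    and inj: "\<And>m h h'. m \<in> lists X \<Longrightarrow> h \<in> H m \<Longrightarrow> h' \<in> H m \<Longrightarrow> K m h = K m h' \<Longrightarrow> \<kappa>0 h = \<kappa>0 h'"
    and u_Nil: "u [] = []"
  shows "gr_identification X U (\<lambda>m. \<kappa>0 ` H m) V (\<lambda>m. \<kappa> ` E m) (\<lambda>m. \<kappa> ` L m) \<theta>"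
  unfolding gr_identification_def
proof (intro conjI ballI)
  fix m assume m: "m \<in> lists X"
  show "bij_betw (\<theta> m) (\<kappa>0 ` H m) ((\<lambda>v. \<kappa> ` L m +>\<^bsub>V\<^esub> v) ` \<kappa> ` E m)"
  proof (rule bij_betw_imageI)
    show "inj_on (\<theta> m) (\<kappa>0 ` H m)"
    proof (rule inj_onI)
      fix x y assume "x \<in> \<kappa>0 ` H m" "y \<in> \<kappa>0 ` H m" and eq: "\<theta> m x = \<theta> m y"
      then obtain h h' where h: "h \<in> H m" "x = \<kappa>0 h" "h' \<in> H m" "y = \<kappa>0 h'" by blast
      have "K m h = K m h'" using eq \<theta>[OF m h(1)] \<theta>[OF m h(3)] by (simp only: h(2,4))
      then show "x = y" unfolding h(2,4) by (rule inj[OF m h(1,3)])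
    qed
    have "\<theta> m ` \<kappa>0 ` H m = K m ` H m"
      unfolding image_image by (rule image_cong[OF refl]) (rule \<theta>[OF m])
    also have "\<dots> = K m ` E m"
    proof (intro equalityI image_subsetI)
      show "K m h \<in> K m ` E m" if "h \<in> H m" for h using H_E[OF m that] by blast
      fix f assume "f \<in> E m"
      from top_part[OF this] obtain h where "h \<in> H m" "f - h \<in> L m" by blast
      then show "K m f \<in> K m ` H m" using K_cong[of f h m] by (intro image_eqI[of _ _ h])
    qed
    also have "\<dots> = (\<lambda>v. \<kappa> ` L m +>\<^bsub>V\<^esub> v) ` \<kappa> ` E m"
      unfolding image_image by (rule image_cong[OF refl]) (rule coset_K[OF E_carrier, symmetric])
    finally show "\<theta> m ` \<kappa>0 ` H m = (\<lambda>v. \<kappa> ` L m +>\<^bsub>V\<^esub> v) ` \<kappa> ` E m" .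
  qed
next
  fix m x y assume m: "m \<in> lists X" and "x \<in> \<kappa>0 ` H m" "y \<in> \<kappa>0 ` H m"
  then obtain h h' where h: "h \<in> H m" "x = \<kappa>0 h" "h' \<in> H m" "y = \<kappa>0 h'" by blast
  have "x \<oplus>\<^bsub>U\<^esub> y = \<kappa>0 (h + h')"
    using ring_hom_add[OF hom0, of h h'] H_carrier h by simp
  then show "\<theta> m (x \<oplus>\<^bsub>U\<^esub> y) = \<theta> m x <+>\<^bsub>V\<^esub> \<theta> m y"
    unfolding h(2,4)
    using \<theta>[OF m h(1)] \<theta>[OF m h(3)] \<theta>[OF m H_add[OF h(1,3)]]
      K_add[OF H_carrier[OF h(1)] H_carrier[OF h(3)], of m] by (simp only:)
next
  fix l m x y assume lm: "l \<in> lists X" "m \<in> lists X" and "x \<in> \<kappa>0 ` H l" "y \<in> \<kappa>0 ` H m"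
  then obtain h h' where h: "h \<in> H l" "x = \<kappa>0 h" "h' \<in> H m" "y = \<kappa>0 h'" by blast
  have "x \<otimes>\<^bsub>U\<^esub> y = \<kappa>0 (h * h')"
    using ring_hom_mult[OF hom0, of h h'] H_carrier h by simp
  moreover have "l @ m \<in> lists X" using lm by simp
  ultimately show "\<theta> (l @ m) (x \<otimes>\<^bsub>U\<^esub> y) = \<kappa> ` L (l @ m) <+>\<^bsub>V\<^esub> (\<theta> l x <#>\<^bsub>V\<^esub> \<theta> m y)"
    using \<theta>[OF lm(1) h(1)] \<theta>[OF lm(2) h(3)] \<theta>[OF _ H_mult[OF h(1,3)]]
      K_mult[OF H_E[OF lm(1) h(1)] H_E[OF lm(2) h(3)]] by (simp only: h(2,4))
next
  have one: "1 \<in> H []" by (simp add: H_iff u_Nil zero_list_def)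
  have "\<theta> [] \<one>\<^bsub>U\<^esub> = K [] 1"
    using \<theta>[of "[]" 1] one ring_hom_one[OF hom0] by simp
  also have "\<dots> = \<kappa> ` L [] +>\<^bsub>V\<^esub> \<one>\<^bsub>V\<^esub>"
    using coset_K[of 1 "[]"] H_carrier[OF one] ring_hom_one[OF hom] by simp
  finally show "\<theta> [] \<one>\<^bsub>U\<^esub> = \<kappa> ` L [] +>\<^bsub>V\<^esub> \<one>\<^bsub>V\<^esub>" .
qed

end

context groebner_setting
begin

lemma R_lists: "R \<subseteq> lists X"
proof
  fix \<rho> assume "\<rho> \<in> R"
  then obtain g where "g \<in> G" "\<rho> = leading_monomial r g" using R_leading by blast
  then show "\<rho> \<in> lists X"
    using leading_monomial(1)[of g] G_facts(1,2) J_carrier by blast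
qed

abbreviation J' :: "('x, 'k) ncpoly set" where "J' \<equiv> monomial_ideal X R"

lemma ideal_J': "ideal J' (free_algebra X)"
  unfolding monomial_ideal_def
  by (rule ring.genideal_ideal[OF ring_free_algebra]) (use R_lists in auto)

sublocale Q': quotient_of_free_algebra X J'
  by (rule quotient_of_free_algebra.intro) (rule ideal_J')

lemma mon_J': "w \<in> lists X \<Longrightarrow> mon w \<in> J' \<longleftrightarrow> \<not> normal_word R w"
  using monomial_vanishes_iff[OF R_lists, of w, where 'k = 'k] Q'.cls_zero_iff[of "mon w"] by simp

lemma homog_id: "h \<in> homog id X m \<Longrightarrow> h = scalar (lookup h m) * mon m"
  by (rule poly_mapping_eqI)
    (auto simp: homog_def scalar_mult_mon lookup_single when_def in_keys_iff)

lemma scalar_J':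
  assumes "m \<in> lists X"
  shows "scalar c * mon m \<in> J' \<longleftrightarrow> c = 0 \<or> \<not> normal_word R m"
proof
  assume c: "scalar c * mon m \<in> J'"
  show "c = 0 \<or> \<not> normal_word R m"
  proof (cases "c = 0")
    case False
    have "scalar (inverse c) * (scalar c * mon m) \<in> J'"
      using ideal.I_l_closed[OF ideal_J' c, of "scalar (inverse c)"] by simp
    then have "mon m \<in> J'" using False by (simp add: scalar_scalar)
    then show ?thesis using mon_J'[OF assms] by simp
  qed simp
next
  assume "c = 0 \<or> \<not> normal_word R m"
  then show "scalar c * mon m \<in> J'"
  proof
    assume "\<not> normal_word R m"
    then have "mon m \<in> J'" using mon_J'[OF assms] by simp
    from ideal.I_l_closed[OF ideal_J' this, of "scalar c"] show ?thesis by simp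
  qed (use Q'.I_zero in simp)
qed

text \<open>
Subtracting the multiple \<open>a g b\<close> of a basis element, for a monomial \<open>m = a \<rho> b\<close> with \<open>\<rho>\<close> leading \<open>g\<close>,
leaves smaller monomials only. The converse, in the lemma after this one, is the divisibility of
leading monomials of elements of \<open>J\<close>. Together they identify the associated graded algebra of \<open>A\<close>.
\<close>

lemma J'_imp_lower:
  assumes "m \<in> lists X" "scalar c * mon m \<in> J'"
  shows "\<exists>g\<in>filt_less r id X m. scalar c * mon m - g \<in> J"
proof (cases "c = 0")
  case True
  then show ?thesis using J_zero by (intro bexI[of _ 0]) (auto simp: filt_less_def)
next
  case False
  then have "\<not> normal_word R m" using scalar_J' assms by simp
  then obtain g0 a b where g0: "g0 \<in> G" and m: "m = a @ leading_monomial r g0 @ b"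
    by (auto simp: normal_word_def sublist_def R_leading)
  let ?\<rho> = "leading_monomial r g0"
  have ab: "a \<in> lists X" "b \<in> lists X" using assms(1) by (auto simp: m)
  define p where "p = mon a * (g0 * mon b)"
  have p: "p \<in> J" unfolding p_def using J_mult ab G_facts(1)[OF g0] by simp
  have key: "w \<in> lists X \<and> w \<prec> m" if w: "w \<in> keys (mon m - p)" for w
  proof -
    have "lookup p m = lookup g0 ?\<rho>"
      unfolding p_def m by (simp only: lookup_mult_mon_left lookup_mult_mon_right)
    then have "w \<noteq> m" using w G_facts(3)[OF g0] by (auto simp: in_keys_iff lookup_minus)
    then have "w \<in> keys p" using w by (auto simp: in_keys_iff lookup_minus lookup_single when_def)
    then obtain v where v: "v \<in> keys g0" "w = a @ v @ b"
      unfolding p_def using keys_mult_append[of w "mon a"] keys_mult_append[of _ g0 "mon b"] by fastforce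
    have g0X: "keys g0 \<subseteq> lists X" using G_facts(1)[OF g0] J_carrier by blast
    have "(v, ?\<rho>) \<in> r" using leading_monomial(2)[OF G_facts(2)[OF g0] g0X v(1)] .
    then show ?thesis using le_context[of v ?\<rho> a b] ab \<open>w \<noteq> m\<close> v g0X m by auto
  qed
  have "scalar c * (mon m - p) \<in> filt_less r id X m"
    using key keys_scalar_mult[of c "mon m - p"] by (auto simp: filt_less_def)
  moreover have "scalar c * mon m - scalar c * (mon m - p) \<in> J"
    using J_scalar[OF p, of c] by (simp add: right_diff_distrib)
  ultimately show ?thesis by blast
qed

text \<open>
The leading monomial of \<open>c m - g\<close> is \<open>m\<close> if \<open>c\<close> is nonzero, so a basis element divides it.
\<close>

lemma lower_imp_J':
  assumes m: "m \<in> lists X" and g: "g \<in> filt_less r id X m" and J: "scalar c * mon m - g \<in> J"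
  shows "scalar c * mon m \<in> J'"
proof (cases "c = 0")
  case False
  let ?f = "scalar c * mon m - g"
  have gk: "w \<in> lists X \<and> w \<prec> m" if "w \<in> keys g" for w using g that by (auto simp: filt_less_def)
  have "lookup g m = 0" using gk by (auto simp: in_keys_iff)
  then have "lookup ?f m = c" by (simp add: lookup_minus scalar_mult_mon)
  then have mf: "m \<in> keys ?f" and f0: "?f \<noteq> 0" using False by (auto simp: in_keys_iff)
  have "(w, m) \<in> r" if w: "w \<in> keys ?f" for w
    using keys_minus_subset[of "scalar c * mon m" g] keys_scalar_mult[of c "mon m"] w gk[of w] le_refl[OF m]
    by auto
  then have lm: "leading_monomial r ?f = m"
    using leading_monomial[OF f0 J_carrier[OF J]] mf order_facts(4) by (meson antisymD)
  have "\<exists>g'\<in>G. sublist (leading_monomial r g') (leading_monomial r ?f)"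
    using basis J f0 unfolding reduced_groebner_basis_def groebner_basis_def by blast
  then have "\<not> normal_word R m" unfolding lm by (auto simp: normal_word_def R_leading)
  then show ?thesis using scalar_J'[OF m] by simp
qed (use Q'.I_zero in simp)

lemma aug_filtration:
  assumes "b \<in> filt_le r concat (chains X R) m"
  shows "aug b \<in> filt_le r id X m"
    "b \<in> filt_less r concat (chains X R) m \<Longrightarrow> aug b \<in> filt_less r id X m"
    "b \<in> homog concat (chains X R) m \<Longrightarrow> aug b \<in> homog id X m"
proof -
  have *: "\<exists>w\<in>keys b. v = concat w \<and> v \<in> lists X" if v: "v \<in> keys (aug b)" for v
  proof -
    obtain w where w: "w \<in> keys b" "v \<in> keys (aug_word w)" using keys_lin[OF v] by blast
    then have "w \<in> lists (chains X R)" using assms by (auto simp: filt_le_def)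
    then show ?thesis using keys_aug_word w by blast
  qed
  show "aug b \<in> filt_le r id X m"
    using * assms unfolding filt_le_def free_algebra_simps id_apply by blast
  show "b \<in> filt_less r concat (chains X R) m \<Longrightarrow> aug b \<in> filt_less r id X m"
    using * unfolding filt_less_def free_algebra_simps id_apply by blast
  show "b \<in> homog concat (chains X R) m \<Longrightarrow> aug b \<in> homog id X m"
    using * unfolding homog_def free_algebra_simps id_apply by blast
qed

lemma aug_monomial: "monomial_aug X R b = cls X J' (aug b)"
  by (simp add: monomial_aug_def lin_def aug_word_def)

text \<open>
Two comparisons enter: \<open>d\<close> and \<open>d'\<close> differ by terms with smaller monomials, and a multiple of a
monomial is zero in the monomial algebra iff it is congruent modulo \<open>J\<close> to smaller terms.
\<close>

theorem associated_graded_d: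
  assumes D: "\<And>n. valid D n"
  shows "associated_graded_is_monomial_model X r R J (d D) phi"
proof -
  let ?C = "chains X R"
  let ?B = "free_algebra ?C :: ('x list, 'k) ncpoly ring"
  let ?A = "free_algebra X Quot J"
  let ?A' = "free_algebra X Quot J'"
  interpret B: filtered_image X R r J G ?C concat ?B id
    by unfold_locales (auto simp: concat_chains_in_lists ring_hom_def)
  interpret A: filtered_image X R r J G X id ?A "cls X J"
    by unfold_locales (auto simp: Q.cls_hom)
  let ?\<theta>B = "\<lambda>m b. filt_less r concat ?C m +>\<^bsub>?B\<^esub> b"
  let ?\<theta>A = "\<lambda>m C. cls X J ` filt_less r id X m <+>\<^bsub>?A\<^esub> cls X J ` (C \<inter> homog id X m)"
  have \<theta>B: "?\<theta>B m b = B.K m b" if "keys b \<subseteq> lists ?C" for m b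
    using B.coset_K[OF that, of m] by simp
  have \<theta>A: "?\<theta>A m (cls X J' h) = A.K m h" if m: "m \<in> lists X" and h: "h \<in> homog id X m" for m h
  proof (rule A.K_absorb)
    have "h \<in> cls X J' h" unfolding free_algebra_coset using Q'.I_zero by force
    then show "cls X J' h \<inter> homog id X m \<noteq> {}" using h by blast
    show "keys h \<subseteq> lists X" using A.H_carrier[OF h] .
    fix t assume t: "t \<in> cls X J' h \<inter> homog id X m"
    then show "keys t \<subseteq> lists X" using A.H_carrier by blast
    have "t - h \<in> J'" using t unfolding free_algebra_coset by auto
    moreover have th: "t - h = scalar (lookup (t - h) m) * mon m"
      by (rule homog_id) (use A.H_diff t h in blast)
    ultimately obtain g where g: "g \<in> filt_less r id X m" "t - h - g \<in> J"
      using J'_imp_lower[OF m, of "lookup (t - h) m"] by auto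
    then have "cls X J t = cls X J (g + h)" by (simp add: Q.cls_eq_iff algebra_simps)
    then show "\<exists>g\<in>filt_less r id X m. cls X J t = cls X J (g + h)" using g(1) by blast
  qed
  have dE: "d D b \<in> filt_le r concat ?C m" if "b \<in> filt_le r concat ?C m" for m b
    unfolding B.E_iff
  proof
    fix v assume "v \<in> keys (d D b)"
    from keys_d[OF D B.E_carrier[OF that] this]
    show "v \<in> lists ?C \<and> (concat v, m) \<in> r" using that le_trans' unfolding B.E_iff by blast
  qed
  have dL: "d D b \<in> filt_less r concat ?C m" if "b \<in> filt_less r concat ?C m" for m b
    unfolding B.L_iff
  proof
    fix v assume "v \<in> keys (d D b)"
    from keys_d[OF D B.L_carrier[OF that] this]
    show "v \<in> lists ?C \<and> concat v \<prec> m" using that le_less_trans' unfolding B.L_iff by blast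
  qed
  have d_top: "d D b - monomial_diff X R b \<in> filt_less r concat ?C m" if b: "b \<in> homog concat ?C m" for m b
    unfolding B.L_iff
  proof
    fix v assume v: "v \<in> keys (d D b - monomial_diff X R b)"
    have eq: "d D b - monomial_diff X R b = lin (\<lambda>w. der dg D w - d' w) b"
      by (simp add: monomial_diff_lin lin_fun_diff)
    from keys_lin[OF v[unfolded eq]]
    obtain w where w: "w \<in> keys b" "v \<in> keys (der dg D w - d' w)" by blast
    have wC: "w \<in> lists ?C" "concat w = m" using b w(1) by (auto simp: B.H_iff)
    have "v \<in> keys (der dg D w) \<or> v \<in> keys (d' w :: ('x list, 'k) ncpoly)"
      using keys_minus_subset w(2) by blast
    then have "v \<in> lists ?C"
      using keys_der_valid(1)[OF D[of "wd w"] wC(1)] keys_d'(2)[OF _ wC(1)] by blast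
    then show "v \<in> lists ?C \<and> concat v \<prec> m"
      using der_minus_d'[OF D[of "wd w"] wC(1) order_refl w(2)] wC(2) by simp
  qed
  have "gr_identification X ?B (\<lambda>m. id ` homog concat ?C m) ?B (\<lambda>m. id ` filt_le r concat ?C m)
      (\<lambda>m. id ` filt_less r concat ?C m) ?\<theta>B"
  proof (rule B.gr_identificationI)
    show "id \<in> ring_hom ?B ?B" by (rule B.hom)
    show "?\<theta>B m (id h) = B.K m h" if "m \<in> lists X" "h \<in> homog concat ?C m" for m h
      using \<theta>B B.H_carrier[OF that(2)] by simp
    fix m h h' assume h: "h \<in> homog concat ?C m" "h' \<in> homog concat ?C m" "B.K m h = B.K m h'"
    have "h \<in> B.K m h" unfolding B.K_def using B.L_zero[of m] by force
    then obtain g where g: "g \<in> filt_less r concat ?C m" "h = g + h'" using h(3) unfolding B.K_def by auto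
    then have "h - h' \<in> filt_less r concat ?C m" by simp
    moreover have "h - h' \<in> homog concat ?C m" using B.H_diff h by blast
    ultimately have "keys (h - h') = {}" unfolding B.H_iff B.L_iff by blast
    then have "h - h' = 0" by (rule keys_empty_imp_zero)
    then show "id h = id h'" by simp
  qed simp
  then have grB: "gr_identification X ?B (homog concat ?C) ?B (filt_le r concat ?C) (filt_less r concat ?C) ?\<theta>B"
    by simp
  have grA: "gr_identification X ?A' (\<lambda>m. cls X J' ` homog id X m) ?A (\<lambda>m. cls X J ` filt_le r id X m)
      (\<lambda>m. cls X J ` filt_less r id X m) ?\<theta>A"
  proof (rule A.gr_identificationI[OF Q'.cls_hom \<theta>A])
    fix m h h' assume m: "m \<in> lists X"
      and h: "h \<in> homog id X m" "h' \<in> homog id X m" "A.K m h = A.K m h'"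
    have "cls X J (0 + h) \<in> A.K m h" unfolding A.K_def using A.L_zero[of m] by blast
    then obtain g where g: "g \<in> filt_less r id X m" "cls X J h = cls X J (g + h')"
      using h(3) unfolding A.K_def by auto
    have hh: "h - h' = scalar (lookup (h - h') m) * mon m"
      by (rule homog_id) (use A.H_diff h in blast)
    have "h - h' - g \<in> J" using g(2) by (simp add: Q.cls_eq_iff algebra_simps)
    then have "scalar (lookup (h - h') m) * mon m - g \<in> J" using hh by metis
    from lower_imp_J'[OF m g(1) this] have "h - h' \<in> J'" using hh by metis
    then show "cls X J' h = cls X J' h'" by (simp add: Q'.cls_eq_iff)
  qed simp_all
  have mapB: "gr_map ?B (filt_less r concat ?C) (d D) m (?\<theta>B m b) = ?\<theta>B m (monomial_diff X R b)"
    if b: "b \<in> homog concat ?C m" for m b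
  proof -
    let ?T = "d D ` (\<lambda>g. g + b) ` filt_less r concat ?C m"
    have lifts: "d D (g + b) - monomial_diff X R b \<in> filt_less r concat ?C m"
      if "g \<in> filt_less r concat ?C m" for g
      using B.L_add[OF dL[OF that] d_top[OF b]] by (simp add: lin_add algebra_simps)
    have bk: "keys b \<subseteq> lists ?C" by (rule B.H_carrier[OF b])
    have "keys (d D b) \<subseteq> lists ?C" using keys_d[OF D bk] by blast
    then have "keys (d D b - (d D b - monomial_diff X R b)) \<subseteq> lists ?C"
      using keys_minus_subset[of "d D b" "d D b - monomial_diff X R b"] B.L_carrier[OF d_top[OF b]] by blast
    then have mk: "keys (monomial_diff X R b :: ('x list, 'k) ncpoly) \<subseteq> lists ?C" by simp
    have "id ` filt_less r concat ?C m <+>\<^bsub>?B\<^esub> id ` ?T = B.K m (monomial_diff X R b)"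
    proof (rule B.K_absorb)
      show "?T \<noteq> {}" using B.L_zero by blast
      show "keys (monomial_diff X R b :: ('x list, 'k) ncpoly) \<subseteq> lists ?C" by (rule mk)
      fix t assume "t \<in> ?T"
      then obtain g where g: "g \<in> filt_less r concat ?C m" "t = d D (g + b)" by blast
      have "keys (g + b) \<subseteq> lists ?C" by (rule keys_add_lists[OF B.L_carrier[OF g(1)] bk])
      from keys_d[OF D this] show "keys t \<subseteq> lists ?C" unfolding g(2) by blast
      have "id t = id ((t - monomial_diff X R b) + monomial_diff X R b)" by simp
      then show "\<exists>g\<in>filt_less r concat ?C m. id t = id (g + monomial_diff X R b)"
        using lifts[OF g(1)] unfolding g(2) by blast
    qed
    then show ?thesis
      unfolding gr_map_def \<theta>B[OF mk, symmetric] free_algebra_coset by simp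
  qed
  have mapA: "gr_map ?A (\<lambda>m. cls X J ` filt_less r id X m) phi m (?\<theta>B m b) = ?\<theta>A m (monomial_aug X R b)"
    if m: "m \<in> lists X" and b: "b \<in> homog concat ?C m" for m b
  proof -
    let ?T = "aug ` (\<lambda>g. g + b) ` filt_less r concat ?C m"
    have bE: "b \<in> filt_le r concat ?C m" by (rule B.H_E[OF m b])
    have ab: "aug b \<in> homog id X m" by (rule aug_filtration(3)[OF bE b])
    have "cls X J ` filt_less r id X m <+>\<^bsub>?A\<^esub> cls X J ` ?T = A.K m (aug b)"
    proof (rule A.K_absorb)
      show "?T \<noteq> {}" using B.L_zero by blast
      show "keys (aug b) \<subseteq> lists X" by (rule A.H_carrier[OF ab])
      fix t assume "t \<in> ?T"
      then obtain g where g: "g \<in> filt_less r concat ?C m" "t = aug g + aug b" by (auto simp: lin_add)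
      have ag: "aug g \<in> filt_less r id X m" by (rule aug_filtration(2)[OF B.L_E[OF g(1)] g(1)])
      show "keys t \<subseteq> lists X"
        unfolding g(2) by (rule keys_add_lists[OF A.L_carrier[OF ag] A.H_carrier[OF ab]])
      show "\<exists>g\<in>filt_less r id X m. cls X J t = cls X J (g + aug b)" using ag g(2) by blast
    qed
    moreover have "phi ` (filt_less r concat ?C m +>\<^bsub>?B\<^esub> b) = cls X J ` ?T"
      unfolding image_image[of "cls X J"]
      by (rule arg_cong[of _ _ "image phi"]) (rule free_algebra_coset)
    ultimately have "gr_map ?A (\<lambda>m. cls X J ` filt_less r id X m) phi m (?\<theta>B m b) = A.K m (aug b)"
      unfolding gr_map_def by (simp only:)
    then show ?thesis using \<theta>A[OF m ab] by (simp only: aug_monomial)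
  qed
  show ?thesis
    unfolding associated_graded_is_monomial_model_def Let_def
    using dE dL aug_filtration(1) aug_filtration(2)[OF B.L_E] grB grA mapB mapA
    by (intro conjI ballI image_subsetI imageI) auto
qed

end

section \<open>The model of an algebra with a finite Groebner basis\<close>

theorem theorem5p3:
  fixes X :: "'x set" and r :: "'x list rel"
    and I J G :: "('x, 'k::field) ncpoly set" and R :: "'x list set"
  assumes "finite X"
    and "monomial_order X r"
    and "I \<subseteq> carrier (free_algebra X)"
    and "J = Idl\<^bsub>free_algebra X\<^esub> I"
    and "reduced_groebner_basis r J G"
    and "finite G"
    and "R = leading_monomial r ` G"
    and "\<forall>\<rho>\<in>R. 2 \<le> length \<rho>"
  shows "\<exists>d \<phi>. model_on_chains X R J d \<phi> \<and>
    associated_graded_is_monomial_model X r R J d \<phi> \<and>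
    (\<forall>\<gamma>\<in>chains X R. \<forall>w\<in>Poly_Mapping.keys (d (mon [\<gamma>]) - monomial_diff X R (mon [\<gamma>])).
       (concat w, \<gamma>) \<in> r \<and> concat w \<noteq> \<gamma>)"
proof -
  have "ideal J (free_algebra X)"
    unfolding assms(4) by (rule ring.genideal_ideal[OF ring_free_algebra assms(3)])
  then interpret groebner_setting X R r J G
    by (intro groebner_setting.intro chain_words.intro groebner_setting_axioms.intro) (use assms in auto)
  obtain D where D: "\<And>n. valid D n" using perturbed_differential by blast
  show ?thesis
  proof (intro exI conjI ballI)
    show "model_on_chains X R J (d D) phi" by (rule model_on_chains_d[OF D])
    show "associated_graded_is_monomial_model X r R J (d D) phi" by (rule associated_graded_d[OF D])
    fix \<gamma> w
    assume \<gamma>: "\<gamma> \<in> chains X R" and w: "w \<in> keys (d D (mon [\<gamma>]) - monomial_diff X R (mon [\<gamma>]))"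
    have "good D \<gamma> (D \<gamma>)" using D[of "dg \<gamma>"] \<gamma> by (simp add: valid_def)
    then show "(concat w, \<gamma>) \<in> r" "concat w \<noteq> \<gamma>" using w by (auto simp: good_def)
  qed
qed

end
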